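(* Let $\tau\in L^{1}_{loc}(\mathbb{R})$ be slowly decreasing, vanish on $(-\infty,0)$, and have convergent (improper) Laplace transform $\mathcal{L}\{\tau;s\}=\int_{0}^{\infty}\tau(x)e^{-sx}\,\mathrm{d}x$ for $\Re e\, s>0$. Let $\beta_1\leq\dots\leq\beta_m\in[0,1)$ and $k_1,\dots,k_m\in\mathbb{Z}_{+}$. \begin{enumerate} \item[(i)] If, for some constants $a,b_n,c_n,d_n\in\mathbb{C}$ and $t_n\in\mathbb{R}$, the analytic function $$\mathcal{L}\{\tau;s\}-\frac{a}{s^{2}}-\sum_{n=1}^{N}\frac{b_n}{s-it_n}-\sum_{n=1}^{m}\frac{c_n+d_n\log^{k_n}(1/s)}{s^{\beta_n+1}}$$ has local pseudofunction boundary behavior on $\Re e\, s=0$, then, as $x\to\infty$, $$\tau(x)=ax+\sum_{n=1}^{N}b_ne^{it_nx}+\sum_{n=1}^{m}x^{\beta_n}\left(\frac{c_n}{\Gamma(\beta_n+1)}+d_n\sum_{j=0}^{k_n}\binom{k_n}{j}D_j(\beta_n+1)\log^{k_n-j}x\right)+o(1).$$ \item[(ii)] Suppose that there is a closed null set $E\subset\mathbb{R}$ and constants $b_n\in\mathbb{C}$, $t_n\in\mathbb{R}$ ($n=1,\dots,N$) such that: (I) the analytic function $\mathcal{L}\{\tau;s\}-\sum_{n=1}^{N}\frac{b_n}{s-it_n}$ has local pseudofunction boundary behavior on the open subset $i(\mathbb{R}\setminus E)$ of $\Re e\, s=0$; (II) for every $t\in E$ there is $M_t>0$ with $\sup_{x>0}\left|\int_0^x\tau(u)e^{-itu}\,\mathrm{d}u\right|<M_t$;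 and (III) $E\cap\{t_1,\dots,t_N\}=\emptyset$. Then $\tau(x)=\sum_{n=1}^{N}b_ne^{it_nx}+o(1)$ as $x\to\infty$. \end{enumerate}
   Context: A real-valued function $\tau$ is slowly decreasing if for each $\varepsilon>0$ there is $\delta>0$ with $\liminf_{x\to\infty}\inf_{h\in[0,\delta]}(\tau(x+h)-\tau(x))>-\varepsilon$; a complex-valued function is slowly decreasing if its real and imaginary parts are. $D_j(\omega)=\frac{d^j}{dy^j}\left(\frac{1}{\Gamma(y)}\right)\big|_{y=\omega}$. The Fourier transform is $\hat\varphi(t)=\int_{-\infty}^{\infty}e^{-itx}\varphi(x)\,\mathrm{d}x$, extended to tempered distributions by duality. A tempered distribution $f$ is a pseudofunction if $\hat f\in L^\infty(\mathbb{R})$ and $\hat f(x)\to0$ as $|x|\to\infty$. A distribution $f$ on an open set $U\subseteq\mathbb{R}$ is a local pseudofunction on $U$ if every point of $U$ has an open neighborhood on which $f$ coincides with a pseudofunction (equivalently, $\langle f(t),e^{iht}\varphi(t)\rangle\to0$ as $|h|\to\infty$ for every $\varphi\in\mathcal{D}(U)$). An analytic function $F$ on $\Re e\, s>0$ has local pseudofunction boundary behavior on $iU$ ($U\subseteq\mathbb{R}$ open) if $F(\sigma+it)$ converges as $\sigma\to0^+$ in $\mathcal{D}'(U)$ (i.e. $\int F(\sigma+it)\varphi(t)\,\mathrm{d}t$ converges for every $\varphi\in\mathcal{D}(U)$) to a distribution $f$ which is a local pseudofunction on $U$; "on $\Re e\, s=0$" means $U=\mathbb{R}$. $\log$ denotes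 the principal branch. *)

theory Defs
  imports "HOL-Analysis.Analysis"
begin

definition slowly_decreasing_real :: "(real \<Rightarrow> real) \<Rightarrow> bool" where
  "slowly_decreasing_real f \<longleftrightarrow>
     (\<forall>\<epsilon>>0. \<exists>\<delta>>0.
        Liminf at_top (\<lambda>x. INF h\<in>{0..\<delta>}. ereal (f (x + h) - f x)) > - ereal \<epsilon>)"

definition slowly_decreasing :: "(real \<Rightarrow> complex) \<Rightarrow> bool" where
  "slowly_decreasing f \<longleftrightarrow>
     slowly_decreasing_real (\<lambda>x. Re (f x)) \<and> slowly_decreasing_real (\<lambda>x. Im (f x))"

definition smooth_fun :: "(real \<Rightarrow> complex) \<Rightarrow> bool" where
  "smooth_fun \<phi> \<longleftrightarrow>
     (\<exists>g :: nat \<Rightarrow> real \<Rightarrow> complex. g 0 = \<phi> \<and>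
        (\<forall>n x. (g n has_vector_derivative g (Suc n) x) (at x)))"

definition test_fun :: "real set \<Rightarrow> (real \<Rightarrow> complex) \<Rightarrow> bool" where
  "test_fun U \<phi> \<longleftrightarrow>
     smooth_fun \<phi> \<and> compact (closure {t. \<phi> t \<noteq> 0}) \<and> closure {t. \<phi> t \<noteq> 0} \<subseteq> U"

text \<open>F (analytic on Re s > 0) has local pseudofunction boundary behaviour on iU:
  F(\<sigma> + it) converges in D'(U) as \<sigma> \<rightarrow> 0+ to a distribution f, and f is a local
  pseudofunction on U, i.e. \<langle>f(t), e^{iht} \<phi>(t)\<rangle> \<rightarrow> 0 as |h| \<rightarrow> \<infinity> for all \<phi> in D(U).\<close>
definition local_pseudofunction_bb :: "(complex \<Rightarrow> complex) \<Rightarrow> real set \<Rightarrow> bool" where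
  "local_pseudofunction_bb F U \<longleftrightarrow>
     (\<exists>f :: (real \<Rightarrow> complex) \<Rightarrow> complex.
        (\<forall>\<phi>. test_fun U \<phi> \<longrightarrow>
           ((\<lambda>\<sigma>. integral UNIV (\<lambda>t. F (Complex \<sigma> t) * \<phi> t)) \<longlongrightarrow> f \<phi>) (at_right 0)) \<and>
        (\<forall>\<phi>. test_fun U \<phi> \<longrightarrow>
           ((\<lambda>h::real. f (\<lambda>t. exp (\<i> * of_real (h * t)) * \<phi> t)) \<longlongrightarrow> 0) at_infinity))"

definition laplace_trunc :: "(real \<Rightarrow> complex) \<Rightarrow> complex \<Rightarrow> real \<Rightarrow> complex" where
  "laplace_trunc \<tau> s T = integral {0..T} (\<lambda>x. \<tau> x * exp (- s * of_real x))"

definition laplace_converges :: "(real \<Rightarrow> complex) \<Rightarrow> complex \<Rightarrow> bool" where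
  "laplace_converges \<tau> s \<longleftrightarrow> (\<exists>l. (laplace_trunc \<tau> s \<longlongrightarrow> l) at_top)"

definition laplace :: "(real \<Rightarrow> complex) \<Rightarrow> complex \<Rightarrow> complex" where
  "laplace \<tau> s = Lim at_top (laplace_trunc \<tau> s)"

definition Dj :: "nat \<Rightarrow> real \<Rightarrow> real" where
  "Dj j \<omega> = (deriv ^^ j) (rGamma :: real \<Rightarrow> real) \<omega>"

end

theory Submission
  imports Defs "HOL-Complex_Analysis.Complex_Analysis"
begin

text \<open>
  Subtracting the main terms, whose Laplace transforms are explicit, reduces both parts to one statement:
  a slowly decreasing \<open>g\<close> whose Laplace transform has local pseudofunction boundary behaviour off a closed
  null set \<open>E\<close>, and whose partial integrals against \<open>e\<^sup>-\<^sup>i\<^sup>u\<^sup>x\<close> are bounded for each \<open>u \<in> E\<close>, tends to \<open>0\<close>;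
  part (i) is the case \<open>E = {}\<close>.

  First, \<open>g\<close> is bounded. If \<open>0 \<in> E\<close> this is immediate from the bounded partial integrals. Otherwise a test
  function near \<open>0\<close> with nonnegative Fourier transform \<open>K\<close> is available; since slow decrease bounds \<open>g\<close>
  linearly from below, monotone convergence as \<open>\<sigma> \<rightarrow> 0+\<close> shows that \<open>\<integral> g(x) K(x - h) dx\<close> converges absolutely
  and tends to \<open>0\<close>, and slow decrease turns this into a bound for \<open>g\<close>.
  For bounded \<open>g\<close> the boundary behaviour says that \<open>\<integral> g(x) (F \<phi>)(x - h) dx \<rightarrow> 0\<close> for every test function \<open>\<phi>\<close>
  supported off \<open>E\<close>, with \<open>F\<close> the Fourier transform. Let \<open>P \<subseteq> E\<close> be the set of points near which this fails. If \<open>P\<close> is nonempty, Baire's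
  theorem gives an interval meeting \<open>P\<close> on which the bounds for the partial integrals are uniform over \<open>P\<close>.
  Cut \<open>\<phi>\<close> into pieces of width \<open>\<delta>\<close>: a piece near \<open>P\<close> contributes \<open>O(\<delta>)\<close> by an integration by parts, and as
  \<open>P\<close> is null there are only \<open>o(1/\<delta>)\<close> of them; so \<open>P\<close> is empty. With all test functions allowed,
  an approximate identity and slow decrease give \<open>g \<rightarrow> 0\<close>.
\<close>

subsection \<open>Smooth functions\<close>

text \<open>The obstacle throughout is convergence: the Laplace integral of \<open>\<tau>\<close> is
  only improper, and nothing is known about the size of \<open>\<tau>\<close>, so neither Fubini nor
  a limit under the integral is available. The one-sided linear bound first makes the improper
  integral absolutely convergent for Re s > 0. At the boundary the sign of the kernel is decisive;
  it is the squared modulus of a transform, hence the transform of an autocorrelation, which has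
  compact support. The bound for \<open>g\<close> comes from a self-improving inequality: in a norm
  with weight 1 + \<epsilon> x, known to be finite, the kernel average bounds the norm by a constant
  plus half of itself, uniformly in \<epsilon>. In the localisation, the gain of a factor \<delta>
  arises as follows: twisting by the exponential of frequency u in P turns integration by parts into
  multiplication of the piece by t - u, which is at most 2 \<delta> on it. All power and logarithm
  terms come from one formula: x^(w-1) / Gamma(w) has transform s^(-w). Differentiating k times in w
  produces log^k(1/s) on one side and, by the Leibniz rule, the numbers D_j on the other.\<close>

lemma smooth_fun_coinduct:
  assumes "f \<in> S" and step: "\<And>f. f \<in> S \<Longrightarrow> \<exists>f'\<in>S. \<forall>x. (f has_vector_derivative f' x) (at x)"
  shows "smooth_fun f"
proof -
  \<comment> \<open>The tower of derivatives is built by dependent choice inside \<open>S\<close>;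
    the clause for n = 0 pins its bottom to \<open>f\<close>. A set closed under differentiation
    thus consists of smooth functions, and no formula for n-th derivatives is required.\<close>
  have "\<exists>g. \<forall>n. g n \<in> S \<and> (n = 0 \<longrightarrow> g n = f) \<and> (\<forall>x. (g n has_vector_derivative g (Suc n) x) (at x))"
  proof (rule dependent_nat_choice[where P = "\<lambda>n u. u \<in> S \<and> (n = 0 \<longrightarrow> u = f)"
        and Q = "\<lambda>n u v. \<forall>x. (u has_vector_derivative v x) (at x)", simplified conj_assoc])
    show "\<exists>x. x \<in> S \<and> (0 = 0 \<longrightarrow> x = f)" using assms(1) by auto
  next
    fix x :: "real \<Rightarrow> complex" and n :: nat
    assume "x \<in> S \<and> (n = 0 \<longrightarrow> x = f)"
    then show "\<exists>y. y \<in> S \<and> (Suc n = 0 \<longrightarrow> y = f) \<and> (\<forall>z. (x has_vector_derivative y z) (at z))"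
      using step[of x] by auto
  qed
  then obtain g where "\<And>n. (n = 0 \<longrightarrow> g n = f) \<and> (\<forall>x. (g n has_vector_derivative g (Suc n) x) (at x))"
    by blast
  then show ?thesis unfolding smooth_fun_def by (intro exI[of _ g]) auto
qed

lemma smooth_funE:
  assumes "smooth_fun f"
  obtains f' where "smooth_fun f'" "\<And>x. (f has_vector_derivative f' x) (at x)"
proof -
  obtain g where g: "g 0 = f" "\<And>n x. (g n has_vector_derivative g (Suc n) x) (at x)"
    using assms unfolding smooth_fun_def by blast
  have "smooth_fun (g 1)" unfolding smooth_fun_def
    using g(2) by (intro exI[of _ "\<lambda>n. g (Suc n)"]) auto
  then show thesis using that[of "g 1"] g(1) g(2)[of 0] by simp
qed

text \<open>A product differentiates to a sum of products, so a set stable under differentiation has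
  to allow both operations. This closure is stable by the product rule, which spares the Leibniz
  formula for n-th derivatives.\<close>

inductive_set smooth_closure :: "(real \<Rightarrow> complex) set \<Rightarrow> (real \<Rightarrow> complex) set" for A where
  base: "f \<in> A \<Longrightarrow> f \<in> smooth_closure A"
| add: "f \<in> smooth_closure A \<Longrightarrow> g \<in> smooth_closure A \<Longrightarrow> (\<lambda>x. f x + g x) \<in> smooth_closure A"
| mult: "f \<in> smooth_closure A \<Longrightarrow> g \<in> smooth_closure A \<Longrightarrow> (\<lambda>x. f x * g x) \<in> smooth_closure A"

lemma smooth_closure:
  assumes A: "\<And>f. f \<in> A \<Longrightarrow> \<exists>f'\<in>smooth_closure A. \<forall>x. (f has_vector_derivative f' x) (at x)"
    and "f \<in> smooth_closure A"
  shows "smooth_fun f"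
proof (rule smooth_fun_coinduct[OF assms(2)])
  fix f assume "f \<in> smooth_closure A"
  then show "\<exists>f'\<in>smooth_closure A. \<forall>x. (f has_vector_derivative f' x) (at x)"
  proof induction
    case (base f) then show ?case using A by blast
  next
    case (add f g)
    then obtain f' g' where "f' \<in> smooth_closure A" "g' \<in> smooth_closure A"
      "\<forall>x. (f has_vector_derivative f' x) (at x)" "\<forall>x. (g has_vector_derivative g' x) (at x)" by blast
    then show ?case
      by (intro bexI[of _ "\<lambda>x. f' x + g' x"]) (auto intro: smooth_closure.add intro!: derivative_intros)
  next
    case (mult f g)
    then obtain f' g' where "f' \<in> smooth_closure A" "g' \<in> smooth_closure A"
      "\<forall>x. (f has_vector_derivative f' x) (at x)" "\<forall>x. (g has_vector_derivative g' x) (at x)" by blast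
    with mult show ?case
      by (intro bexI[of _ "\<lambda>x. f x * g' x + f' x * g x"])
        (auto intro: smooth_closure.intros intro!: has_vector_derivative_mult)
  qed
qed

lemma smooth_closure_smooth: "f \<in> smooth_closure (Collect smooth_fun) \<Longrightarrow> smooth_fun f"
proof (rule smooth_closure)
  fix f assume "f \<in> Collect smooth_fun"
  then show "\<exists>f'\<in>smooth_closure (Collect smooth_fun). \<forall>x. (f has_vector_derivative f' x) (at x)"
    by (metis smooth_funE smooth_closure.base mem_Collect_eq)
qed

lemma smooth_fun_add: "smooth_fun f \<Longrightarrow> smooth_fun g \<Longrightarrow> smooth_fun (\<lambda>x. f x + g x)"
  by (intro smooth_closure_smooth smooth_closure.intros) auto

lemma smooth_fun_mult: "smooth_fun f \<Longrightarrow> smooth_fun g \<Longrightarrow> smooth_fun (\<lambda>x. f x * g x)"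
  by (intro smooth_closure_smooth smooth_closure.intros) auto

lemma smooth_fun_const: "smooth_fun (\<lambda>x. c)"
  by (rule smooth_fun_coinduct[where S = "range (\<lambda>c x. c)"]) (auto intro!: exI[of _ 0])

lemma smooth_fun_antideriv:
  assumes "smooth_fun f'" "\<And>x. (f has_vector_derivative f' x) (at x)"
  shows "smooth_fun f"
proof (rule smooth_fun_coinduct[where S = "insert f (Collect smooth_fun)"])
  fix g assume "g \<in> insert f (Collect smooth_fun)"
  then show "\<exists>g'\<in>insert f (Collect smooth_fun). \<forall>x. (g has_vector_derivative g' x) (at x)"
    using assms by (metis insert_iff mem_Collect_eq smooth_funE)
qed simp

lemma smooth_fun_of_real: "smooth_fun of_real"
  using smooth_fun_const[of 1]
  by (rule smooth_fun_antideriv) (auto intro!: derivative_eq_intros)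

lemma smooth_fun_affine:
  assumes "smooth_fun f" shows "smooth_fun (\<lambda>x. f (a * x + b))"
proof -
  obtain g where g: "g 0 = f" "\<And>n x. (g n has_vector_derivative g (Suc n) x) (at x)"
    using assms unfolding smooth_fun_def by blast
  have "((\<lambda>x. of_real a ^ n * g n (a * x + b)) has_vector_derivative 
          of_real a ^ Suc n * g (Suc n) (a * x + b)) (at x)" for n x
  proof -
    have "((g n \<circ> (\<lambda>x. a * x + b)) has_vector_derivative a *\<^sub>R g (Suc n) (a * x + b)) (at x)"
      by (rule vector_diff_chain_at) (auto intro!: derivative_eq_intros g(2))
    from has_vector_derivative_mult_right[OF this, of "of_real a ^ n"] show ?thesis
      by (simp add: o_def scaleR_conv_of_real mult_ac)
  qed
  then show ?thesis unfolding smooth_fun_def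
    by (intro exI[of _ "\<lambda>n x. of_real a ^ n * g n (a * x + b)"]) (auto simp: g(1))
qed

lemma smooth_fun_exp: "smooth_fun (\<lambda>x. exp (c * of_real x))"
proof -
  have "((\<lambda>x. c ^ n * exp (c * of_real x)) has_vector_derivative c ^ Suc n * exp (c * of_real x)) (at x)" for n x
    by (rule has_vector_derivative_real_field) (auto intro!: derivative_eq_intros)
  then show ?thesis unfolding smooth_fun_def
    by (intro exI[of _ "\<lambda>n x. c ^ n * exp (c * of_real x)"]) auto
qed

lemma smooth_fun_continuous: "smooth_fun f \<Longrightarrow> continuous_on S f"
  by (metis smooth_funE has_vector_derivative_continuous continuous_at_imp_continuous_on)

section \<open>Bump functions, smooth steps and a partition of unity\<close>

text \<open>The classical flat function exp(-1/x), with a polynomial in 1/x as a factor so that the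
  family is stable under differentiation.\<close>

definition flat_exp :: "real poly \<Rightarrow> real \<Rightarrow> real" where
  "flat_exp p x = (if x > 0 then poly p (1/x) * exp (-1/x) else 0)"

lemma poly_exp_tendsto_0: "((\<lambda>y. poly p y * exp (-y)) \<longlongrightarrow> (0::real)) at_top"
proof -
  have "((\<lambda>y. \<Sum>i\<le>degree p. coeff p i * (y ^ i / exp y)) \<longlongrightarrow> (\<Sum>i\<le>degree p. coeff p i * 0)) at_top"
    by (intro tendsto_intros tendsto_power_div_exp_0)
  then show ?thesis
    by (simp add: poly_altdef sum_distrib_right exp_minus divide_inverse mult.assoc)
qed

text \<open>With y = 1/x one has dy/dx = -y^2, so p(y) exp(-y) differentiates to y^2 (p - p')(y)
  exp(-y); the factor \<open>[:0,0,1:]\<close> is this y^2. At 0 it suffices that the exponential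
  beats every polynomial.\<close>

lemma has_derivative_flat_exp:
  "(flat_exp p has_real_derivative flat_exp ([:0,0,1:] * (p - pderiv p)) x) (at x)"
proof -
  consider "x > 0" | "x < 0" | "x = 0" by linarith
  then show ?thesis
  proof cases
    case 1
    have "((\<lambda>x. poly p (1/x) * exp (-1/x)) has_real_derivative flat_exp ([:0,0,1:] * (p - pderiv p)) x) (at x)"
      unfolding flat_exp_def using 1
      by (auto intro!: derivative_eq_intros DERIV_chain2[OF poly_DERIV] simp: field_simps power2_eq_square)
    moreover have "\<forall>\<^sub>F y in nhds x. flat_exp p y = poly p (1/y) * exp (-1/y)"
      using eventually_nhds_in_open[of "{0<..}" x] 1 by (auto simp: flat_exp_def elim: eventually_mono)
    ultimately show ?thesis by (subst DERIV_cong_ev[OF refl _ refl])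
  next
    case 2
    have "\<forall>\<^sub>F y in nhds x. flat_exp p y = 0"
      using eventually_nhds_in_open[of "{..<0}" x] 2 by (auto simp: flat_exp_def elim: eventually_mono)
    then show ?thesis using 2
      by (subst DERIV_cong_ev[where g = "\<lambda>_. 0"]) (auto simp: flat_exp_def)
  next
    case 3
    \<comment> \<open>Dividing the increment by h multiplies by 1/h, that is, puts a zero
      coefficient in front of \<open>p\<close>.\<close>
    have "((\<lambda>h. poly (pCons 0 p) (1/h) * exp (-(1/h))) \<longlongrightarrow> 0) (at_right 0)"
      using filterlim_compose[OF poly_exp_tendsto_0 filterlim_inverse_at_top_right, of "pCons 0 p"]
      by (simp add: inverse_eq_divide)
    then have "((\<lambda>h. flat_exp p h / h) \<longlongrightarrow> 0) (at_right 0)"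
    proof (rule Lim_transform_eventually)
      show "\<forall>\<^sub>F h in at_right 0. poly (pCons 0 p) (1/h) * exp (-(1/h)) = flat_exp p h / h"
        using eventually_at_right_less[of 0] by eventually_elim (auto simp: flat_exp_def)
    qed
    moreover have "((\<lambda>h. flat_exp p h / h) \<longlongrightarrow> 0) (at_left 0)"
      by (rule tendsto_eventually) (auto simp: eventually_at_left_field flat_exp_def intro!: exI[of _ "-1"])
    ultimately have "((\<lambda>h. flat_exp p h / h) \<longlongrightarrow> 0) (at 0)"
      by (simp add: filterlim_at_split)
    then show ?thesis using 3 by (simp add: DERIV_def flat_exp_def)
  qed
qed

lemma smooth_fun_flat_exp: "smooth_fun (\<lambda>x. of_real (flat_exp p x))"
proof (rule smooth_fun_coinduct[where S = "range (\<lambda>p x. of_real (flat_exp p x))"])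
  fix f :: "real \<Rightarrow> complex" assume "f \<in> range (\<lambda>p x. of_real (flat_exp p x))"
  then obtain p where f: "f = (\<lambda>x. of_real (flat_exp p x))" by auto
  show "\<exists>f'\<in>range (\<lambda>p x. of_real (flat_exp p x)). \<forall>x. (f has_vector_derivative f' x) (at x)"
    unfolding f by (rule bexI[of _ "\<lambda>x. of_real (flat_exp ([:0,0,1:] * (p - pderiv p)) x)"])
      (auto simp del: mult_pCons_left intro!: has_vector_derivative_of_real has_derivative_flat_exp)
qed auto

definition bump :: "real \<Rightarrow> real" where
  "bump x = flat_exp 1 x * flat_exp 1 (1 - x)"

lemma smooth_fun_bump: "smooth_fun (\<lambda>x. of_real (bump x))"
  using smooth_fun_mult[OF smooth_fun_flat_exp[of 1] smooth_fun_affine[OF smooth_fun_flat_exp[of 1], of "-1" 1]]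
  by (simp add: bump_def)

lemma bump_eq_0: "x \<le> 0 \<or> x \<ge> 1 \<Longrightarrow> bump x = 0"
  and bump_pos: "0 < x \<Longrightarrow> x < 1 \<Longrightarrow> bump x > 0"
  by (auto simp: bump_def flat_exp_def)

lemma bump_nonneg: "bump x \<ge> 0"
  by (auto simp: bump_def flat_exp_def)

lemma continuous_on_bump: "continuous_on S bump"
proof -
  have "continuous_on S (\<lambda>x. Re (complex_of_real (bump x)))"
    by (intro continuous_intros smooth_fun_continuous smooth_fun_bump)
  then show ?thesis by simp
qed

text \<open>The integral starts at -1 and not at the edge 0 of the support, so that 0 is interior to
  the interval of integration and the fundamental theorem gives a two-sided derivative
  there.\<close>

definition smooth_step :: "real \<Rightarrow> real" where
  "smooth_step x = integral {-1..x} bump / integral {0..1} bump"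

lemma integral_bump_pos: "integral {0..1} bump > 0"
proof -
  have int: "bump integrable_on {0..1}" by (intro integrable_continuous_interval continuous_on_bump)
  have "integral {0..1} bump \<noteq> 0"
  proof
    assume "integral {0..1} bump = 0"
    then have "(bump has_integral 0) (cbox 0 1)" using integrable_integral[OF int] by simp
    from has_integral_0_cbox_imp_0[OF _ _ this, of "1/2"] 
    have "bump (1/2) = 0" using continuous_on_bump bump_nonneg by (auto simp: box_real)
    then show False using bump_pos[of "1/2"] by simp
  qed
  moreover have "integral {0..1} bump \<ge> 0" by (intro integral_nonneg int bump_nonneg)
  ultimately show ?thesis by simp
qed

lemma integral_bump_left: "x \<le> 0 \<Longrightarrow> integral {-1..x} bump = 0"
  by (subst integral_cong[where g = "\<lambda>_. 0"]) (auto simp: bump_eq_0)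

lemma smooth_step_0: "x \<le> 0 \<Longrightarrow> smooth_step x = 0"
  by (simp add: smooth_step_def integral_bump_left)

lemma smooth_step_1: assumes "x \<ge> 1" shows "smooth_step x = 1"
proof -
  have int: "bump integrable_on {a..b}" for a b by (intro integrable_continuous_interval continuous_on_bump)
  have "integral {-1..x} bump = integral {-1..0} bump + integral {0..x} bump"
    using assms by (intro Henstock_Kurzweil_Integration.integral_combine[symmetric] int) auto
  also have "integral {0..x} bump = integral {0..1} bump + integral {1..x} bump"
    using assms by (intro Henstock_Kurzweil_Integration.integral_combine[symmetric] int) auto
  also have "integral {1..x} bump = 0"
    by (subst integral_cong[where g = "\<lambda>_. 0"]) (auto simp: bump_eq_0)
  finally show ?thesis using integral_bump_pos by (simp add: smooth_step_def integral_bump_left)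
qed

lemma smooth_step_deriv: "(smooth_step has_real_derivative bump x / integral {0..1} bump) (at x)"
proof (cases "x < 0")
  case True
  then have "\<forall>\<^sub>F y in nhds x. smooth_step y = 0"
    using eventually_nhds_in_open[of "{..<0}" x] by (auto simp: smooth_step_0 elim!: eventually_mono)
  then show ?thesis using True
    by (subst DERIV_cong_ev[where g = "\<lambda>_. 0"]) (auto simp: bump_eq_0)
next
  case False
  have "((\<lambda>u. integral {-1..u} bump) has_vector_derivative bump x) (at x within {-1..x+1})"
    using False by (intro integral_has_vector_derivative continuous_on_bump) auto
  then have "((\<lambda>u. integral {-1..u} bump) has_real_derivative bump x) (at x)"
    using False at_within_Icc_at[of "-1" x "x+1"] by (simp add: has_real_derivative_iff_has_vector_derivative)
  from DERIV_cdivide[OF this] show ?thesis by (simp add: smooth_step_def[abs_def])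
qed

lemma smooth_fun_smooth_step: "smooth_fun (\<lambda>x. of_real (smooth_step x))"
proof (rule smooth_fun_antideriv)
  show "smooth_fun (\<lambda>x. of_real (bump x) * of_real (1 / integral {0..1} bump))"
    by (intro smooth_fun_mult smooth_fun_bump smooth_fun_const)
  show "((\<lambda>x. of_real (smooth_step x)) has_vector_derivative 
     complex_of_real (bump x) * of_real (1 / integral {0..1} bump)) (at x)" for x
    using has_vector_derivative_of_real[OF smooth_step_deriv, of x, where 'a = complex]
    by simp
qed

text \<open>A difference of consecutive steps: its integer translates telescope to 1, and it is
  supported in {0..2}.\<close>

definition unit_part :: "real \<Rightarrow> complex" where
  "unit_part t = of_real (smooth_step t - smooth_step (t - 1))"

lemma smooth_fun_unit_part: "smooth_fun unit_part"
proof -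
  have "smooth_fun (\<lambda>x. of_real (smooth_step x) + (-1) * of_real (smooth_step (1 * x + (-1))))"
    by (intro smooth_fun_add smooth_fun_mult smooth_fun_const smooth_fun_smooth_step
       smooth_fun_affine[where f = "\<lambda>x. of_real (smooth_step x)"])
  then show ?thesis by (simp add: unit_part_def[abs_def])
qed

lemma unit_part_eq_0: "t \<le> 0 \<or> t \<ge> 2 \<Longrightarrow> unit_part t = 0"
  by (auto simp: unit_part_def smooth_step_0 smooth_step_1)

lemma sum_unit_part:
  assumes "\<bar>t\<bar> \<le> real n"
  shows "(\<Sum>j\<in>{-int n-1..int n}. unit_part (t - of_int j)) = 1"
proof -
  have "(\<Sum>j\<in>{-int n-1..int n}. unit_part (t - of_int j)) = 
     of_real (\<Sum>j\<in>{-int n-1..int n}. (smooth_step (t - of_int j) - smooth_step (t - of_int (j + 1))))"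
    by (simp add: unit_part_def algebra_simps)
  also have "(\<Sum>j\<in>{-int n-1..int n}. (smooth_step (t - of_int j) - smooth_step (t - of_int (j + 1))))
      = smooth_step (t - of_int (-int n-1)) - smooth_step (t - of_int (int n + 1))"
  proof -
    have "(\<Sum>j\<in>{a..b}. (h j - h (j + 1))) = h a - h (b + 1)" if "a \<le> b" for a b :: int and h :: "int \<Rightarrow> real"
      using that
    proof (induction b rule: int_ge_induct)
      case (step i)
      then have "{a..i+1} = insert (i+1) {a..i}" by auto
      then show ?case using step by simp
    qed simp
    from this[of "-int n-1" "int n" "\<lambda>j. smooth_step (t - of_int j)"] show ?thesis by simp
  qed
  \<comment> \<open>The lowest index evaluates the step at t + n + 1 >= 1, where it is 1; the upper
    end of the telescope evaluates it at t - n - 1 < 0, where it is 0.\<close>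
  also have "\<dots> = 1" using assms by (auto simp: smooth_step_0 smooth_step_1)
  finally show ?thesis by simp
qed

subsection \<open>Test functions and their Fourier transforms\<close>

lemma test_funI:
  assumes "smooth_fun \<phi>" "compact C" "C \<subseteq> U" "\<And>t. \<phi> t \<noteq> 0 \<Longrightarrow> t \<in> C"
  shows "test_fun U \<phi>"
proof -
  have "closure {t. \<phi> t \<noteq> 0} \<subseteq> C"
    using assms by (intro closure_minimal compact_imp_closed) auto
  then show ?thesis unfolding test_fun_def using assms
    by (meson closed_closure compact_Int_closed compact_closure bounded_subset compact_imp_bounded subset_trans
       closure_subset)
qed

lemma test_fun_smooth: "test_fun U \<phi> \<Longrightarrow> smooth_fun \<phi>"
  by (simp add: test_fun_def)

lemma test_fun_support:
  assumes "test_fun U \<phi>"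
  obtains C where "compact C" "C \<subseteq> U" "\<And>t. t \<notin> C \<Longrightarrow> \<phi> t = 0"
  using assms closure_subset[of "{t. \<phi> t \<noteq> 0}"] unfolding test_fun_def by blast

lemma test_fun_mono: "test_fun U \<phi> \<Longrightarrow> U \<subseteq> V \<Longrightarrow> test_fun V \<phi>"
  by (auto simp: test_fun_def)

lemma test_fun_mult: 
  assumes "smooth_fun u" "test_fun U \<phi>" shows "test_fun U (\<lambda>t. u t * \<phi> t)"
proof -
  obtain C where "compact C" "C \<subseteq> U" "\<And>t. t \<notin> C \<Longrightarrow> \<phi> t = 0"
    using test_fun_support[OF assms(2)] by blast
  then show ?thesis using assms
    by (intro test_funI[of _ C] smooth_fun_mult) (auto simp: test_fun_def)
qed

lemma test_fun_bounded_support: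
  assumes "test_fun U \<phi>"
  obtains R where "R > 0" "\<And>t. t \<notin> {-R..R} \<Longrightarrow> \<phi> t = 0"
proof -
  obtain C where C: "compact C" "C \<subseteq> U" "\<And>t. t \<notin> C \<Longrightarrow> \<phi> t = 0"
    using test_fun_support[OF assms] by metis
  obtain B where B: "\<And>x. x \<in> C \<Longrightarrow> norm x \<le> B" 
    using compact_imp_bounded[OF C(1)] bounded_iff by blast
  have "\<phi> t = 0" if "t \<notin> {-max B 1..max B 1}" for t
    using that B[of t] by (intro C(3)) (auto simp: abs_le_iff)
  then show ?thesis by (intro that[of "max B 1"]) auto
qed

lemma test_fun_deriv:
  assumes "test_fun U \<phi>"
  obtains \<phi>' where "test_fun U \<phi>'" "\<And>x. (\<phi> has_vector_derivative \<phi>' x) (at x)"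
proof -
  obtain \<phi>' where d: "smooth_fun \<phi>'" "\<And>x. (\<phi> has_vector_derivative \<phi>' x) (at x)"
    using smooth_funE[OF test_fun_smooth[OF assms]] by blast
  obtain C where C: "compact C" "C \<subseteq> U" "\<And>t. t \<notin> C \<Longrightarrow> \<phi> t = 0"
    using test_fun_support[OF assms] by blast
  have "\<phi>' t = 0" if t: "t \<notin> C" for t
  proof -
    have "((\<lambda>_. 0) has_vector_derivative \<phi>' t) (at t)"
    proof (rule has_vector_derivative_transform_within_open[OF d(2)])
      show "open (- C)" using C(1) by (simp add: compact_imp_closed open_Compl)
    qed (use t C(3) in auto)
    then show ?thesis using vector_derivative_unique_at has_vector_derivative_const by blast
  qed
  then have "test_fun U \<phi>'" by (intro test_funI[OF d(1) C(1,2)]) auto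
  then show ?thesis using d(2) that by blast
qed

lemma integrable_compact_support:
  fixes f :: "'a::euclidean_space \<Rightarrow> 'b::{banach, second_countable_topology}"
  assumes "continuous_on UNIV f" "compact C" "\<And>t. t \<notin> C \<Longrightarrow> f t = 0"
  shows "integrable lborel f"
proof -
  have "integrable lborel (\<lambda>t. indicator C t *\<^sub>R f t)"
    using assms by (intro borel_integrable_compact) (auto intro: continuous_on_subset)
  also have "(\<lambda>t. indicator C t *\<^sub>R f t) = f" using assms(3) by (auto simp: indicator_def fun_eq_iff)
  finally show ?thesis .
qed

lemma integrable_test_fun:
  assumes "test_fun U \<phi>" "continuous_on UNIV u"
  shows "integrable lborel (\<lambda>t. u t * \<phi> t)"
proof -
  obtain R where R: "R > 0" "\<And>t. t \<notin> {-R..R} \<Longrightarrow> \<phi> t = 0"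
    using test_fun_bounded_support[OF assms(1)] by blast
  have "continuous_on UNIV \<phi>" by (rule smooth_fun_continuous) (rule test_fun_smooth[OF assms(1)])
  then show ?thesis
    by (intro integrable_compact_support[of _ "{-R..R}"] continuous_intros assms(2)) (use R in auto)
qed

section \<open>Fourier transforms of test functions: derivatives and decay\<close>

definition fourier :: "(real \<Rightarrow> complex) \<Rightarrow> real \<Rightarrow> complex" where
  "fourier \<phi> y = (LINT t|lborel. exp (- (\<i> * of_real (t * y))) * \<phi> t)"

lemma fourier_integrable:
  "test_fun U \<phi> \<Longrightarrow> integrable lborel (\<lambda>t. exp (- (\<i> * of_real (t * y))) * \<phi> t)"
  by (rule integrable_test_fun) (auto intro!: continuous_intros)

lemma integral_lborel_support:
  fixes f :: "real \<Rightarrow> complex"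
  assumes "integrable lborel f" "\<And>t. t \<notin> S \<Longrightarrow> f t = 0"
  shows "(LINT t|lborel. f t) = integral S f"
proof -
  have "(LINT t|lborel. f t) = integral UNIV f"
    by (rule integral_lborel[OF assms(1), symmetric])
  also have "\<dots> = integral UNIV (\<lambda>t. if t \<in> S then f t else 0)"
    using assms(2) by (intro Henstock_Kurzweil_Integration.integral_cong) auto
  also have "\<dots> = integral S f"
    by (rule Henstock_Kurzweil_Integration.integral_restrict_UNIV)
  finally show ?thesis .
qed

lemma norm_exp_imaginary: "norm (exp (\<i> * of_real x)) = 1" "norm (exp (- (\<i> * of_real x))) = 1"
  by (simp_all add: norm_exp_eq_Re)

lemma fourier_eq_integral:
  assumes "test_fun U \<phi>" "\<And>t. t \<notin> {a..b} \<Longrightarrow> \<phi> t = 0"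
  shows "fourier \<phi> y = integral {a..b} (\<lambda>t. exp (- (\<i> * of_real (t * y))) * \<phi> t)"
  unfolding fourier_def using assms by (intro integral_lborel_support fourier_integrable) auto

lemma has_vector_derivative_exp_imaginary:
  "((\<lambda>x. exp (- (\<i> * complex_of_real (x * c)))) has_vector_derivative 
     - (\<i> * of_real c) * exp (- (\<i> * of_real (x * c)))) (at x within S)"
proof -
  have "((\<lambda>z. exp (- (\<i> * (z * of_real c)))) has_field_derivative
     - (\<i> * of_real c) * exp (- (\<i> * (of_real x * of_real c)))) (at (of_real x))"
    by (auto intro!: derivative_eq_intros)
  from has_vector_derivative_real_field[OF this] show ?thesis by (simp add: o_def)
qed

lemma fourier_has_vector_derivative:
  assumes "test_fun U \<phi>"
  shows "(fourier \<phi> has_vector_derivative fourier (\<lambda>t. - (\<i> * of_real t) * \<phi> t) y) (at y)"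
proof -
  obtain R where R: "R > 0" "\<And>t. t \<notin> {-R..R} \<Longrightarrow> \<phi> t = 0"
    using test_fun_bounded_support[OF assms] by blast
  have cont: "continuous_on S \<phi>" for S
    by (rule smooth_fun_continuous) (rule test_fun_smooth[OF assms])
  have t: "test_fun U (\<lambda>t. - (\<i> * of_real t) * \<phi> t)"
    using test_fun_mult[OF smooth_fun_mult[OF smooth_fun_const[of "-\<i>"] smooth_fun_of_real] assms] by simp
  have "((\<lambda>y. integral (cbox (-R) R) (\<lambda>t. exp (- (\<i> * of_real (t * y))) * \<phi> t)) has_vector_derivative
     integral (cbox (-R) R) (\<lambda>t. exp (- (\<i> * of_real (t * y))) * (- (\<i> * of_real t) * \<phi> t))) (at y within UNIV)"
  proof (rule leibniz_rule_vector_derivative)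
    show "((\<lambda>y. exp (- (\<i> * complex_of_real (t * y))) * \<phi> t) has_vector_derivative
          exp (- (\<i> * of_real (t * y))) * (- (\<i> * of_real t) * \<phi> t)) (at y within UNIV)" for t y
    proof -
      have "((\<lambda>y. exp (- (\<i> * complex_of_real (t * y)))) has_vector_derivative
          exp (- (\<i> * of_real (t * y))) * - (\<i> * of_real t)) (at y)"
        using has_vector_derivative_exp_imaginary[of t y] by (simp add: mult_ac)
      from has_vector_derivative_mult_left[OF this, of "\<phi> t"] show ?thesis by (simp add: mult.assoc)
    qed
    show "(\<lambda>t. exp (- (\<i> * complex_of_real (t * y))) * \<phi> t) integrable_on cbox (- R) R" for y
      by (intro integrable_continuous continuous_intros cont)
    show "continuous_on (UNIV \<times> cbox (- R) R)
      (\<lambda>(y, t). exp (- (\<i> * complex_of_real (t * y))) * (- (\<i> * complex_of_real t) * \<phi> t))"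
      unfolding split_beta by (intro continuous_intros continuous_on_compose2[OF cont[of UNIV]]) auto
  qed auto
  moreover have "fourier \<phi> = (\<lambda>y. integral (cbox (-R) R) (\<lambda>t. exp (- (\<i> * of_real (t * y))) * \<phi> t))"
    using fourier_eq_integral[OF assms R(2)] by (auto simp: cbox_interval)
  moreover have "fourier (\<lambda>t. - (\<i> * of_real t) * \<phi> t) y = 
     integral (cbox (-R) R) (\<lambda>t. exp (- (\<i> * of_real (t * y))) * (- (\<i> * of_real t) * \<phi> t))"
    using R(2) by (subst fourier_eq_integral[OF t]) (auto simp: cbox_interval)
  ultimately show ?thesis by simp
qed

lemma continuous_on_fourier: "test_fun U \<phi> \<Longrightarrow> continuous_on S (fourier \<phi>)"
  by (intro continuous_at_imp_continuous_on ballI)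
     (rule has_vector_derivative_continuous, erule fourier_has_vector_derivative)

lemma fourier_deriv:
  assumes "test_fun U \<phi>" "test_fun U \<phi>'" "\<And>x. (\<phi> has_vector_derivative \<phi>' x) (at x)"
  shows "fourier \<phi>' y = \<i> * of_real y * fourier \<phi> y"
proof -
  obtain R0 where R0: "R0 > 0" "\<And>t. t \<notin> {-R0..R0} \<Longrightarrow> \<phi> t = 0"
    using test_fun_bounded_support[OF assms(1)] by blast
  obtain R1 where R1: "R1 > 0" "\<And>t. t \<notin> {-R1..R1} \<Longrightarrow> \<phi>' t = 0"
    using test_fun_bounded_support[OF assms(2)] by blast
  \<comment> \<open>The extra 1 makes both functions vanish at -R and R themselves, where the
    boundary terms of the integration by parts are evaluated.\<close>
  define R where "R = max R0 R1 + 1"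
  have R: "R > 0" "\<And>t. \<bar>t\<bar> \<ge> R \<Longrightarrow> \<phi> t = 0" "\<And>t. \<bar>t\<bar> \<ge> R \<Longrightarrow> \<phi>' t = 0"
    using R0(1) R1(1) by (auto simp: R_def intro!: R0(2) R1(2))
  let ?e = "\<lambda>t. exp (- (\<i> * complex_of_real (t * y)))"
  have "((\<lambda>t. ?e t * \<phi> t) has_vector_derivative ?e t * \<phi>' t - \<i> * of_real y * (?e t * \<phi> t)) (at t within {-R..R})" for t
  proof -
    have "(?e has_vector_derivative - \<i> * of_real y * ?e t) (at t within {-R..R})"
      using has_vector_derivative_exp_imaginary[of y t "{-R..R}"] by (simp add: mult_ac)
    from has_vector_derivative_mult[OF this has_vector_derivative_at_within[OF assms(3)]]
    show ?thesis by (simp add: algebra_simps)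
  qed
  then have "((\<lambda>t. ?e t * \<phi>' t - \<i> * of_real y * (?e t * \<phi> t)) has_integral (?e R * \<phi> R - ?e (-R) * \<phi> (-R))) {-R..R}"
    using R(1) by (intro fundamental_theorem_of_calculus) auto
  then have "integral {-R..R} (\<lambda>t. ?e t * \<phi>' t - \<i> * of_real y * (?e t * \<phi> t)) = 0"
    using R by (simp add: integral_unique)
  also have "integral {-R..R} (\<lambda>t. ?e t * \<phi>' t - \<i> * of_real y * (?e t * \<phi> t)) = 
     fourier \<phi>' y - \<i> * of_real y * fourier \<phi> y"
  proof -
    have c: "continuous_on S \<phi>" "continuous_on S \<phi>'" for S
      using assms by (auto intro!: smooth_fun_continuous intro: test_fun_smooth)
    have "integral {-R..R} (\<lambda>t. ?e t * \<phi>' t - \<i> * of_real y * (?e t * \<phi> t)) =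
      integral {-R..R} (\<lambda>t. ?e t * \<phi>' t) - integral {-R..R} (\<lambda>t. \<i> * of_real y * (?e t * \<phi> t))"
      by (intro Henstock_Kurzweil_Integration.integral_diff integrable_continuous_interval continuous_intros c)
    moreover have "fourier \<phi> y = integral {-R..R} (\<lambda>t. ?e t * \<phi> t)"
      by (rule fourier_eq_integral[OF assms(1)]) (auto intro!: R(2))
    moreover have "fourier \<phi>' y = integral {-R..R} (\<lambda>t. ?e t * \<phi>' t)"
      by (rule fourier_eq_integral[OF assms(2)]) (auto intro!: R(3))
    ultimately show ?thesis by simp
  qed
  finally show ?thesis by simp
qed

lemma fourier_norm_le:
  assumes "test_fun U \<phi>"
  shows "norm (fourier \<phi> y) \<le> (LINT t|lborel. norm (\<phi> t))"
proof -
  have "norm (fourier \<phi> y) \<le> (LINT t|lborel. norm (exp (- (\<i> * of_real (t * y))) * \<phi> t))"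
    unfolding fourier_def by (rule integral_norm_bound)
  then show ?thesis by (simp add: norm_mult norm_exp_imaginary)
qed

lemma fourier_decay:
  assumes "test_fun U \<phi>"
  shows "\<exists>C\<ge>0. \<forall>y. norm (fourier \<phi> y) * \<bar>y\<bar> ^ n \<le> C"
  using assms
proof (induction n arbitrary: \<phi>)
  case 0
  have "0 \<le> (LINT t|lborel. norm (\<phi> t))" by simp
  then show ?case using fourier_norm_le[OF 0] by (auto intro!: exI[of _ "LINT t|lborel. norm (\<phi> t)"])
next
  case (Suc n)
  obtain \<phi>' where d: "test_fun U \<phi>'" "\<And>x. (\<phi> has_vector_derivative \<phi>' x) (at x)"
    using test_fun_deriv[OF Suc.prems] by blast
  obtain C where C: "C \<ge> 0" "\<And>y. norm (fourier \<phi>' y) * \<bar>y\<bar> ^ n \<le> C" using Suc.IH[OF d(1)] by blast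
  show ?case using C by (auto simp: fourier_deriv[OF Suc.prems d] norm_mult mult_ac)
qed

text \<open>Order 4 leaves room for the weight 1 + |y|: the weighted transform is still dominated by
  a multiple of 1 / (1 + y^2), whose integrability comes from the arctangent. An even exponent
  avoids absolute values.\<close>

lemma fourier_decay_bound:
  assumes "test_fun U \<phi>"
  obtains C where "C > 0" "\<And>y. norm (fourier \<phi> y) \<le> C / (1 + y ^ 4)"
proof -
  obtain A where A: "A \<ge> 0" "\<And>y. norm (fourier \<phi> y) * \<bar>y\<bar> ^ 4 \<le> A" using fourier_decay[OF assms] by blast
  obtain B where B: "B \<ge> 0" "\<And>y. norm (fourier \<phi> y) * \<bar>y\<bar> ^ 0 \<le> B" using fourier_decay[OF assms] by blast
  show thesis
  proof (rule that[of "A + B + 1"])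
    show "A + B + 1 > 0" using A B by simp
    show "norm (fourier \<phi> y) \<le> (A + B + 1) / (1 + y ^ 4)" for y
    proof -
      have "0 < 1 + y ^ 4" by (simp add: add_pos_nonneg)
      then show ?thesis using A(2)[of y] B(2)[of y] by (simp add: field_simps)
    qed
  qed
qed

lemma fourier_scale:
  assumes "l > 0"
  shows "fourier (\<lambda>t. \<phi> (t / l)) y = of_real l * fourier \<phi> (l * y)"
  unfolding fourier_def using assms
  by (subst lborel_integral_real_affine[of l _ 0]) (auto simp: scaleR_conv_of_real mult_ac)

text \<open>This is how the factor e^(iht) in the pseudofunction condition becomes the shift x - h
  of a kernel, so that h -> \<infinity> inspects \<open>g\<close> near infinity.\<close>

lemma fourier_modulate:
  "fourier (\<lambda>t. exp (\<i> * of_real (h * t)) * \<phi> t) y = fourier \<phi> (y - h)"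
proof -
  have "exp (- (\<i> * complex_of_real (t * y))) * exp (\<i> * of_real (h * t)) = exp (- (\<i> * of_real (t * (y - h))))" for t
    by (simp add: mult_exp_exp algebra_simps)
  then show ?thesis unfolding fourier_def mult.assoc[symmetric] by simp
qed

lemma test_fun_scale:
  assumes "smooth_fun \<phi>" "\<And>t. \<bar>t\<bar> \<ge> 1 \<Longrightarrow> \<phi> t = 0" "l > 0" "{-l..l} \<subseteq> U"
  shows "test_fun U (\<lambda>t. \<phi> (t / l))"
proof (rule test_funI[of _ "{-l..l}"])
  show "smooth_fun (\<lambda>t. \<phi> (t / l))" using smooth_fun_affine[OF assms(1), of "1/l" 0] by simp
  show "t \<in> {-l..l}" if "\<phi> (t / l) \<noteq> 0" for t
  proof -
    have "\<not> \<bar>t / l\<bar> \<ge> 1" using assms(2) that by blast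
    then show ?thesis using assms(3) by (auto simp: field_simps abs_if split: if_splits)
  qed
qed (use assms in auto)

section \<open>The nonnegative transform of an autocorrelation\<close>

text \<open>The autocorrelation of \<open>bump\<close>. It is supported in {-1..1}, and its
  transform is a squared modulus, so it combines compact support with a nonnegative
  transform.\<close>

definition pos_kernel_fun :: "real \<Rightarrow> complex" where
  "pos_kernel_fun t = integral {0..1} (\<lambda>u. of_real (bump (u + t) * bump u))"

lemma smooth_fun_pos_kernel_fun: "smooth_fun pos_kernel_fun"
proof -
  obtain g where g: "g 0 = (\<lambda>x. complex_of_real (bump x))" "\<And>n x. (g n has_vector_derivative g (Suc n) x) (at x)"
    using smooth_fun_bump unfolding smooth_fun_def by blast
  have cont: "continuous_on S (g n)" for n S
    using g(2) has_vector_derivative_continuous by (metis continuous_at_imp_continuous_on)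
  \<comment> \<open>All derivatives fall on the shifted factor; the unshifted \<open>bump\<close>
    remains a cut-off, so the domain {0..1} never depends on t.\<close>
  have "((\<lambda>t. integral (cbox 0 1) (\<lambda>u. g n (u + t) * of_real (bump u))) has_vector_derivative
     integral (cbox 0 1) (\<lambda>u. g (Suc n) (u + t) * of_real (bump u))) (at t within UNIV)" for n t
  proof (rule leibniz_rule_vector_derivative)
    show "((\<lambda>t. g n (u + t) * of_real (bump u)) has_vector_derivative
          g (Suc n) (u + t) * of_real (bump u)) (at t within UNIV)" for t u
    proof -
      have "((g n \<circ> (\<lambda>t. u + t)) has_vector_derivative 1 *\<^sub>R g (Suc n) (u + t)) (at t)"
        by (rule vector_diff_chain_at) (auto intro!: derivative_eq_intros g(2))
      from has_vector_derivative_mult_left[OF this, of "of_real (bump u)"] show ?thesis by (simp add: o_def)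
    qed
    show "(\<lambda>u. g n (u + t) * complex_of_real (bump u)) integrable_on cbox 0 1" for t
      by (intro integrable_continuous continuous_intros continuous_on_compose2[OF cont[of UNIV]] continuous_on_bump) auto
    show "continuous_on (UNIV \<times> cbox 0 1) (\<lambda>(t, u). g (Suc n) (u + t) * complex_of_real (bump u))"
      unfolding split_beta 
      by (intro continuous_intros continuous_on_compose2[OF cont[of UNIV]] continuous_on_compose2[OF continuous_on_bump[of UNIV]]) auto
  qed auto
  then show ?thesis unfolding smooth_fun_def
    by (intro exI[of _ "\<lambda>n t. integral (cbox 0 1) (\<lambda>u. g n (u + t) * of_real (bump u))"])
       (auto simp: g(1) pos_kernel_fun_def fun_eq_iff cbox_interval)
qed

lemma pos_kernel_fun_eq_0: "\<bar>t\<bar> \<ge> 1 \<Longrightarrow> pos_kernel_fun t = 0"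
  unfolding pos_kernel_fun_def 
  by (subst Henstock_Kurzweil_Integration.integral_cong[where g = "\<lambda>_. 0"]) 
     (auto simp: bump_eq_0 abs_if split: if_splits)

lemma bump_outside: "x \<notin> {0..1} \<Longrightarrow> bump x = 0"
  by (rule bump_eq_0) auto

lemma test_fun_bump: "test_fun UNIV (\<lambda>x. of_real (bump x))"
  using bump_outside by (intro test_funI[OF smooth_fun_bump, of "{0..1}"]) auto

lemma pos_kernel_fun_eq: "pos_kernel_fun t = (LINT u|lborel. of_real (bump (u + t) * bump u))"
proof -
  have "integrable lborel (\<lambda>u. complex_of_real (bump (u + t)) * of_real (bump u))"
    by (intro integrable_test_fun[OF test_fun_bump] continuous_intros continuous_on_compose2[OF continuous_on_bump[of UNIV]]) auto
  then show ?thesis unfolding pos_kernel_fun_def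
    by (subst integral_lborel_support[where S = "{0..1}"]) (auto simp: bump_outside)
qed

lemma fourier_pos_kernel_fun:
  "fourier pos_kernel_fun y = of_real ((norm (fourier (\<lambda>x. of_real (bump x)) y))\<^sup>2)"
proof -
  let ?b = "\<lambda>x. complex_of_real (bump x)" and ?e = "\<lambda>t. exp (- (\<i> * complex_of_real (t * y)))"
  have cb: "continuous_on S ?b" for S by (intro continuous_intros continuous_on_bump)
  have int: "integrable (lborel \<Otimes>\<^sub>M lborel) (\<lambda>(t, u). ?e t * (?b (u + t) * ?b u))"
    unfolding lborel_prod split_beta
  proof (rule integrable_compact_support[of _ "cbox (-1, 0) (1, 1)"])
    show "continuous_on UNIV (\<lambda>x. ?e (fst x) * (?b (snd x + fst x) * ?b (snd x)))"
      by (intro continuous_intros continuous_on_compose2[OF cb[of UNIV]] continuous_on_compose2[OF continuous_on_bump[of UNIV]]) auto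
    show "?e (fst x) * (?b (snd x + fst x) * ?b (snd x)) = 0" if "x \<notin> cbox (-1, 0) (1, 1)" for x :: "real \<times> real"
    proof -
      have "snd x \<notin> {0..1} \<or> snd x + fst x \<notin> {0..1}"
        using that by (cases x) (auto simp: cbox_Pair_eq)
      then show ?thesis using bump_outside by auto
    qed
  qed simp
  have "fourier pos_kernel_fun y = (LINT t|lborel. (LINT u|lborel. ?e t * (?b (u + t) * ?b u)))"
    unfolding fourier_def pos_kernel_fun_eq by simp
  also have "\<dots> = (LINT u|lborel. (LINT t|lborel. ?e t * (?b (u + t) * ?b u)))"
    by (rule lborel_pair.Fubini_integral[OF int, symmetric])
  also have "\<dots> = (LINT u|lborel. exp (\<i> * of_real (u * y)) * ?b u * fourier ?b y)"
  proof (rule Bochner_Integration.integral_cong)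
    fix u
    \<comment> \<open>The shift t -> t - u splits the exponential into a factor in u and a factor in
      t; the two resulting integrals are conjugate to each other.\<close>
    have "(LINT t|lborel. ?e t * (?b (u + t) * ?b u)) = (LINT t|lborel. ?e (t - u) * (?b t * ?b u))"
      by (subst lborel_integral_real_affine[of 1 _ "-u"]) (auto simp: algebra_simps)
    also have "\<dots> = (LINT t|lborel. (exp (\<i> * of_real (u * y)) * ?b u) * (?e t * ?b t))"
      by (intro Bochner_Integration.integral_cong) (auto simp: exp_diff[symmetric] exp_add[symmetric] algebra_simps mult_exp_exp)
    also have "\<dots> = exp (\<i> * of_real (u * y)) * ?b u * fourier ?b y"
      unfolding fourier_def by (rule integral_mult_right_zero)
    finally show "(LINT t|lborel. ?e t * (?b (u + t) * ?b u)) = exp (\<i> * of_real (u * y)) * ?b u * fourier ?b y" .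
  qed simp
  also have "\<dots> = (LINT u|lborel. exp (\<i> * of_real (u * y)) * ?b u) * fourier ?b y"
    by (rule integral_mult_left_zero)
  also have "(LINT u|lborel. exp (\<i> * of_real (u * y)) * ?b u) = cnj (fourier ?b y)"
    unfolding fourier_def by (subst Bochner_Integration.integral_cnj[symmetric]) (simp add: exp_cnj)
  also have "cnj (fourier ?b y) * fourier ?b y = of_real ((norm (fourier ?b y))\<^sup>2)"
    by (metis complex_norm_square mult.commute)
  finally show ?thesis .
qed

definition pos_kernel :: "real \<Rightarrow> real" where
  "pos_kernel y = (norm (fourier (\<lambda>x. of_real (bump x)) y))\<^sup>2"

lemma pos_kernel_nonneg: "pos_kernel y \<ge> 0"
  by (simp add: pos_kernel_def)

lemma continuous_on_pos_kernel: "continuous_on S pos_kernel"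
  unfolding pos_kernel_def[abs_def]
  by (intro continuous_intros continuous_on_fourier[OF test_fun_bump])

lemma test_fun_pos_kernel_fun: "test_fun UNIV pos_kernel_fun"
proof (rule test_funI[OF smooth_fun_pos_kernel_fun, of "{-1..1}"])
  show "t \<in> {-1..1}" if "pos_kernel_fun t \<noteq> 0" for t
  proof (rule ccontr)
    assume "t \<notin> {-1..1}"
    then have "1 \<le> \<bar>t\<bar>" by auto
    then show False using that pos_kernel_fun_eq_0 by blast
  qed
qed auto

lemma pos_kernel_decay: obtains C where "C > 0" "\<And>y. pos_kernel y \<le> C / (1 + y ^ 4)"
proof -
  obtain C where C: "C > 0" "\<And>y. norm (fourier pos_kernel_fun y) \<le> C / (1 + y ^ 4)"
    using fourier_decay_bound[OF test_fun_pos_kernel_fun] by blast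
  show thesis by (rule that[OF C(1)]) (use C(2) in \<open>simp add: fourier_pos_kernel_fun pos_kernel_def norm_power\<close>)
qed

text \<open>Positivity at this one point is enough: with continuity and nonnegativity it gives
  \<open>pos_kernel (l * u)\<close> positive mass on {0..1}, whatever the scale
  \<open>l\<close>.\<close>

lemma pos_kernel_0: "pos_kernel 0 > 0"
proof -
  have "fourier (\<lambda>x. of_real (bump x)) 0 = integral {0..1} (\<lambda>x. complex_of_real (bump x))"
    by (subst fourier_eq_integral[OF test_fun_bump, of 0 1]) (auto simp: bump_outside)
  also have "\<dots> = of_real (integral {0..1} bump)"
    by (intro integral_unique has_integral_of_real integrable_integral integrable_continuous_interval continuous_on_bump)
  finally show ?thesis using integral_bump_pos by (simp add: pos_kernel_def)
qed

subsection \<open>Real Tauberian arguments with a positive kernel\<close>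

lemma integrable_inverse_square: "integrable lborel (\<lambda>x::real. 1 / (1 + x\<^sup>2))"
proof -
  have "set_integrable lborel (einterval (-\<infinity>) \<infinity>) (\<lambda>x::real. 1 / (1 + x\<^sup>2))"
  proof (rule interval_integral_FTC_nonneg(1)[where F = arctan])
    show "(arctan has_real_derivative 1 / (1 + x\<^sup>2)) (at x)" for x :: real
      by (auto intro!: derivative_eq_intros simp: inverse_eq_divide)
    show "isCont (\<lambda>x. 1 / (1 + x\<^sup>2)) x" for x :: real
      by (intro continuous_intros) (simp add: add_nonneg_eq_0_iff)
    show "((arctan \<circ> real_of_ereal) \<longlongrightarrow> - (pi/2)) (at_right (-\<infinity>))"
      "((arctan \<circ> real_of_ereal) \<longlongrightarrow> pi/2) (at_left \<infinity>)"
      by (simp_all add: ereal_tendsto_simps filterlim_tendsto_pos_mult_at_bot tendsto_arctan_at_top tendsto_arctan_at_bot)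
  qed auto
  then show ?thesis by (simp add: set_integrable_def)
qed

text \<open>Submultiplicativity of the weight 1 + |x|. It trades linear growth at x for a constant
  depending on the centre y and a weight in x - y that the kernel can integrate.\<close>

lemma one_plus_abs_le: "1 + \<bar>x\<bar> \<le> (1 + \<bar>y\<bar>) * (1 + \<bar>x - y\<bar>)" for x y :: real
proof -
  have "0 \<le> \<bar>y\<bar> * \<bar>x - y\<bar>" by simp
  moreover have "\<bar>x\<bar> \<le> \<bar>y\<bar> + \<bar>x - y\<bar>" by linarith
  ultimately show ?thesis by (simp only: distrib_left distrib_right mult_1_left mult_1_right)
qed

section \<open>From bounded kernel averages to a bounded function\<close>

text \<open>The weight matches the linear growth that slow decrease permits; boundedness handles the
  initial segment, where \<open>r\<close> is merely integrable; mass on {0..1} turns an average into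
  a bound at the left end of an interval of length 1.\<close>

locale tauberian_kernel =
  fixes K :: "real \<Rightarrow> real"
  assumes K_nonneg: "K u \<ge> 0"
    and K_measurable [measurable]: "K \<in> borel_measurable borel"
    and K_weight: "integrable lborel (\<lambda>u. (1 + \<bar>u\<bar>) * K u)"
    and K_bounded: "\<exists>B. \<forall>u. K u \<le> B"
    and K_pos: "(LINT u|lborel. indicator {0..1} u * K u) > 0"
begin

lemma K_integrable: "integrable lborel K"
  by (rule Bochner_Integration.integrable_bound[OF K_weight]) (auto simp: abs_mult K_nonneg algebra_simps)

lemma integrable_indicator_K: 
  assumes [measurable]: "S \<in> sets borel"
  shows "integrable lborel (\<lambda>u. indicator S u * K u)"
  using integrable_mult_indicator[OF _ K_integrable, of S] by simp

lemma integrable_indicator_K_weight: 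
  assumes [measurable]: "S \<in> sets borel"
  shows "integrable lborel (\<lambda>u. indicator S u * ((1 + \<bar>u\<bar>) * K u))"
  using integrable_mult_indicator[OF _ K_weight, of S] by simp

lemma integral_K_pos: "(LINT u|lborel. K u) > 0"
proof -
  have "(LINT u|lborel. indicator {0..1} u * K u) \<le> (LINT u|lborel. K u)"
    by (intro integral_mono integrable_indicator_K K_integrable) (auto simp: indicator_def K_nonneg)
  then show ?thesis using K_pos by simp
qed

lemma tendsto_indicator_K: "((\<lambda>A. LINT u|lborel. indicator {-A..A} u * K u) \<longlongrightarrow> (LINT u|lborel. K u)) at_top"
proof (rule integral_dominated_convergence_at_top[where w = K])
  show "AE u in lborel. ((\<lambda>A. indicator {-A..A} u * K u) \<longlongrightarrow> K u) at_top"
  proof (intro AE_I2 tendsto_eventually)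
    fix u show "\<forall>\<^sub>F A in at_top. indicator {-A..A} u * K u = K u"
      using eventually_ge_at_top[of "\<bar>u\<bar>"] by eventually_elim (auto simp: indicator_def abs_le_iff)
  qed
  show "\<forall>\<^sub>F A in at_top. AE u in lborel. norm (indicator {-A..A} u * K u) \<le> K u"
    by (intro always_eventually allI AE_I2) (auto simp: indicator_def K_nonneg)
qed (auto intro: K_integrable)

lemma tendsto_tail_K_weight: "((\<lambda>A. LINT u|lborel. indicator (- {-A..A}) u * ((1 + \<bar>u\<bar>) * K u)) \<longlongrightarrow> 0) at_top"
proof -
  have "((\<lambda>A. LINT u|lborel. indicator (- {-A..A}) u * ((1 + \<bar>u\<bar>) * K u)) \<longlongrightarrow> (LINT (u::real)|lborel. 0)) at_top"
  proof (rule integral_dominated_convergence_at_top[where w = "\<lambda>u. (1 + \<bar>u\<bar>) * K u"])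
    show "AE u in lborel. ((\<lambda>A. indicator (- {-A..A}) u * ((1 + \<bar>u\<bar>) * K u)) \<longlongrightarrow> 0) at_top"
    proof (intro AE_I2 tendsto_eventually)
      fix u show "\<forall>\<^sub>F A in at_top. indicator (- {-A..A}) u * ((1 + \<bar>u\<bar>) * K u) = 0"
        using eventually_ge_at_top[of "\<bar>u\<bar>"] by eventually_elim (auto simp: indicator_def abs_le_iff)
    qed
    show "\<forall>\<^sub>F A in at_top. AE u in lborel. norm (indicator (- {-A..A}) u * ((1 + \<bar>u\<bar>) * K u)) \<le> (1 + \<bar>u\<bar>) * K u"
      by (intro always_eventually allI AE_I2) (auto simp: indicator_def K_nonneg abs_mult)
  qed (auto intro: K_weight)
  then show ?thesis by simp
qed

end

lemma borel_measurable_lebesgueI: "f \<in> borel_measurable borel \<Longrightarrow> f \<in> borel_measurable lebesgue"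
  by (simp add: measurable_completion)

lemma lebesgue_integral_shift:
  fixes f :: "real \<Rightarrow> 'a :: {banach, second_countable_topology}"
  assumes [measurable]: "f \<in> borel_measurable borel"
  shows "(LINT x|lebesgue. f (x - y)) = (LINT u|lborel. f u)"
proof -
  have "(LINT x|lebesgue. f (x - y)) = (LINT x|lborel. f (x - y))"
    by (rule integral_completion) measurable
  also have "\<dots> = (LINT x|lborel. f x)"
    by (subst (2) lborel_integral_real_affine[of 1 _ "-y"]) auto
  finally show ?thesis .
qed

lemma lebesgue_integrable_shift:
  fixes f :: "real \<Rightarrow> 'a :: {banach, second_countable_topology}"
  assumes "integrable lborel f"
  shows "integrable lebesgue (\<lambda>x. f (x - y))"
proof -
  have [measurable]: "f \<in> borel_measurable borel" using assms by auto
  have "integrable lborel (\<lambda>x. f (x - y))"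
    using lborel_integrable_real_affine[OF assms, of 1 "-y"] by simp
  then show ?thesis by (subst integrable_completion) auto
qed

text \<open>Let S be the least constant with |r x| <= S (1 + \<epsilon> x) on {X..}. A kernel
  average around h, of which all but a small part lies in a window next to h, bounds S by a constant
  plus S / 2. Since S is finite, it is bounded independently of \<epsilon>, and \<epsilon> -> 0
  removes the weight.\<close>

lemma (in tauberian_kernel) bounded_of_kernel_bounded:
  fixes r :: "real \<Rightarrow> real"
  assumes loc: "\<And>b. integrable lebesgue (\<lambda>x. indicator {..b} x * r x)"
    and slow: "\<And>x u. x \<ge> X \<Longrightarrow> u \<ge> 0 \<Longrightarrow> r (x + u) - r x \<ge> - C * (1 + u)"
    and X: "X \<ge> 0" and C: "C \<ge> 0"
    and int: "\<And>y. integrable lebesgue (\<lambda>x. r x * K (x - y))"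
    and bd: "\<And>y. y \<ge> Y \<Longrightarrow> \<bar>LINT x|lebesgue. r x * K (x - y)\<bar> \<le> B"
  shows "\<exists>M. \<forall>x\<ge>X. \<bar>r x\<bar> \<le> M"
proof -
  obtain KB where KB: "\<And>u. K u \<le> KB" using K_bounded by blast
  have KB0: "KB \<ge> 0" using KB[of 0] K_nonneg[of 0] by simp
  define k where "k = (LINT u|lborel. (1 + \<bar>u\<bar>) * K u)"
  define R where "R = (LINT x|lebesgue. \<bar>indicator {..X} x * r x\<bar>)"
  have R0: "R \<ge> 0" by (simp add: R_def)
  have k0: "k \<ge> 0" unfolding k_def by (intro integral_nonneg_AE) (auto simp: K_nonneg)
  have intR: "integrable lebesgue (\<lambda>x. KB * \<bar>indicator {..X} x * r x\<bar>)"
    by (intro integrable_mult_right integrable_abs loc)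
  have intk: "integrable lebesgue (\<lambda>x. c * ((1 + \<bar>x - y\<bar>) * K (x - y)))" for c y
    by (intro integrable_mult_right lebesgue_integrable_shift[OF K_weight])
  have valk: "(LINT x|lebesgue. c * ((1 + \<bar>x - y\<bar>) * K (x - y))) = c * k" for c y
    unfolding k_def by (subst integral_mult_right_zero, subst lebesgue_integral_shift) auto
  have intI: "integrable lebesgue (\<lambda>x. c * (indicator S (x - y) * K (x - y)))" if "S \<in> sets borel" for c y S
    by (intro integrable_mult_right lebesgue_integrable_shift[OF integrable_indicator_K[OF that]])
  have valI: "(LINT x|lebesgue. c * (indicator S (x - y) * K (x - y))) = c * (LINT u|lborel. indicator S u * K u)" 
    if [measurable]: "S \<in> sets borel" for c y S
    by (subst integral_mult_right_zero, subst lebesgue_integral_shift) auto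
  have intW: "integrable lebesgue (\<lambda>x. c * (indicator S (x - y) * ((1 + \<bar>x - y\<bar>) * K (x - y))))" if "S \<in> sets borel" for c y S
    by (intro integrable_mult_right lebesgue_integrable_shift[OF integrable_indicator_K_weight[OF that]])
  have valW: "(LINT x|lebesgue. c * (indicator S (x - y) * ((1 + \<bar>x - y\<bar>) * K (x - y)))) = 
      c * (LINT u|lborel. indicator S u * ((1 + \<bar>u\<bar>) * K u))" 
    if [measurable]: "S \<in> sets borel" for c y S
    by (subst integral_mult_right_zero, subst lebesgue_integral_shift) auto
  have valR: "(LINT x|lebesgue. KB * \<bar>indicator {..X} x * r x\<bar>) = KB * R" by (simp add: R_def)

  text \<open>Linear growth, needed only to make the weighted supremum below finite.\<close>
  define w0 where "w0 = C + \<bar>r X\<bar>"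
  define k1 where "k1 = (LINT u|lborel. indicator {0..1} u * K u)"
  have k1: "k1 > 0" using K_pos by (simp add: k1_def)
  have lower: "r x \<ge> - w0 * (1 + x)" if "x \<ge> X" for x
  proof -
    have "r x \<ge> r X - C * (1 + (x - X))" using slow[of X "x - X"] that by simp
    also have "C * (1 + (x - X)) \<le> C * (1 + x)" using C X by (intro mult_left_mono) auto
    moreover have "\<bar>r X\<bar> * 1 \<le> \<bar>r X\<bar> * (1 + x)" using that X by (intro mult_left_mono) auto
    ultimately show ?thesis by (simp add: w0_def algebra_simps)
  qed
  \<comment> \<open>On {h..h+1} slow decrease gives r >= r h - 2 C. Elsewhere the linear lower bound
    is compensated by adding a multiple of the weighted kernel, so the average around h controls
    \<open>r h\<close> from above.\<close>
  have upper: "r h \<le> 2 * C + (B + KB * R + w0 * (1 + h) * k) / k1" if h: "h \<ge> X" "h \<ge> Y" for h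
  proof -
    have "(LINT x|lebesgue. (r h - 2 * C) * (indicator {0..1} (x - h) * K (x - h))) \<le>
      (LINT x|lebesgue. (r x * K (x - h) + KB * \<bar>indicator {..X} x * r x\<bar>) + (w0 * (1 + h)) * ((1 + \<bar>x - h\<bar>) * K (x - h)))"
    proof (intro integral_mono)
      show "integrable lebesgue (\<lambda>x. (r h - 2 * C) * (indicator {0..1} (x - h) * K (x - h)))"
        by (rule intI) auto
      show "integrable lebesgue (\<lambda>x. (r x * K (x - h) + KB * \<bar>indicator {..X} x * r x\<bar>) + (w0 * (1 + h)) * ((1 + \<bar>x - h\<bar>) * K (x - h)))"
        by (intro Bochner_Integration.integrable_add int intR intk)
      fix x :: real
      show "(r h - 2 * C) * (indicator {0..1} (x - h) * K (x - h)) \<le>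
        (r x * K (x - h) + KB * \<bar>indicator {..X} x * r x\<bar>) + (w0 * (1 + h)) * ((1 + \<bar>x - h\<bar>) * K (x - h))"
      proof (cases "x < X")
        case True
        have "- (r x * K (x - h)) \<le> \<bar>r x\<bar> * KB"
          using mult_mono[OF abs_ge_self[of "- r x"] KB[of "x-h"]] K_nonneg by simp
        moreover have "0 \<le> (w0 * (1 + h)) * ((1 + \<bar>x - h\<bar>) * K (x - h))"
          using K_nonneg C X h by (simp add: w0_def)
        ultimately show ?thesis using True h by (simp add: mult.commute)
      next
        case False
        have "(1 + x) \<le> (1 + h) * (1 + \<bar>x - h\<bar>)"
          using one_plus_abs_le[of x h] X h False by simp
        then have "w0 * (1 + x) \<le> w0 * ((1 + h) * (1 + \<bar>x - h\<bar>))" using C by (intro mult_left_mono) (auto simp: w0_def)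
        then have nn: "0 \<le> r x + (w0 * (1 + h)) * (1 + \<bar>x - h\<bar>)" using lower[of x] False by (simp add: mult.assoc)
        have "(r h - 2 * C) * indicator {0..1} (x - h) \<le> r x + (w0 * (1 + h)) * (1 + \<bar>x - h\<bar>)"
        proof (cases "x - h \<in> {0..1}")
          case True
          have "r x \<ge> r h - C * (1 + (x - h))" using slow[of h "x - h"] True h by simp
          moreover have "C * (1 + (x - h)) \<le> C * 2" using C True by (intro mult_left_mono) auto
          moreover have "0 \<le> (w0 * (1 + h)) * (1 + \<bar>x - h\<bar>)" using C X h by (simp add: w0_def)
          ultimately have "r h - 2 * C \<le> r x + (w0 * (1 + h)) * (1 + \<bar>x - h\<bar>)" by linarith
          with True show ?thesis by simp
        qed (use nn in simp)
        from mult_right_mono[OF this K_nonneg[of "x - h"]] show ?thesis using KB0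
          by (smt (verit, best) mult.assoc distrib_right mult_nonneg_nonneg abs_ge_zero)
      qed
    qed
    also have "\<dots> = (LINT x|lebesgue. r x * K (x - h)) + KB * R + w0 * (1 + h) * k"
      by (subst Bochner_Integration.integral_add, (intro Bochner_Integration.integrable_add int intR intk)+)+
        (simp only: valR valk)
    also have "\<dots> \<le> B + KB * R + w0 * (1 + h) * k" using bd[OF h(2)] by simp
    also have "(LINT x|lebesgue. (r h - 2 * C) * (indicator {0..1} (x - h) * K (x - h))) = (r h - 2 * C) * k1"
      unfolding k1_def by (rule valI) auto
    finally have "(r h - 2 * C) \<le> (B + KB * R + w0 * (1 + h) * k) / k1" using k1 by (simp add: pos_le_divide_eq)
    then show ?thesis by simp
  qed

  define \<kappa> where "\<kappa> A = (LINT u|lborel. indicator {-A..A} u * K u)" for A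
  define \<eta> where "\<eta> A = (LINT u|lborel. indicator (- {-A..A}) u * ((1 + \<bar>u\<bar>) * K u))" for A
  \<comment> \<open>The window is made so large that the weighted mass outside it is less than half
    the mass inside; this ratio becomes the coefficient of S on the right of the self-improving
    inequality.\<close>
  have "((\<lambda>A. \<kappa> A - 2 * \<eta> A) \<longlongrightarrow> (LINT u|lborel. K u) - 2 * 0) at_top"
    unfolding \<kappa>_def \<eta>_def by (intro tendsto_intros tendsto_indicator_K tendsto_tail_K_weight)
  then have "\<forall>\<^sub>F A in at_top. \<kappa> A - 2 * \<eta> A > 0" using integral_K_pos by (auto dest: order_tendstoD(1))
  then have "\<forall>\<^sub>F A in at_top. \<kappa> A - 2 * \<eta> A > 0 \<and> A \<ge> 0" using eventually_ge_at_top[of 0] by eventually_elim auto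
  then obtain A where A: "\<kappa> A - 2 * \<eta> A > 0" "A \<ge> 0" using eventually_happens' trivial_limit_at_top_linorder by blast
  have \<eta>0: "\<eta> A \<ge> 0" unfolding \<eta>_def by (intro integral_nonneg_AE) (auto simp: K_nonneg)
  have \<kappa>0: "\<kappa> A > 0" using A \<eta>0 by linarith
  define D where "D = B + KB * R + C * (1 + A) * k"
  \<comment> \<open>From X2 on, both centres h - A and h + A used in \<open>key\<close> lie beyond
    Y, and the left window {h - 2 A..h} stays to the right of X.\<close>
  define X2 where "X2 = max (max X 0 + 2 * A) (Y + A)"
  have X2: "X2 \<ge> X + 2 * A" "X2 - A \<ge> Y" "X2 \<ge> X" using A by (auto simp: X2_def)

  \<comment> \<open>The window is placed on the side of h where slow decrease helps. If r h >= 0 its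
    centre is h + A, because values to the right cannot be much smaller; otherwise it is h - A,
    because values to the left cannot be much larger. On the other side of h, which is outside the
    window, only the weighted bound S is used.\<close>
  have key: "\<bar>r h\<bar> * \<kappa> A \<le> D + S * (1 + \<epsilon> * h) * \<eta> A"
    if h: "h \<ge> X2" and \<epsilon>: "0 < \<epsilon>" "\<epsilon> \<le> 1" and S: "S \<ge> 0" "\<And>x. x \<ge> X \<Longrightarrow> \<bar>r x\<bar> \<le> S * (1 + \<epsilon> * x)" for h \<epsilon> S
  proof -
    have hX: "h \<ge> X" "h \<ge> 0" using h X2 X by auto
    have w1: "1 \<le> 1 + \<epsilon> * h" using \<epsilon> hX by simp
    have tail: "\<bar>r x\<bar> * K u \<le> (S * (1 + \<epsilon> * h)) * ((1 + \<bar>u\<bar>) * K u)" 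
      if "x \<ge> X" "x \<le> h + \<bar>u\<bar>" for x u
    proof -
      have "1 + \<epsilon> * x \<le> (1 + \<epsilon> * h) + 1 * \<bar>u\<bar>"
      proof -
        have "\<epsilon> * x \<le> \<epsilon> * (h + \<bar>u\<bar>)" using that \<epsilon> by (intro mult_left_mono) auto
        moreover have "\<epsilon> * \<bar>u\<bar> \<le> 1 * \<bar>u\<bar>" using \<epsilon> by (intro mult_right_mono) auto
        ultimately show ?thesis by (simp add: algebra_simps)
      qed
      also have "\<dots> \<le> (1 + \<epsilon> * h) + (1 + \<epsilon> * h) * \<bar>u\<bar>" using w1 by (intro add_left_mono mult_right_mono) auto
      finally have "S * (1 + \<epsilon> * x) \<le> S * ((1 + \<epsilon> * h) * (1 + \<bar>u\<bar>))" 
        using S(1) by (intro mult_left_mono) (auto simp: algebra_simps)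
      then have "\<bar>r x\<bar> \<le> S * ((1 + \<epsilon> * h) * (1 + \<bar>u\<bar>))" using S(2)[OF that(1)] by linarith
      from mult_right_mono[OF this K_nonneg[of u]] show ?thesis by (simp add: mult.assoc)
    qed
    have low: "\<bar>r x\<bar> * K u \<le> KB * \<bar>r x\<bar>" for x u
      using KB[of u] by (simp add: mult.commute mult_right_mono)
    have CK: "0 \<le> C * (1 + A) * ((1 + \<bar>u\<bar>) * K u)" for u using C A K_nonneg by simp
    have SK: "0 \<le> (S * (1 + \<epsilon> * h)) * ((1 + \<bar>u\<bar>) * K u)" for u using S w1 K_nonneg by simp
    have CA: "C * (1 + (A + \<bar>u\<bar>)) * K u \<le> C * (1 + A) * ((1 + \<bar>u\<bar>) * K u)" for u
    proof -
      have "1 + (A + \<bar>u\<bar>) \<le> (1 + A) * (1 + \<bar>u\<bar>)" using A by (simp add: algebra_simps)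
      then have "C * (1 + (A + \<bar>u\<bar>)) \<le> C * ((1 + A) * (1 + \<bar>u\<bar>))" using C by (rule mult_left_mono)
      from mult_right_mono[OF this K_nonneg[of u]] show ?thesis by (simp add: mult.assoc)
    qed
    let ?E = "\<lambda>y x. (KB * \<bar>indicator {..X} x * r x\<bar> + C * (1 + A) * ((1 + \<bar>x - y\<bar>) * K (x - y))) + 
        (S * (1 + \<epsilon> * h)) * (indicator (- {-A..A}) (x - y) * ((1 + \<bar>x - y\<bar>) * K (x - y)))"
    have intE: "integrable lebesgue (?E y)" for y
      by (intro Bochner_Integration.integrable_add intR intk intW) auto
    have valE: "(LINT x|lebesgue. ?E y x) = KB * R + C * (1 + A) * k + S * (1 + \<epsilon> * h) * \<eta> A" for y
    proof -
      have B: "- {-A..A} \<in> sets borel" by simp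
      show ?thesis unfolding \<eta>_def
        by (simp only: valR valk valW[OF B]
            Bochner_Integration.integral_add[OF Bochner_Integration.integrable_add[OF intR intk] intW[OF B]]
            Bochner_Integration.integral_add[OF intR intk])
    qed
    show ?thesis
    proof (cases "r h \<ge> 0")
      case True
      define y where "y = h + A"
      have "(LINT x|lebesgue. r h * (indicator {-A..A} (x - y) * K (x - y))) \<le> 
        (LINT x|lebesgue. r x * K (x - y) + ?E y x)"
      proof (intro integral_mono Bochner_Integration.integrable_add int intR intk intW)
        show "integrable lebesgue (\<lambda>x. r h * (indicator {-A..A} (x - y) * K (x - y)))" by (rule intI) auto
        fix x :: real
        consider "x < X" | "X \<le> x" "x < h" | "h \<le> x" by linarith
        then show "r h * (indicator {-A..A} (x - y) * K (x - y)) \<le> r x * K (x - y) + ?E y x"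
        proof cases
          case 1
          then have "x - y \<notin> {-A..A}" using hX by (auto simp: y_def)
          moreover have "- (r x * K (x - y)) \<le> KB * \<bar>r x\<bar>" 
            using low[of x "x - y"] abs_ge_minus_self[of "r x * K (x - y)"] K_nonneg by (simp add: abs_mult)
          ultimately show ?thesis using 1 CK[of "x - y"] SK[of "x - y"] by simp
        next
          case 2
          then have "x - y \<notin> {-A..A}" by (auto simp: y_def)
          moreover have "- (r x * K (x - y)) \<le> (S * (1 + \<epsilon> * h)) * ((1 + \<bar>x - y\<bar>) * K (x - y))"
            using tail[OF 2(1), of "x - y"] 2(2) abs_ge_minus_self[of "r x * K (x - y)"] K_nonneg 
            unfolding abs_mult abs_of_nonneg[OF K_nonneg] by linarith
          moreover have "0 \<le> KB * \<bar>indicator {..X} x * r x\<bar>" using KB0 by simp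
          ultimately show ?thesis using CK[of "x - y"] by simp
        next
          case 3
          have "r h - C * (1 + (A + \<bar>x - y\<bar>)) \<le> r x"
          proof -
            have "r h - C * (1 + (x - h)) \<le> r x" using slow[of h "x - h"] 3 hX by simp
            moreover have "C * (1 + (x - h)) \<le> C * (1 + (A + \<bar>x - y\<bar>))" 
              using C by (intro mult_left_mono) (auto simp: y_def)
            ultimately show ?thesis by linarith
          qed
          from mult_right_mono[OF this K_nonneg[of "x - y"]]
          have "r h * K (x - y) \<le> r x * K (x - y) + C * (1 + A) * ((1 + \<bar>x - y\<bar>) * K (x - y))"
            using CA[of "x - y"] by (simp add: left_diff_distrib)
          moreover have "r h * (indicator {-A..A} (x - y) * K (x - y)) \<le> r h * K (x - y)"
            using True K_nonneg by (intro mult_left_mono) (auto simp: indicator_def)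
          moreover have "0 \<le> (S * (1 + \<epsilon> * h)) * (indicator (- {-A..A}) (x - y) * ((1 + \<bar>x - y\<bar>) * K (x - y)))"
            using SK[of "x - y"] by (auto simp: indicator_def)
          moreover have "0 \<le> KB * \<bar>indicator {..X} x * r x\<bar>" using KB0 by simp
          ultimately show ?thesis by linarith
        qed
      qed simp_all
      also have "\<dots> = (LINT x|lebesgue. r x * K (x - y)) + (KB * R + C * (1 + A) * k + S * (1 + \<epsilon> * h) * \<eta> A)"
        unfolding valE[symmetric, of y] by (rule Bochner_Integration.integral_add[OF int intE])
      also have "\<dots> \<le> D + S * (1 + \<epsilon> * h) * \<eta> A" using bd[of y] h X2 A by (simp add: y_def D_def)
      also have "(LINT x|lebesgue. r h * (indicator {-A..A} (x - y) * K (x - y))) = r h * \<kappa> A"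
        unfolding \<kappa>_def by (rule valI) auto
      finally show ?thesis using True by simp
    next
      case False
      define y where "y = h - A"
      have "(LINT x|lebesgue. r x * K (x - y)) \<le> 
        (LINT x|lebesgue. r h * (indicator {-A..A} (x - y) * K (x - y)) + ?E y x)"
      proof (intro integral_mono Bochner_Integration.integrable_add int intR intk intW)
        show "integrable lebesgue (\<lambda>x. r h * (indicator {-A..A} (x - y) * K (x - y)))" by (rule intI) auto
        fix x :: real
        consider "x < X" | "X \<le> x" "x \<le> h" | "h < x" by linarith
        then show "r x * K (x - y) \<le> r h * (indicator {-A..A} (x - y) * K (x - y)) + ?E y x"
        proof cases
          case 1
          then have "x - y \<notin> {-A..A}" using h X2 by (auto simp: y_def)
          moreover have "r x * K (x - y) \<le> KB * \<bar>r x\<bar>" 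
            using low[of x "x - y"] abs_ge_self[of "r x * K (x - y)"] K_nonneg by (simp add: abs_mult)
          ultimately show ?thesis using 1 CK[of "x - y"] SK[of "x - y"] by simp
        next
          case 3
          then have "x - y \<notin> {-A..A}" by (auto simp: y_def)
          moreover have "r x * K (x - y) \<le> (S * (1 + \<epsilon> * h)) * ((1 + \<bar>x - y\<bar>) * K (x - y))"
            using tail[of x "x - y"] 3 hX A abs_ge_self[of "r x * K (x - y)"] K_nonneg by (simp add: abs_mult y_def)
          moreover have "0 \<le> KB * \<bar>indicator {..X} x * r x\<bar>" using KB0 by simp
          ultimately show ?thesis using CK[of "x - y"] by simp
        next
          case 2
          have "r x \<le> r h + C * (1 + (A + \<bar>x - y\<bar>))"
          proof -
            have "r x \<le> r h + C * (1 + (h - x))" using slow[of x "h - x"] 2 by simp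
            moreover have "C * (1 + (h - x)) \<le> C * (1 + (A + \<bar>x - y\<bar>))" 
              using C by (intro mult_left_mono) (auto simp: y_def)
            ultimately show ?thesis by linarith
          qed
          from mult_right_mono[OF this K_nonneg[of "x - y"]]
          have "r x * K (x - y) \<le> r h * K (x - y) + C * (1 + A) * ((1 + \<bar>x - y\<bar>) * K (x - y))"
            using CA[of "x - y"] by (simp add: distrib_right)
          moreover have "r h * K (x - y) \<le> r h * (indicator {-A..A} (x - y) * K (x - y))"
            using False K_nonneg by (intro mult_left_mono_neg) (auto simp: indicator_def)
          moreover have "0 \<le> (S * (1 + \<epsilon> * h)) * (indicator (- {-A..A}) (x - y) * ((1 + \<bar>x - y\<bar>) * K (x - y)))"
            using SK[of "x - y"] by (auto simp: indicator_def)
          moreover have "0 \<le> KB * \<bar>indicator {..X} x * r x\<bar>" using KB0 by simp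
          ultimately show ?thesis by linarith
        qed
      qed simp_all
      also have "\<dots> = (LINT x|lebesgue. r h * (indicator {-A..A} (x - y) * K (x - y))) + (KB * R + C * (1 + A) * k + S * (1 + \<epsilon> * h) * \<eta> A)"
        unfolding valE[symmetric, of y] by (rule Bochner_Integration.integral_add[OF intI intE]) auto
      also have "(LINT x|lebesgue. r h * (indicator {-A..A} (x - y) * K (x - y))) = r h * \<kappa> A"
        unfolding \<kappa>_def by (rule valI) auto
      finally have "- (r h * \<kappa> A) \<le> D + S * (1 + \<epsilon> * h) * \<eta> A" using bd[of y] h X2 by (simp add: y_def D_def)
      then show ?thesis using False by simp
    qed
  qed

  \<comment> \<open>On the compact stretch {X..X2}, slow decrease out of X bounds \<open>r\<close>
    from below and slow decrease into X2 bounds it from above.\<close>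
  define B2 where "B2 = \<bar>r X2\<bar> + \<bar>r X\<bar> + C * (1 + (X2 - X))"
  have near: "\<bar>r x\<bar> \<le> B2" if "X \<le> x" "x \<le> X2" for x
  proof -
    have "r X - C * (1 + (x - X)) \<le> r x" "r x \<le> r X2 + C * (1 + (X2 - x))"
      using slow[of X "x - X"] slow[of x "X2 - x"] that by auto
    moreover have "C * (1 + (x - X)) \<le> C * (1 + (X2 - X))" "C * (1 + (X2 - x)) \<le> C * (1 + (X2 - X))"
      using C that by (auto intro!: mult_left_mono)
    ultimately show ?thesis unfolding B2_def by linarith
  qed
  have D0: "D \<ge> 0"
  proof -
    have "B \<ge> 0" using bd[of Y] by simp
    then show ?thesis using KB0 R0 C A k0 by (simp add: D_def)
  qed
  have B20: "B2 \<ge> 0" using near[of X] X2 by simp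
  \<comment> \<open>The fixed point of S = B2 + D / \<kappa> A + S / 2, free of \<epsilon>.\<close>
  define M where "M = 2 * B2 + 2 * D / \<kappa> A"
  have M: "\<bar>r x\<bar> \<le> M * (1 + \<epsilon> * x)" if x: "x \<ge> X" and \<epsilon>: "0 < \<epsilon>" "\<epsilon> \<le> 1" for x \<epsilon>
  proof -
    have w1: "1 \<le> 1 + \<epsilon> * x" if "x \<ge> X" for x using \<epsilon> X that by simp
    let ?q = "\<lambda>x. \<bar>r x\<bar> / (1 + \<epsilon> * x)"
    define Q where "Q = 2 * C + \<bar>B\<bar> / k1 + KB * R / k1 + w0 * k / k1"
    have "bdd_above (?q ` {X..})"
    proof (rule bdd_aboveI2)
      fix x assume "x \<in> {X..}"
      then have x: "x \<ge> X" by simp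
      show "?q x \<le> max B2 ((Q + w0) / \<epsilon>)"
      proof (cases "x \<le> X2")
        case True
        have "?q x \<le> B2" using near[OF x True] w1[OF x] B20 
          by (smt (verit) divide_le_eq mult_left_mono mult_cancel_left1 mult_nonneg_nonneg)
        then show ?thesis by simp
      next
        case False
        have w00: "w0 \<ge> 0" using C by (simp add: w0_def)
        have x0: "x \<ge> 0" using x X by simp
        have "r x \<le> Q * (1 + x)"
        proof -
          have "r x \<le> 2 * C + (B + KB * R + w0 * (1 + x) * k) / k1" using upper[of x] False X2 A x by simp
          also have "\<dots> = (2 * C + B / k1 + KB * R / k1) * 1 + w0 * k / k1 * (1 + x)" by (simp add: add_divide_distrib mult_ac)
          also have "\<dots> \<le> (2 * C + \<bar>B\<bar> / k1 + KB * R / k1) * (1 + x) + w0 * k / k1 * (1 + x)"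
            using k1 C KB0 R0 x0 by (intro add_right_mono mult_mono add_mono divide_right_mono) auto
          finally show ?thesis by (simp add: Q_def algebra_simps)
        qed
        moreover have "Q \<ge> 0" using k1 C KB0 R0 w00 k0 by (simp add: Q_def)
        ultimately have "\<bar>r x\<bar> \<le> (Q + w0) * (1 + x)" using lower[OF x] w00 x0
          by (smt (verit) distrib_right mult_nonneg_nonneg)
        also have "(1 + x) \<le> (1 + \<epsilon> * x) / \<epsilon>" using \<epsilon> by (simp add: field_simps)
        finally have "\<bar>r x\<bar> \<le> (Q + w0) * ((1 + \<epsilon> * x) / \<epsilon>)" using \<open>Q \<ge> 0\<close> w00
          by (meson add_nonneg_nonneg mult_left_mono order_trans)
        then have "?q x \<le> (Q + w0) / \<epsilon>" using w1[OF x] by (simp add: pos_divide_le_eq)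
        then show ?thesis by simp
      qed
    qed
    note bdd = this
    define S where "S = (SUP x\<in>{X..}. ?q x)"
    have S: "\<bar>r x\<bar> \<le> S * (1 + \<epsilon> * x)" if "x \<ge> X" for x
    proof -
      have "?q x \<le> S" unfolding S_def by (rule cSUP_upper[OF _ bdd]) (use that in auto)
      then show ?thesis using w1[OF that] by (simp add: pos_divide_le_eq)
    qed
    have S0: "S \<ge> 0" 
    proof -
      have "0 \<le> S * (1 + \<epsilon> * X)" using S[of X] abs_ge_zero[of "r X"] by linarith
      moreover have "0 < 1 + \<epsilon> * X" using w1[of X] by linarith
      ultimately show ?thesis by (metis zero_le_mult_iff not_le)
    qed
    have "S \<le> B2 + D / \<kappa> A + S / 2" unfolding S_def
    proof (rule cSUP_least)
      fix x assume "x \<in> {X..}"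
      then have x: "x \<ge> X" by simp
      have "?q x \<le> B2 + D / \<kappa> A + S / 2"
      proof (cases "x \<le> X2")
        case True
        have "?q x \<le> B2" using near[OF x True] w1[OF x] B20 
          by (smt (verit) divide_le_eq mult_left_mono mult_cancel_left1 mult_nonneg_nonneg)
        moreover have "0 \<le> D / \<kappa> A" "0 \<le> S / 2" using D0 \<kappa>0 S0 by auto
        ultimately show ?thesis by linarith
      next
        case False
        have "\<bar>r x\<bar> * \<kappa> A \<le> D + S * (1 + \<epsilon> * x) * \<eta> A" 
          using key[OF _ \<epsilon> S0 S] False by auto
        also have "D \<le> D * (1 + \<epsilon> * x)" using D0 w1[OF x] by (simp add: mult_le_cancel_left1)
        also have "S * (1 + \<epsilon> * x) * \<eta> A \<le> S * (1 + \<epsilon> * x) * (\<kappa> A / 2)" 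
          using A S0 w1[OF x] by (intro mult_left_mono) auto
        also have "D * (1 + \<epsilon> * x) + S * (1 + \<epsilon> * x) * (\<kappa> A / 2) = (D / \<kappa> A + S / 2) * (1 + \<epsilon> * x) * \<kappa> A"
          using \<kappa>0 by (simp add: field_simps)
        finally have "\<bar>r x\<bar> * \<kappa> A \<le> (D / \<kappa> A + S / 2) * (1 + \<epsilon> * x) * \<kappa> A" by simp
        then have "\<bar>r x\<bar> \<le> (D / \<kappa> A + S / 2) * (1 + \<epsilon> * x)" using \<kappa>0 by simp
        then have "?q x \<le> D / \<kappa> A + S / 2" using w1[OF x] by (simp add: pos_divide_le_eq)
        then show ?thesis using B20 by simp
      qed
      then show "?q x \<le> B2 + D / \<kappa> A + (SUP x\<in>{X..}. ?q x) / 2" by (simp add: S_def)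
    qed auto
    then have "S \<le> M" by (simp add: M_def)
    then show ?thesis using S[OF x] w1[OF x] by (smt (verit) mult_right_mono)
  qed
  have "\<bar>r x\<bar> \<le> M" if x: "x \<ge> X" for x
  \<comment> \<open>As \<open>M\<close> does not depend on \<epsilon>, the weight may now be sent to
    1 at each fixed x.\<close>
  proof (rule tendsto_lowerbound[where F = "at_right 0" and f = "\<lambda>\<epsilon>. M * (1 + \<epsilon> * x)"])
    show "((\<lambda>\<epsilon>. M * (1 + \<epsilon> * x)) \<longlongrightarrow> M) (at_right 0)" by (auto intro!: tendsto_eq_intros)
    show "\<forall>\<^sub>F \<epsilon> in at_right 0. \<bar>r x\<bar> \<le> M * (1 + \<epsilon> * x)"
      using eventually_at_right_less[of 0] eventually_at_right_real[of 0 1]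
      by (auto elim!: eventually_mono intro!: M x)
  qed simp
  then show ?thesis by blast
qed

lemma integrable_decay:
  fixes f :: "real \<Rightarrow> real"
  assumes [measurable]: "f \<in> borel_measurable borel" and "\<And>u. \<bar>f u\<bar> \<le> C / (1 + u ^ 4)"
  shows "integrable lborel (\<lambda>u. (1 + \<bar>u\<bar>) * f u)"
proof (rule Bochner_Integration.integrable_bound)
  show "integrable lborel (\<lambda>u. (4 * \<bar>C\<bar>) * (1 / (1 + u\<^sup>2)))"
    by (intro integrable_mult_right integrable_inverse_square)
  show "AE u in lborel. norm ((1 + \<bar>u\<bar>) * f u) \<le> norm ((4 * \<bar>C\<bar>) * (1 / (1 + u\<^sup>2)))"
  proof (intro AE_I2)
    fix u :: real
    have p: "0 < 1 + u\<^sup>2" "0 < 1 + u ^ 4" by (auto intro: add_pos_nonneg)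
    \<comment> \<open>The estimates |u| <= (1 + u^2) / 2 and u^2 <= (1 + u^4) / 2 give this with
      room to spare.\<close>
    have "(1 + \<bar>u\<bar>) * (1 + u\<^sup>2) \<le> 4 * (1 + u ^ 4)"
    proof -
      have u: "\<bar>u\<bar> \<le> (1 + u\<^sup>2) / 2" using zero_le_power2[of "\<bar>u\<bar> - 1"] by (simp add: power2_diff)
      have u2: "u\<^sup>2 \<le> (1 + u ^ 4) / 2" using zero_le_power2[of "u\<^sup>2 - 1"] by (simp add: power2_diff)
      have "(1 + \<bar>u\<bar>) * (1 + u\<^sup>2) \<le> ((3 + u\<^sup>2) / 2) * (1 + u\<^sup>2)" using u p by (intro mult_right_mono) auto
      also have "\<dots> = (3 + 4 * u\<^sup>2 + u ^ 4) / 2" by (simp add: algebra_simps power2_eq_square power4_eq_xxxx)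
      also have "\<dots> \<le> 4 * (1 + u ^ 4)" 
      proof -
        define v where "v = u ^ 4"
        have "0 \<le> v" by (simp add: v_def)
        then show ?thesis using u2 unfolding v_def[symmetric] by simp
      qed
      finally show ?thesis .
    qed
    then have "(1 + \<bar>u\<bar>) / (1 + u ^ 4) \<le> 4 / (1 + u\<^sup>2)" using p by (simp add: field_simps)
    then have "\<bar>C\<bar> * ((1 + \<bar>u\<bar>) / (1 + u ^ 4)) \<le> \<bar>C\<bar> * (4 / (1 + u\<^sup>2))" by (rule mult_left_mono) simp
    moreover have "(1 + \<bar>u\<bar>) * \<bar>f u\<bar> \<le> (1 + \<bar>u\<bar>) * (\<bar>C\<bar> / (1 + u ^ 4))"
    proof (rule mult_left_mono)
      show "\<bar>f u\<bar> \<le> \<bar>C\<bar> / (1 + u ^ 4)"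
        using assms(2)[of u] p by (meson order_trans divide_right_mono abs_ge_self less_imp_le)
    qed simp
    ultimately show "norm ((1 + \<bar>u\<bar>) * f u) \<le> norm ((4 * \<bar>C\<bar>) * (1 / (1 + u\<^sup>2)))"
      using p by (simp add: abs_mult mult_ac)
  qed
qed measurable

lemma pos_kernel_measurable [measurable]: "pos_kernel \<in> borel_measurable borel"
  by (intro borel_measurable_continuous_onI continuous_on_pos_kernel)

lemma pos_kernel_tauberian:
  assumes l: "l > 0"
  shows "tauberian_kernel (\<lambda>u. pos_kernel (l * u))"
proof
  obtain C where C: "C > 0" "\<And>y. pos_kernel y \<le> C / (1 + y ^ 4)" using pos_kernel_decay by metis
  show "\<exists>B. \<forall>u. pos_kernel (l * u) \<le> B"
  proof (intro exI allI)
    fix u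
    have "C / (1 + (l * u) ^ 4) \<le> C / 1" using C(1) by (intro divide_left_mono) (auto intro: add_pos_nonneg)
    then show "pos_kernel (l * u) \<le> C" using C(2)[of "l * u"] by simp
  qed
  have "integrable lborel (\<lambda>u. (1 + \<bar>u\<bar>) * pos_kernel u)"
    using C pos_kernel_nonneg by (intro integrable_decay[where C = C]) auto
  from lborel_integrable_real_affine[OF this, of l 0] l
  have "integrable lborel (\<lambda>u. (1 + 1/l) * ((1 + \<bar>l * u\<bar>) * pos_kernel (l * u)))"
    by (intro integrable_mult_right) simp
  then show "integrable lborel (\<lambda>u. (1 + \<bar>u\<bar>) * pos_kernel (l * u))"
  proof (rule Bochner_Integration.integrable_bound)
    show "AE u in lborel. norm ((1 + \<bar>u\<bar>) * pos_kernel (l * u)) \<le> norm ((1 + 1/l) * ((1 + \<bar>l * u\<bar>) * pos_kernel (l * u)))"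
    proof (intro AE_I2)
      fix u
      have "1 + \<bar>u\<bar> \<le> (1 + 1/l) * (1 + \<bar>l * u\<bar>)" using l by (simp add: field_simps abs_mult)
      then show "norm ((1 + \<bar>u\<bar>) * pos_kernel (l * u)) \<le> norm ((1 + 1/l) * ((1 + \<bar>l * u\<bar>) * pos_kernel (l * u)))"
        using l pos_kernel_nonneg[of "l * u"] by (simp add: abs_mult mult.assoc[symmetric] mult_right_mono)
    qed
  qed measurable
  have cont: "continuous_on S (\<lambda>u. pos_kernel (l * u))" for S
    by (intro continuous_on_compose2[OF continuous_on_pos_kernel[of UNIV]] continuous_intros) auto
  have int: "(\<lambda>u. pos_kernel (l * u)) integrable_on {0..1}"
    by (intro integrable_continuous_interval cont)
  have "set_integrable lborel {0..1} (\<lambda>u. pos_kernel (l * u))"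
    by (intro borel_integrable_atLeastAtMost') (rule cont)
  then have eq: "(LINT u|lborel. indicator {0..1} u * pos_kernel (l * u)) = integral {0..1} (\<lambda>u. pos_kernel (l * u))"
    using set_borel_integral_eq_integral(2) by (force simp: set_lebesgue_integral_def)
  have "integral {0..1} (\<lambda>u. pos_kernel (l * u)) \<noteq> 0"
  proof
    assume "integral {0..1} (\<lambda>u. pos_kernel (l * u)) = 0"
    then have "((\<lambda>u. pos_kernel (l * u)) has_integral 0) (cbox 0 1)" using integrable_integral[OF int] by simp
    from has_integral_0_cbox_imp_0[OF _ _ this, of 0]
    have "pos_kernel (l * 0) = 0" using cont pos_kernel_nonneg by (auto simp: box_real)
    then show False using pos_kernel_0 by simp
  qed
  moreover have "integral {0..1} (\<lambda>u. pos_kernel (l * u)) \<ge> 0"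
    by (intro integral_nonneg int) (auto simp: pos_kernel_nonneg)
  ultimately show "(LINT u|lborel. indicator {0..1} u * pos_kernel (l * u)) > 0" unfolding eq by simp
qed (auto simp: pos_kernel_nonneg)

section \<open>From vanishing kernel averages to a vanishing function\<close>

text \<open>For given \<epsilon> the kernel is sharpened until nearly all its mass lies in a window
  of length \<delta>, on which slow decrease controls \<open>r\<close> up to \<epsilon>; the window
  lies to the right of h for the upper bound and to the left for the lower one. The sharpening
  depends on \<epsilon>, so averages at every scale \<open>l\<close> enter.\<close>

lemma tendsto_0_of_kernel_tendsto_0:
  fixes r :: "real \<Rightarrow> real"
  assumes [measurable]: "r \<in> borel_measurable lebesgue" and M: "\<And>x. \<bar>r x\<bar> \<le> M"
    and slow: "\<And>\<epsilon>. \<epsilon> > 0 \<Longrightarrow> \<exists>\<delta>>0. \<exists>X. \<forall>x\<ge>X. \<forall>u\<in>{0..\<delta>}. r (x + u) - r x \<ge> - \<epsilon>"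
    and conv: "\<And>l. l > 0 \<Longrightarrow> ((\<lambda>y. LINT x|lebesgue. r x * pos_kernel (l * (x - y))) \<longlongrightarrow> 0) at_top"
  shows "(r \<longlongrightarrow> 0) at_top"
proof -
  interpret P: tauberian_kernel pos_kernel using pos_kernel_tauberian[of 1] by simp
  have M0: "M \<ge> 0" using M[of 0] by simp
  \<comment> \<open>One \<epsilon> is spent on slow decrease within the window, one on the tail of
    the kernel, and one on the average itself.\<close>
  have "\<forall>\<^sub>F h in at_top. \<bar>r h\<bar> \<le> 3 * \<epsilon>" if \<epsilon>: "\<epsilon> > 0" for \<epsilon>
  proof -
    obtain \<delta> X where \<delta>: "\<delta> > 0" and sl: "\<And>x u. x \<ge> X \<Longrightarrow> 0 \<le> u \<Longrightarrow> u \<le> \<delta> \<Longrightarrow> r (x + u) - r x \<ge> - \<epsilon>"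
      using slow[OF \<epsilon>] by force
    define a where "a = \<delta> / 2"
    have a: "a > 0" using \<delta> by (simp add: a_def)
    define \<kappa> where "\<kappa> A = (LINT u|lborel. indicator {-A..A} u * pos_kernel u)" for A
    define \<eta> where "\<eta> A = (LINT u|lborel. indicator (- {-A..A}) u * pos_kernel u)" for A
    have \<eta>_le: "\<eta> A \<le> (LINT u|lborel. indicator (- {-A..A}) u * ((1 + \<bar>u\<bar>) * pos_kernel u))" for A
      unfolding \<eta>_def
      by (intro integral_mono P.integrable_indicator_K P.integrable_indicator_K_weight) 
         (auto simp: indicator_def pos_kernel_nonneg algebra_simps)
    \<comment> \<open>\<open>A\<close> is taken so large that the tail, weighted with the bound M of
      \<open>r\<close>, is at most \<epsilon> times the mass inside.\<close>
    have "((\<lambda>A. \<epsilon> * \<kappa> A - M * (LINT u|lborel. indicator (- {-A..A}) u * ((1 + \<bar>u\<bar>) * pos_kernel u)))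
       \<longlongrightarrow> \<epsilon> * (LINT u|lborel. pos_kernel u) - M * 0) at_top"
      unfolding \<kappa>_def by (intro tendsto_intros P.tendsto_indicator_K P.tendsto_tail_K_weight)
    then have "\<forall>\<^sub>F A in at_top. \<epsilon> * \<kappa> A - M * (LINT u|lborel. indicator (- {-A..A}) u * ((1 + \<bar>u\<bar>) * pos_kernel u)) > 0" 
      by (rule order_tendstoD(1)) (use P.integral_K_pos \<epsilon> in simp)
    then have "\<forall>\<^sub>F A in at_top. \<epsilon> * \<kappa> A - M * \<eta> A > 0 \<and> A > 0" 
      using eventually_gt_at_top[of 0] 
    proof eventually_elim
      case (elim A)
      then show ?case using mult_left_mono[OF \<eta>_le[of A] M0] by linarith
    qed
    then obtain A where A: "\<epsilon> * \<kappa> A - M * \<eta> A > 0" "A > 0" 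
      using eventually_happens' trivial_limit_at_top_linorder by blast
    have \<eta>0: "\<eta> A \<ge> 0" unfolding \<eta>_def by (intro integral_nonneg_AE) (auto simp: pos_kernel_nonneg)
    have \<kappa>0: "\<kappa> A > 0"
    proof -
      have "0 \<le> M * \<eta> A" using M0 \<eta>0 by simp
      then have "0 < \<epsilon> * \<kappa> A" using A by linarith
      then show ?thesis using \<epsilon> by (simp add: zero_less_mult_iff)
    qed
    \<comment> \<open>This scale carries the window {-a..a} of length \<delta> onto {-A..A}.\<close>
    define l where "l = A / a"
    have l: "l > 0" "l * a = A" using A a by (auto simp: l_def)
    interpret L: tauberian_kernel "\<lambda>u. pos_kernel (l * u)" by (rule pos_kernel_tauberian[OF l(1)])
    have ind: "indicator {-a..a} u = (indicator {-A..A} (l * u) :: real)" for u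
    proof -
      have "l * u \<le> A \<longleftrightarrow> u \<le> a" "- A \<le> l * u \<longleftrightarrow> - a \<le> u" 
        using l(1) mult_le_cancel_left_pos[of l u a] mult_le_cancel_left_pos[of l "-a" u] l(2) by auto
      then show ?thesis by (simp add: indicator_def)
    qed
    have ind': "indicator (- {-a..a}) u = (indicator (- {-A..A}) (l * u) :: real)" for u
      using ind[of u] by (auto simp: indicator_def split: if_splits)
    have v1: "(LINT u|lborel. indicator {-a..a} u * pos_kernel (l * u)) = \<kappa> A / l"
      unfolding \<kappa>_def ind using l(1) by (subst (2) lborel_integral_real_affine[of l _ 0]) auto
    have v2: "(LINT u|lborel. indicator (- {-a..a}) u * pos_kernel (l * u)) = \<eta> A / l"
      unfolding \<eta>_def ind' using l(1) by (subst (2) lborel_integral_real_affine[of l _ 0]) auto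
    have intI: "integrable lebesgue (\<lambda>x. c * (indicator S (x - y) * pos_kernel (l * (x - y))))" if "S \<in> sets borel" for c y S
      by (intro integrable_mult_right lebesgue_integrable_shift[OF L.integrable_indicator_K[OF that]])
    have valI: "(LINT x|lebesgue. c * (indicator S (x - y) * pos_kernel (l * (x - y)))) = 
       c * (LINT u|lborel. indicator S u * pos_kernel (l * u))" 
      if [measurable]: "S \<in> sets borel" for c y S
      by (subst integral_mult_right_zero, subst lebesgue_integral_shift[where f = "\<lambda>u. indicator S u * pos_kernel (l * u)"]) auto
    have int: "integrable lebesgue (\<lambda>x. r x * pos_kernel (l * (x - y)))" for y
    proof (rule Bochner_Integration.integrable_bound)
      show "integrable lebesgue (\<lambda>x. M * pos_kernel (l * (x - y)))"
        by (intro integrable_mult_right lebesgue_integrable_shift[OF L.K_integrable])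
      show "(\<lambda>x. r x * pos_kernel (l * (x - y))) \<in> borel_measurable lebesgue"
        by (intro borel_measurable_times assms borel_measurable_lebesgueI) measurable
      show "AE x in lebesgue. norm (r x * pos_kernel (l * (x - y))) \<le> norm (M * pos_kernel (l * (x - y)))"
        using M M0 pos_kernel_nonneg by (intro AE_I2) (auto simp: abs_mult intro!: mult_right_mono)
    qed
    let ?J = "\<lambda>y. LINT x|lebesgue. r x * pos_kernel (l * (x - y))"
    have up: "(r h - \<epsilon>) * (\<kappa> A / l) \<le> ?J (h + a) + M * (\<eta> A / l)" if h: "h \<ge> X" for h
    proof -
      define y where "y = h + a"
      have "(LINT x|lebesgue. (r h - \<epsilon>) * (indicator {-a..a} (x - y) * pos_kernel (l * (x - y)))) \<le>
        (LINT x|lebesgue. r x * pos_kernel (l * (x - y)) + M * (indicator (- {-a..a}) (x - y) * pos_kernel (l * (x - y))))"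
      proof (intro integral_mono Bochner_Integration.integrable_add int)
        fix x
        show "(r h - \<epsilon>) * (indicator {-a..a} (x - y) * pos_kernel (l * (x - y))) \<le>
            r x * pos_kernel (l * (x - y)) + M * (indicator (- {-a..a}) (x - y) * pos_kernel (l * (x - y)))"
        proof (cases "x - y \<in> {-a..a}")
          case True
          then have "r h - \<epsilon> \<le> r x" using sl[of h "x - h"] h by (auto simp: y_def a_def)
          from mult_right_mono[OF this pos_kernel_nonneg[of "l * (x - y)"]] show ?thesis using True by simp
        next
          case False
          have "- M \<le> r x" using M[of x] by (simp add: abs_le_iff)
          from mult_right_mono[OF this pos_kernel_nonneg[of "l * (x - y)"]] show ?thesis using False by simp
        qed
      qed (rule intI, simp)+
      also have "\<dots> = ?J y + M * (\<eta> A / l)"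
        by (subst Bochner_Integration.integral_add[OF int intI]) (simp, subst valI, auto simp: v2)
      also have "(LINT x|lebesgue. (r h - \<epsilon>) * (indicator {-a..a} (x - y) * pos_kernel (l * (x - y)))) = (r h - \<epsilon>) * (\<kappa> A / l)"
        by (subst valI) (auto simp: v1)
      finally show ?thesis by (simp add: y_def)
    qed
    have down: "?J (h - a) \<le> (r h + \<epsilon>) * (\<kappa> A / l) + M * (\<eta> A / l)" if h: "h \<ge> X + \<delta>" for h
    proof -
      define y where "y = h - a"
      have "?J y \<le>
        (LINT x|lebesgue. (r h + \<epsilon>) * (indicator {-a..a} (x - y) * pos_kernel (l * (x - y))) + M * (indicator (- {-a..a}) (x - y) * pos_kernel (l * (x - y))))"
      proof (intro integral_mono Bochner_Integration.integrable_add int)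
        fix x
        show "r x * pos_kernel (l * (x - y)) \<le> (r h + \<epsilon>) * (indicator {-a..a} (x - y) * pos_kernel (l * (x - y))) 
            + M * (indicator (- {-a..a}) (x - y) * pos_kernel (l * (x - y)))"
        proof (cases "x - y \<in> {-a..a}")
          case True
          then have "r x \<le> r h + \<epsilon>" using sl[of x "h - x"] h by (auto simp: y_def a_def)
          from mult_right_mono[OF this pos_kernel_nonneg[of "l * (x - y)"]] show ?thesis using True by simp
        next
          case False
          have "r x \<le> M" using M[of x] by (simp add: abs_le_iff)
          from mult_right_mono[OF this pos_kernel_nonneg[of "l * (x - y)"]] show ?thesis using False by simp
        qed
      qed (rule intI, simp)+
      also have "\<dots> = (r h + \<epsilon>) * (\<kappa> A / l) + M * (\<eta> A / l)"
        by (subst Bochner_Integration.integral_add[OF intI intI]) (simp, simp, subst valI, simp, subst valI, auto simp: v1 v2)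
      finally show ?thesis by (simp add: y_def)
    qed
    have "\<forall>\<^sub>F y in at_top. dist (?J y) 0 < \<epsilon> * \<kappa> A / l"
      using conv[OF l(1)] \<epsilon> \<kappa>0 l(1) by (intro tendstoD) auto
    then obtain Y where Y: "\<And>y. y \<ge> Y \<Longrightarrow> \<bar>?J y\<bar> < \<epsilon> * \<kappa> A / l"
      by (auto simp: eventually_at_top_linorder)
    have tail: "M * (\<eta> A / l) \<le> \<epsilon> * (\<kappa> A / l)"
      using A l(1) by (simp add: divide_right_mono)
    have "\<bar>r h\<bar> \<le> 3 * \<epsilon>" if "h \<ge> X + \<delta>" "h \<ge> Y + a" for h
    proof -
      have 1: "(r h - \<epsilon>) * (\<kappa> A / l) \<le> (2 * \<epsilon>) * (\<kappa> A / l)"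
        using up[of h] Y[of "h + a"] tail that a \<delta> by (simp add: abs_less_iff)
      have 2: "(- 2 * \<epsilon>) * (\<kappa> A / l) \<le> (r h + \<epsilon>) * (\<kappa> A / l)"
        using down[of h] Y[of "h - a"] tail that a \<delta> by (simp add: abs_less_iff)
      have "0 < \<kappa> A / l" using \<kappa>0 l by simp
      then have "r h - \<epsilon> \<le> 2 * \<epsilon>" "- 2 * \<epsilon> \<le> r h + \<epsilon>" 
        using mult_right_le_imp_le[OF 1] mult_right_le_imp_le[OF 2] by auto
      then show ?thesis by (simp add: abs_le_iff)
    qed
    then show ?thesis unfolding eventually_at_top_linorder
      by (intro exI[of _ "max (X + \<delta>) (Y + a)"]) auto
  qed
  note * = this
  show ?thesis
  proof (rule tendstoI)
    fix e :: real assume "e > 0"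
    then have "\<forall>\<^sub>F h in at_top. \<bar>r h\<bar> \<le> 3 * (e / 6)" by (intro *) auto
    then show "\<forall>\<^sub>F h in at_top. dist (r h) 0 < e"
      by eventually_elim (use \<open>e > 0\<close> in auto)
  qed
qed

subsection \<open>Localisation of the singular set\<close>

text \<open>\<open>g\<close> is only Lebesgue measurable while the kernels are Borel, so Fubini is
  applied to the mixed product of \<open>lborel\<close> and \<open>lebesgue\<close>; this provides
  its second factor.\<close>

lemma sigma_finite_lebesgue: "sigma_finite_measure (lebesgue :: 'a::euclidean_space measure)"
proof
  obtain A :: "'a set set" where A: "countable A" "A \<subseteq> sets lborel" "\<Union>A = space lborel" "\<forall>a\<in>A. emeasure lborel a \<noteq> \<infinity>"
    using lborel.sigma_finite_countable by blast
  then show "\<exists>A::'a set set. countable A \<and> A \<subseteq> sets lebesgue \<and> \<Union> A = space lebesgue \<and> (\<forall>a\<in>A. emeasure lebesgue a \<noteq> \<infinity>)"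
    by (intro exI[of _ A]) (use sets_completionI_sets in \<open>auto simp: subset_eq\<close>)
qed

interpretation lebesgue: sigma_finite_measure "lebesgue :: real measure" by (rule sigma_finite_lebesgue)

interpretation lborel_lebesgue: pair_sigma_finite "lborel :: real measure" "lebesgue :: real measure" ..

lemma borel_measurable_snd_lborel_lebesgue:
  "snd \<in> borel_measurable (lborel \<Otimes>\<^sub>M (lebesgue :: real measure))"
  using measurable_compose[OF measurable_snd id_borel_measurable_lebesgue] by (simp add: id_def)

lemma integrable_indicator_Icc:
  "integrable lborel (\<lambda>x. indicator {a..b::real} x :: real)" "integrable lebesgue (\<lambda>x. indicator {a..b::real} x :: real)"
  by (rule integrable_real_indicator; auto simp: emeasure_lborel_Icc_eq)+

lemma integral_FTC_atLeast:
  fixes \<Psi> :: "real \<Rightarrow> complex"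
  assumes "\<And>x. (\<Psi> has_vector_derivative \<Psi>' x) (at x)" "continuous_on UNIV \<Psi>'" "integrable lborel \<Psi>'"
    and "(\<Psi> \<longlongrightarrow> 0) at_top"
  shows "(LINT y|lborel. indicator {a..} y *\<^sub>R \<Psi>' y) = - \<Psi> a"
proof -
  have "((\<lambda>b. LINT y:{a..b}|lborel. \<Psi>' y) \<longlongrightarrow> (LINT y:{a..}|lborel. \<Psi>' y)) at_top"
    by (rule tendsto_set_lebesgue_integral_at_top) 
      (use assms(3) in \<open>auto simp: set_integrable_def intro!: integrable_mult_indicator\<close>)
  moreover have "((\<lambda>b. LINT y:{a..b}|lborel. \<Psi>' y) \<longlongrightarrow> 0 - \<Psi> a) at_top"
  proof (rule Lim_transform_eventually)
    show "((\<lambda>b. \<Psi> b - \<Psi> a) \<longlongrightarrow> 0 - \<Psi> a) at_top" by (intro tendsto_intros assms)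
    show "\<forall>\<^sub>F b in at_top. \<Psi> b - \<Psi> a = (LINT y:{a..b}|lborel. \<Psi>' y)"
      using eventually_ge_at_top[of a]
    proof eventually_elim
      case (elim b)
      have "(LINT y|lborel. indicator {a..b} y *\<^sub>R \<Psi>' y) = \<Psi> b - \<Psi> a"
        using elim assms(1,2)
        by (intro integral_FTC_Icc) (auto intro: has_vector_derivative_at_within continuous_on_subset)
      then show ?case by (simp add: set_lebesgue_integral_def)
    qed
  qed
  ultimately show ?thesis using tendsto_unique[OF trivial_limit_at_top_linorder] by (auto simp: set_lebesgue_integral_def)
qed

text \<open>\<open>q\<close> has no regularity, so the integration by parts is done by Fubini:
  \<Psi> x is minus the integral of \<Psi>' over {x..}, and exchanging the integrals leaves \<Psi>'
  against the partial integrals of \<open>q\<close>, which are at most M. The weight in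
  \<open>w\<close> pays for the crude bound B |y| that makes the double integral absolutely
  convergent.\<close>

lemma integration_by_parts_bound:
  fixes q \<Psi> :: "real \<Rightarrow> complex"
  assumes q_meas [measurable]: "q \<in> borel_measurable lebesgue" and q_bd: "\<And>x. norm (q x) \<le> B" and q_0: "\<And>x. x < 0 \<Longrightarrow> q x = 0"
    and S: "\<And>x. x > 0 \<Longrightarrow> norm (LINT y|lebesgue. indicator {0..x} y *\<^sub>R q y) \<le> M"
    and d: "\<And>x. (\<Psi> has_vector_derivative \<Psi>' x) (at x)" and cont: "continuous_on UNIV \<Psi>'" 
    and w: "integrable lborel (\<lambda>y. (1 + \<bar>y\<bar>) * norm (\<Psi>' y))" and lim: "(\<Psi> \<longlongrightarrow> 0) at_top"
  shows "norm (LINT x|lebesgue. q x * \<Psi> x) \<le> M * (LINT y|lborel. norm (\<Psi>' y))"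
proof -
  have B0: "B \<ge> 0" using q_bd[of 0] norm_ge_zero order_trans by blast
  have M0: "M \<ge> 0" using S[of 1] norm_ge_zero order_trans zero_less_one by blast
  have [measurable]: "\<Psi>' \<in> borel_measurable borel" by (intro borel_measurable_continuous_onI cont)
  have int': "integrable lborel \<Psi>'"
    by (rule Bochner_Integration.integrable_bound[OF w]) (auto simp: algebra_simps)
  \<comment> \<open>The triangle 0 <= x <= y, to be read as a cut-off in x at y or as a cut-off in y
    at x; the second reading uses that \<open>q\<close> vanishes on the negative axis.\<close>
  define F where "F y x = (if 0 \<le> x \<and> x \<le> y then q x * \<Psi>' y else 0)" for y x
  have F_eq1: "F y x = (indicator {0..y} x *\<^sub>R q x) * \<Psi>' y" for x y by (auto simp: F_def indicator_def)
  have F_eq2: "F y x = q x * (indicator {x..} y *\<^sub>R \<Psi>' y)" for x y using q_0[of x] by (auto simp: F_def indicator_def)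
  note [measurable] = borel_measurable_snd_lborel_lebesgue
  have F_meas [measurable]: "case_prod F \<in> borel_measurable (lborel \<Otimes>\<^sub>M lebesgue)"
    unfolding F_def split_beta by measurable
  have int_q: "integrable lebesgue (\<lambda>x. indicator {0..y} x *\<^sub>R q x)" for y
  proof (rule Bochner_Integration.integrable_bound)
    show "integrable lebesgue (\<lambda>x. B * indicator {0..y} x)"
      by (intro integrable_mult_right integrable_indicator_Icc)
    show "AE x in lebesgue. norm (indicator {0..y} x *\<^sub>R q x) \<le> norm (B * indicator {0..y} x)"
      using q_bd B0 by (intro AE_I2) (auto simp: indicator_def)
  qed (auto intro!: borel_measurable_scaleR borel_measurable_indicator)
  have "integrable (lborel \<Otimes>\<^sub>M lebesgue) (case_prod F)"
  proof (rule lborel_lebesgue.Fubini_integrable[OF F_meas])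
    show "AE y in lborel. integrable lebesgue (\<lambda>x. case_prod F (y, x))"
      unfolding prod.case F_eq1 by (intro AE_I2 integrable_mult_left int_q)
    show "integrable lborel (\<lambda>y. LINT x|lebesgue. norm (case_prod F (y, x)))"
    proof (rule Bochner_Integration.integrable_bound)
      show "integrable lborel (\<lambda>y. B * ((1 + \<bar>y\<bar>) * norm (\<Psi>' y)))" by (intro integrable_mult_right w)
      show "(\<lambda>y. LINT x|lebesgue. norm (case_prod F (y, x))) \<in> borel_measurable lborel"
        by (rule lebesgue.borel_measurable_lebesgue_integral) (simp, measurable)
      show "AE y in lborel. norm (LINT x|lebesgue. norm (case_prod F (y, x))) \<le> norm (B * ((1 + \<bar>y\<bar>) * norm (\<Psi>' y)))"
      proof (intro AE_I2)
        fix y :: real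
        have "(LINT x|lebesgue. norm (F y x)) \<le> (LINT x|lebesgue. (B * norm (\<Psi>' y)) * indicator {0..y} x)"
        proof (rule integral_mono)
          show "integrable lebesgue (\<lambda>x. norm (F y x))"
            unfolding F_eq1 by (intro integrable_norm integrable_mult_left int_q)
          show "integrable lebesgue (\<lambda>x. B * norm (\<Psi>' y) * indicator {0..y} x)"
            by (intro integrable_mult_right integrable_indicator_Icc)
          show "norm (F y x) \<le> B * norm (\<Psi>' y) * indicator {0..y} x" for x
            using q_bd[of x] by (auto simp: F_def indicator_def norm_mult intro!: mult_right_mono)
        qed
        also have "\<dots> = (B * norm (\<Psi>' y)) * max 0 y" by (simp add: max_def)
        also have "\<dots> \<le> (B * norm (\<Psi>' y)) * (1 + \<bar>y\<bar>)" using B0 by (intro mult_left_mono) auto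
        finally have "(LINT x|lebesgue. norm (F y x)) \<le> B * ((1 + \<bar>y\<bar>) * norm (\<Psi>' y))" by (simp add: mult_ac)
        moreover have "0 \<le> (LINT x|lebesgue. norm (F y x))" by simp
        ultimately show "norm (LINT x|lebesgue. norm (case_prod F (y, x))) \<le> norm (B * ((1 + \<bar>y\<bar>) * norm (\<Psi>' y)))"
          using B0 by (simp add: abs_mult)
      qed
    qed
  qed
  then have "(LINT x|lebesgue. LINT y|lborel. F y x) = (LINT y|lborel. LINT x|lebesgue. F y x)"
    by (rule lborel_lebesgue.Fubini_integral)
  also have "(LINT x|lebesgue. LINT y|lborel. F y x) = - (LINT x|lebesgue. q x * \<Psi> x)"
    unfolding F_eq2 integral_mult_right_zero integral_FTC_atLeast[OF d cont int' lim] by simp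
  finally have "norm (LINT x|lebesgue. q x * \<Psi> x) = norm (LINT y|lborel. LINT x|lebesgue. F y x)"
    by (metis norm_minus_cancel)
  also have "\<dots> = norm (LINT y|lborel. (LINT x|lebesgue. indicator {0..y} x *\<^sub>R q x) * \<Psi>' y)"
    unfolding F_eq1 integral_mult_left_zero ..
  also have "\<dots> \<le> (LINT y|lborel. M * norm (\<Psi>' y))"
  proof (rule Bochner_Integration.integral_norm_bound_integral)
    show *: "norm ((LINT x|lebesgue. indicator {0..y} x *\<^sub>R q x) * \<Psi>' y) \<le> M * norm (\<Psi>' y)" for y
    proof (cases "y > 0")
      case False
      \<comment> \<open>For y <= 0 the interval is empty or a single point, so the integral vanishes
        although \<open>S\<close> speaks of positive endpoints only.\<close>
      have "(LINT x|lebesgue. indicator {0..y} x *\<^sub>R q x) = (LINT (x::real)|lebesgue. 0)"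
      proof (rule integral_cong_AE)
        have "AE x in lebesgue. x \<noteq> (0::real)" by (intro AE_completion AE_lborel_singleton)
        then show "AE x in lebesgue. indicator {0..y} x *\<^sub>R q x = 0"
          by (rule AE_mp) (use False in \<open>auto simp: indicator_def intro!: AE_I2\<close>)
      qed (auto intro!: borel_measurable_scaleR borel_measurable_indicator)
      then show ?thesis using M0 by simp
    qed (auto simp: norm_mult intro!: mult_right_mono S)
    show "integrable lborel (\<lambda>y. M * norm (\<Psi>' y))" by (intro integrable_mult_right integrable_norm int')
    show "integrable lborel (\<lambda>y. (LINT x|lebesgue. indicator {0..y} x *\<^sub>R q x) * \<Psi>' y)"
    proof (rule Bochner_Integration.integrable_bound)
      show "integrable lborel (\<lambda>y. M * norm (\<Psi>' y))" by (intro integrable_mult_right integrable_norm int')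
      show "AE y in lborel. norm ((LINT x|lebesgue. indicator {0..y} x *\<^sub>R q x) * \<Psi>' y) \<le> norm (M * norm (\<Psi>' y))"
        using * M0 by (intro AE_I2) (simp add: abs_mult)
      have "(\<lambda>y. LINT x|lebesgue. F y x) \<in> borel_measurable lborel"
        by (rule lebesgue.borel_measurable_lebesgue_integral) (rule F_meas)
      then show "(\<lambda>y. (LINT x|lebesgue. indicator {0..y} x *\<^sub>R q x) * \<Psi>' y) \<in> borel_measurable lborel"
        unfolding F_eq1 integral_mult_left_zero .
    qed
  qed
  finally show ?thesis by simp
qed

section \<open>Pairings and their localisation by a partition of unity\<close>

text \<open>For bounded \<open>g\<close> this is the distributional Fourier transform of
  \<open>g\<close>, evaluated at e^(iht) \<phi>(t); see \<open>fourier_modulate\<close>.\<close>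

definition pairing :: "(real \<Rightarrow> complex) \<Rightarrow> (real \<Rightarrow> complex) \<Rightarrow> real \<Rightarrow> complex" where
  "pairing g \<phi> h = (LINT x|lebesgue. g x * fourier \<phi> (x - h))"

text \<open>The transform of \<open>g\<close> behaves on V as a local pseudofunction in the
  direction h -> +\<infinity>, the one that sees \<open>g\<close> near +\<infinity>.\<close>

definition regular_on :: "(real \<Rightarrow> complex) \<Rightarrow> real set \<Rightarrow> bool" where
  "regular_on g V \<longleftrightarrow> (\<forall>\<phi>. test_fun V \<phi> \<longrightarrow> (pairing g \<phi> \<longlongrightarrow> 0) at_top)"

lemma fourier_measurable: "test_fun U \<phi> \<Longrightarrow> fourier \<phi> \<in> borel_measurable borel"
  by (intro borel_measurable_continuous_onI continuous_on_fourier)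

lemma fourier_weight_integrable:
  assumes "test_fun U \<phi>" shows "integrable lborel (\<lambda>y. (1 + \<bar>y\<bar>) * norm (fourier \<phi> y))"
proof -
  obtain C where "\<And>y. norm (fourier \<phi> y) \<le> C / (1 + y ^ 4)" using fourier_decay_bound[OF assms] by metis
  then show ?thesis
    using fourier_measurable[OF assms] by (intro integrable_decay[where C = C]) auto
qed

lemma fourier_fun_integrable:
  assumes "test_fun U \<phi>" shows "integrable lborel (fourier \<phi>)"
  by (rule Bochner_Integration.integrable_bound[OF fourier_weight_integrable[OF assms]])
     (use fourier_measurable[OF assms] in \<open>auto simp: algebra_simps\<close>)

lemma tendsto_fourier_at_infinity:
  assumes "test_fun U \<phi>" shows "(fourier \<phi> \<longlongrightarrow> 0) at_infinity"
proof -
  obtain C where C: "\<And>y. norm (fourier \<phi> y) * \<bar>y\<bar> ^ 1 \<le> C" using fourier_decay[OF assms, of 1] by blast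
  have "((\<lambda>y. C / norm y) \<longlongrightarrow> 0) at_infinity"
    by (intro tendsto_divide_0[OF tendsto_const] filterlim_at_top_imp_at_infinity filterlim_norm_at_top)
  then show ?thesis
  proof (rule Lim_null_comparison[rotated])
    have "\<forall>\<^sub>F y::real in at_infinity. norm y \<ge> 1" by (auto simp: eventually_at_infinity)
    then show "\<forall>\<^sub>F y in at_infinity. norm (fourier \<phi> y) \<le> C / norm y"
      by eventually_elim (use C in \<open>simp add: pos_le_divide_eq\<close>)
  qed
qed

lemma pairing_integrable:
  assumes "g \<in> borel_measurable lebesgue" "\<And>x. norm (g x) \<le> B" "test_fun U \<phi>"
  shows "integrable lebesgue (\<lambda>x. g x * fourier \<phi> (x - h))"
proof (rule Bochner_Integration.integrable_bound)
  have i: "integrable lebesgue (\<lambda>x. fourier \<phi> (x - h))"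
    by (rule lebesgue_integrable_shift[OF fourier_fun_integrable[OF assms(3)]])
  show "integrable lebesgue (\<lambda>x. B * norm (fourier \<phi> (x - h)))"
    by (intro integrable_mult_right integrable_norm i)
  show "(\<lambda>x. g x * fourier \<phi> (x - h)) \<in> borel_measurable lebesgue"
    using assms(1) i by (intro borel_measurable_times) auto
  show "AE x in lebesgue. norm (g x * fourier \<phi> (x - h)) \<le> norm (B * norm (fourier \<phi> (x - h)))"
    using order_trans[OF norm_ge_zero assms(2)[of 0]]
    by (intro AE_I2) (auto simp: norm_mult abs_mult assms(2) intro!: mult_right_mono)
qed

lemma pairing_sum:
  assumes "g \<in> borel_measurable lebesgue" "\<And>x. norm (g x) \<le> B" "\<And>j. j \<in> J \<Longrightarrow> test_fun U (\<phi> j)" 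
  shows "pairing g (\<lambda>t. \<Sum>j\<in>J. \<phi> j t) h = (\<Sum>j\<in>J. pairing g (\<phi> j) h)"
proof -
  have "fourier (\<lambda>t. \<Sum>j\<in>J. \<phi> j t) y = (\<Sum>j\<in>J. fourier (\<phi> j) y)" for y
    unfolding fourier_def sum_distrib_left
    by (rule Bochner_Integration.integral_sum) (rule fourier_integrable[OF assms(3)])
  then show ?thesis unfolding pairing_def sum_distrib_left
    by (simp add: sum_distrib_left) (rule Bochner_Integration.integral_sum, rule pairing_integrable[OF assms])
qed

definition piece :: "(real \<Rightarrow> complex) \<Rightarrow> real \<Rightarrow> int \<Rightarrow> real \<Rightarrow> complex" where
  "piece \<phi> \<delta> j t = unit_part (t / \<delta> - of_int j) * \<phi> t"

lemma piece_eq_0: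
  assumes "\<delta> > 0" "t \<notin> {\<delta> * of_int j..\<delta> * (of_int j + 2)}"
  shows "piece \<phi> \<delta> j t = 0"
proof -
  have "t / \<delta> - of_int j \<le> 0 \<or> t / \<delta> - of_int j \<ge> 2"
    using assms by (auto simp: field_simps)
  then show ?thesis by (simp add: piece_def unit_part_eq_0)
qed

lemma smooth_fun_piece: "smooth_fun \<phi> \<Longrightarrow> smooth_fun (piece \<phi> \<delta> j)"
  unfolding piece_def[abs_def]
  using smooth_fun_affine[OF smooth_fun_unit_part, of "1/\<delta>" "- of_int j"] by (intro smooth_fun_mult) auto

lemma test_fun_piece: "test_fun U \<phi> \<Longrightarrow> test_fun U (piece \<phi> \<delta> j)"
  unfolding piece_def[abs_def]
  using smooth_fun_affine[OF smooth_fun_unit_part, of "1/\<delta>" "- of_int j"] by (intro test_fun_mult) auto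

lemma test_fun_pieceI:
  assumes "smooth_fun \<phi>" "compact C" "\<And>t. t \<notin> C \<Longrightarrow> \<phi> t = 0" "\<delta> > 0" 
    and "C \<inter> {\<delta> * of_int j..\<delta> * (of_int j + 2)} \<subseteq> U"
  shows "test_fun U (piece \<phi> \<delta> j)"
proof (rule test_funI[OF smooth_fun_piece[OF assms(1)] _ assms(5)])
  show "compact (C \<inter> {\<delta> * of_int j..\<delta> * (of_int j + 2)})" using assms(2) by (intro compact_Int) auto
  show "t \<in> C \<inter> {\<delta> * of_int j..\<delta> * (of_int j + 2)}" if "piece \<phi> \<delta> j t \<noteq> 0" for t
    using that piece_eq_0[OF assms(4)] assms(3) by (auto simp: piece_def)
qed

lemma partition_pieces:
  assumes "test_fun U \<phi>" "\<delta> > 0"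
  obtains J where "finite J" "\<phi> = (\<lambda>t. \<Sum>j\<in>J. piece \<phi> \<delta> j t)"
proof -
  obtain R where R: "R > 0" "\<And>t. t \<notin> {-R..R} \<Longrightarrow> \<phi> t = 0"
    using test_fun_bounded_support[OF assms(1)] by blast
  define n where "n = nat \<lceil>R / \<delta>\<rceil>"
  have n: "R / \<delta> \<le> real n" unfolding n_def by linarith
  have "\<phi> t = (\<Sum>j\<in>{-int n-1..int n}. piece \<phi> \<delta> j t)" for t
  proof (cases "t \<in> {-R..R}")
    case True
    then have "\<bar>t / \<delta>\<bar> \<le> R / \<delta>" using assms(2) by (auto simp: abs_le_iff divide_right_mono field_simps)
    then have "(\<Sum>j\<in>{-int n-1..int n}. unit_part (t / \<delta> - of_int j)) = 1" using n by (intro sum_unit_part) simp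
    then show ?thesis by (simp add: piece_def sum_distrib_right[symmetric])
  qed (simp add: R(2) piece_def)
  then show thesis by (intro that[of "{-int n-1..int n}"]) auto
qed

text \<open>Regularity is local: with a Lebesgue number of the cover, a fine partition of unity cuts
  \<phi> into finitely many pieces, each supported in a single member of G. Hence there is a largest
  open set of regularity.\<close>

lemma regular_on_Union:
  assumes "g \<in> borel_measurable lebesgue" "\<And>x. norm (g x) \<le> B"
    and G: "\<And>V. V \<in> G \<Longrightarrow> open V \<and> regular_on g V"
  shows "regular_on g (\<Union>G)"
  unfolding regular_on_def
proof (intro allI impI)
  fix \<phi> assume \<phi>: "test_fun (\<Union>G) \<phi>"
  obtain C where C: "compact C" "C \<subseteq> \<Union>G" "\<And>t. t \<notin> C \<Longrightarrow> \<phi> t = 0" using test_fun_support[OF \<phi>] by metis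
  obtain e where e: "e > 0" "\<And>x. x \<in> C \<Longrightarrow> \<exists>V\<in>G. ball x e \<subseteq> V"
    using Heine_Borel_lemma[OF C(1,2)] G by metis
  \<comment> \<open>A piece is supported in an interval of length 2 \<delta> < e, which therefore
    lies in the ball of radius e around any of its points.\<close>
  define \<delta> where "\<delta> = e / 3"
  have \<delta>: "\<delta> > 0" using e by (simp add: \<delta>_def)
  obtain J where J: "finite J" "\<phi> = (\<lambda>t. \<Sum>j\<in>J. piece \<phi> \<delta> j t)"
    using partition_pieces[OF \<phi> \<delta>] by metis
  have "(pairing g (piece \<phi> \<delta> j) \<longlongrightarrow> 0) at_top" for j
  proof (cases "C \<inter> {\<delta> * of_int j..\<delta> * (of_int j + 2)} = {}")
    case True
    have "piece \<phi> \<delta> j t = 0" for t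
    proof (cases "t \<in> C")
      case True
      then show ?thesis using \<open>C \<inter> _ = {}\<close> by (intro piece_eq_0[OF \<delta>]) auto
    qed (simp add: piece_def C(3))
    then have "piece \<phi> \<delta> j = (\<lambda>_. 0)" by auto
    then show ?thesis by (simp add: pairing_def[abs_def] fourier_def[abs_def])
  next
    case False
    then obtain x where x: "x \<in> C" "x \<in> {\<delta> * of_int j..\<delta> * (of_int j + 2)}" by blast
    obtain V where V: "V \<in> G" "ball x e \<subseteq> V" using e(2)[OF x(1)] by blast
    have "{\<delta> * of_int j..\<delta> * (of_int j + 2)} \<subseteq> ball x e"
      using x(2) e(1) by (auto simp: dist_real_def \<delta>_def field_simps)
    then have "test_fun V (piece \<phi> \<delta> j)"
      using V by (intro test_fun_pieceI[OF test_fun_smooth[OF \<phi>] C(1,3) \<delta>]) auto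
    then show ?thesis using G[OF V(1)] by (auto simp: regular_on_def)
  qed
  then have "((\<lambda>h. \<Sum>j\<in>J. pairing g (piece \<phi> \<delta> j) h) \<longlongrightarrow> (\<Sum>j\<in>J. 0)) at_top"
    by (intro tendsto_sum) auto
  moreover have "pairing g \<phi> = (\<lambda>h. \<Sum>j\<in>J. pairing g (piece \<phi> \<delta> j) h)"
    by (subst J(2), rule ext) (rule pairing_sum[OF assms(1,2)], rule test_fun_piece[OF \<phi>])
  ultimately show "(pairing g \<phi> \<longlongrightarrow> 0) at_top" by simp
qed

lemma test_fun_bounded:
  assumes "test_fun U \<phi>" obtains B where "\<And>t. norm (\<phi> t) \<le> B"
proof -
  obtain R where R: "R > 0" "\<And>t. t \<notin> {-R..R} \<Longrightarrow> \<phi> t = 0"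
    using test_fun_bounded_support[OF assms] by blast
  have "compact (\<phi> ` {-R..R})"
    by (intro compact_continuous_image smooth_fun_continuous) (auto intro: test_fun_smooth[OF assms])
  then have "bounded (\<phi> ` {-R..R})" by (rule compact_imp_bounded)
  then have "\<exists>B. \<forall>t\<in>{-R..R}. norm (\<phi> t) \<le> B" unfolding bounded_iff by simp
  then obtain B where B: "\<And>t. t \<in> {-R..R} \<Longrightarrow> norm (\<phi> t) \<le> B" by metis
  have "norm (\<phi> t) \<le> max B 0" for t using R(2)[of t] B[of t] by (cases "t \<in> {-R..R}") auto
  then show thesis using that by blast
qed

lemma L1_bound:
  fixes f :: "real \<Rightarrow> complex"
  assumes "integrable lborel f" "\<And>t. t \<notin> {a..b} \<Longrightarrow> f t = 0" "\<And>t. t \<in> {a..b} \<Longrightarrow> norm (f t) \<le> c" "a \<le> b"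
  shows "(LINT t|lborel. norm (f t)) \<le> c * (b - a)"
proof -
  have "(LINT t|lborel. norm (f t)) \<le> (LINT t|lborel. c * indicator {a..b} t)"
    using assms by (intro integral_mono integrable_norm integrable_mult_right integrable_indicator_Icc) (auto simp: indicator_def)
  also have "\<dots> = c * (b - a)" using assms by simp
  finally show ?thesis .
qed

lemma test_fun_unit_part: "test_fun UNIV unit_part"
proof (rule test_funI[OF smooth_fun_unit_part, of "{0..2}"])
  show "t \<in> {0..2}" if "unit_part t \<noteq> 0" for t using that unit_part_eq_0[of t] by (cases "t \<le> 0 \<or> t \<ge> 2") auto
qed auto

text \<open>The function (t - t0) times the piece has size \<delta> on an interval of length 2
  \<delta>, so its L1 norm is O(\<delta>^2). Two derivatives cost \<delta>^(-2), so its second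
  derivative has L1 norm O(1). The two estimates combine to the bound, with a constant that is
  uniform in the position j and in t0.\<close>

lemma fourier_piece_moment_bound:
  assumes \<phi>: "test_fun UNIV \<phi>"
  shows "\<exists>C\<ge>0. \<forall>\<delta> j t0 y. 0 < \<delta> \<longrightarrow> \<delta> \<le> 1 \<longrightarrow> t0 \<in> {\<delta> * of_int j..\<delta> * (of_int j + 2)} \<longrightarrow> 
     norm (fourier (\<lambda>t. (of_real t - of_real t0) * piece \<phi> \<delta> j t) y) \<le> C * \<delta>\<^sup>2 / (1 + (\<delta> * y)\<^sup>2)"
proof -
  obtain \<phi>1 where \<phi>1: "test_fun UNIV \<phi>1" "\<And>x. (\<phi> has_vector_derivative \<phi>1 x) (at x)" using test_fun_deriv[OF \<phi>] by metis
  obtain \<phi>2 where \<phi>2: "test_fun UNIV \<phi>2" "\<And>x. (\<phi>1 has_vector_derivative \<phi>2 x) (at x)" using test_fun_deriv[OF \<phi>1(1)] by metis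
  obtain \<chi>1 where \<chi>1: "test_fun UNIV \<chi>1" "\<And>x. (unit_part has_vector_derivative \<chi>1 x) (at x)" 
    using test_fun_deriv[OF test_fun_unit_part] by metis
  obtain \<chi>2 where \<chi>2: "test_fun UNIV \<chi>2" "\<And>x. (\<chi>1 has_vector_derivative \<chi>2 x) (at x)" using test_fun_deriv[OF \<chi>1(1)] by metis
  obtain b0 where b0: "\<And>t. norm (\<phi> t) \<le> b0" using test_fun_bounded[OF \<phi>] by metis
  obtain b1 where b1: "\<And>t. norm (\<phi>1 t) \<le> b1" using test_fun_bounded[OF \<phi>1(1)] by metis
  obtain b2 where b2: "\<And>t. norm (\<phi>2 t) \<le> b2" using test_fun_bounded[OF \<phi>2(1)] by metis
  obtain c0 where c0: "\<And>t. norm (unit_part t) \<le> c0" using test_fun_bounded[OF test_fun_unit_part] by metis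
  obtain c1 where c1: "\<And>t. norm (\<chi>1 t) \<le> c1" using test_fun_bounded[OF \<chi>1(1)] by metis
  obtain c2 where c2: "\<And>t. norm (\<chi>2 t) \<le> c2" using test_fun_bounded[OF \<chi>2(1)] by metis
  define B where "B = Max {b0, b1, b2, c0, c1, c2, 1}"
  have B: "norm (\<phi> t) \<le> B" "norm (\<phi>1 t) \<le> B" "norm (\<phi>2 t) \<le> B"
     "norm (unit_part t) \<le> B" "norm (\<chi>1 t) \<le> B" "norm (\<chi>2 t) \<le> B" for t
  proof -
    have le: "b0 \<le> B" "b1 \<le> B" "b2 \<le> B" "c0 \<le> B" "c1 \<le> B" "c2 \<le> B" unfolding B_def by (simp_all only: Max_ge finite.intros insert_iff simp_thms)
    show "norm (\<phi> t) \<le> B" "norm (\<phi>1 t) \<le> B" "norm (\<phi>2 t) \<le> B"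
     "norm (unit_part t) \<le> B" "norm (\<chi>1 t) \<le> B" "norm (\<chi>2 t) \<le> B"
      using b0[of t] b1[of t] b2[of t] c0[of t] c1[of t] c2[of t] le by linarith+
  qed
  have B1: "B \<ge> 1" unfolding B_def by (simp_all only: Max_ge finite.intros insert_iff simp_thms)
  \<comment> \<open>28 = 4 + 24: the interval length 2 \<delta> times the suprema 2 \<delta> B^2 of
    \<psi> and 12 B^2 / \<delta> of its second derivative.\<close>
  define C where "C = 28 * B\<^sup>2"
  show ?thesis
  proof (intro exI[of _ C] conjI allI impI)
    show "C \<ge> 0" by (simp add: C_def)
    fix \<delta> t0 y :: real and j :: int
    assume \<delta>: "0 < \<delta>" "\<delta> \<le> 1" and t0: "t0 \<in> {\<delta> * of_int j..\<delta> * (of_int j + 2)}"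
    define p where "p = (\<lambda>t::real. complex_of_real t - of_real t0)"
    define r where "r = (\<lambda>t. unit_part (t / \<delta> - of_int j))"
    define r1 where "r1 = (\<lambda>t. \<chi>1 (t / \<delta> - of_int j) / of_real \<delta>)"
    define r2 where "r2 = (\<lambda>t. \<chi>2 (t / \<delta> - of_int j) / (of_real \<delta>)\<^sup>2)"
    define \<psi> where "\<psi> = (\<lambda>t. p t * (r t * \<phi> t))"
    have \<psi>_eq: "(\<lambda>t. (of_real t - of_real t0) * piece \<phi> \<delta> j t) = \<psi>"
      by (simp add: \<psi>_def p_def r_def piece_def)
    have dp: "(p has_vector_derivative 1) (at t)" for t 
      unfolding p_def by (auto intro!: derivative_eq_intros)
    have chain: "((\<lambda>t. f (t / \<delta> - of_int j)) has_vector_derivative f' (t / \<delta> - of_int j) / of_real \<delta>) (at t)"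
      if "\<And>x. (f has_vector_derivative f' x) (at x)" for f f' :: "real \<Rightarrow> complex" and t
    proof -
      have "((f \<circ> (\<lambda>t. t / \<delta> - of_int j)) has_vector_derivative (1 / \<delta>) *\<^sub>R f' (t / \<delta> - of_int j)) (at t)"
        by (rule vector_diff_chain_at) (auto intro!: derivative_eq_intros that)
      then show ?thesis by (simp add: o_def scaleR_conv_of_real)
    qed
    have dr: "(r has_vector_derivative r1 t) (at t)" for t
      unfolding r_def r1_def by (rule chain[OF \<chi>1(2)])
    have dr1: "(r1 has_vector_derivative r2 t) (at t)" for t
      using has_vector_derivative_divide[OF chain[OF \<chi>2(2), of t], of "of_real \<delta>"] 
      by (simp add: r1_def r2_def power2_eq_square)
    have t\<psi>: "test_fun UNIV \<psi>" 
    proof -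
      have "smooth_fun (\<lambda>t. of_real t + (- of_real t0))"
        by (intro smooth_fun_add smooth_fun_of_real smooth_fun_const)
      then show ?thesis unfolding \<psi>_eq[symmetric] by (intro test_fun_mult test_fun_piece \<phi>) simp
    qed
    obtain \<psi>1 where \<psi>1: "test_fun UNIV \<psi>1" "\<And>x. (\<psi> has_vector_derivative \<psi>1 x) (at x)" using test_fun_deriv[OF t\<psi>] by metis
    obtain \<psi>2 where \<psi>2: "test_fun UNIV \<psi>2" "\<And>x. (\<psi>1 has_vector_derivative \<psi>2 x) (at x)" using test_fun_deriv[OF \<psi>1(1)] by metis
    have e1: "\<psi>1 t = p t * (r t * \<phi>1 t + r1 t * \<phi> t) + r t * \<phi> t" for t
    proof (rule vector_derivative_unique_at[OF \<psi>1(2)])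
      show "(\<psi> has_vector_derivative p t * (r t * \<phi>1 t + r1 t * \<phi> t) + r t * \<phi> t) (at t)"
        unfolding \<psi>_def using has_vector_derivative_mult[OF dp has_vector_derivative_mult[OF dr \<phi>1(2)]] by simp
    qed
    have e2: "\<psi>2 t = p t * (r t * \<phi>2 t + 2 * (r1 t * \<phi>1 t) + r2 t * \<phi> t) + 2 * (r t * \<phi>1 t) + 2 * (r1 t * \<phi> t)" for t
    proof (rule vector_derivative_unique_at[OF \<psi>2(2)])
      have "(\<psi>1 has_vector_derivative p t * ((r t * \<phi>2 t + r1 t * \<phi>1 t) + (r1 t * \<phi>1 t + r2 t * \<phi> t)) + 1 * (r t * \<phi>1 t + r1 t * \<phi> t)
         + (r t * \<phi>1 t + r1 t * \<phi> t)) (at t)"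
        unfolding e1[abs_def]
        by (intro has_vector_derivative_add has_vector_derivative_mult dp dr dr1 \<phi>1(2) \<phi>2(2))
      then show "(\<psi>1 has_vector_derivative p t * (r t * \<phi>2 t + 2 * (r1 t * \<phi>1 t) + r2 t * \<phi> t) + 2 * (r t * \<phi>1 t) + 2 * (r1 t * \<phi> t)) (at t)"
        by (simp add: algebra_simps)
    qed
    let ?a = "\<delta> * of_int j" and ?b = "\<delta> * (of_int j + 2)"
    have ab: "?a \<le> ?b" "?b - ?a = 2 * \<delta>" using \<delta> by (auto simp: algebra_simps)
    have supp: "\<psi> t = 0" if "t \<notin> {?a..?b}" for t
      using piece_eq_0[OF \<delta>(1) that] by (simp add: \<psi>_eq[symmetric])
    have supp2: "\<psi>2 t = 0" if t: "t \<notin> {?a..?b}" for t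
    proof -
      have op: "open (- {?a..?b})" by (simp add: open_Compl)
      have z1: "\<psi>1 s = 0" if "s \<notin> {?a..?b}" for s
      proof -
        have "((\<lambda>_. 0) has_vector_derivative \<psi>1 s) (at s)"
          by (rule has_vector_derivative_transform_within_open[OF \<psi>1(2) op]) (use that supp in auto)
        then show ?thesis using vector_derivative_unique_at has_vector_derivative_const by blast
      qed
      have "((\<lambda>_. 0) has_vector_derivative \<psi>2 t) (at t)"
        by (rule has_vector_derivative_transform_within_open[OF \<psi>2(2) op]) (use t z1 in auto)
      then show ?thesis using vector_derivative_unique_at has_vector_derivative_const by blast
    qed
    have np: "norm (p t) \<le> 2 * \<delta>" if "t \<in> {?a..?b}" for t
    proof -
      have "norm (p t) = \<bar>t - t0\<bar>" unfolding p_def by (simp flip: of_real_diff)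
      then show ?thesis using that t0 by (auto simp: algebra_simps)
    qed
    have nr: "norm (r t) \<le> B" "norm (r1 t) \<le> B / \<delta>" "norm (r2 t) \<le> B / \<delta>\<^sup>2" for t
      using B \<delta> by (auto simp: r_def r1_def r2_def norm_divide norm_power divide_right_mono)
    have B\<delta>: "B * B \<le> B * B / \<delta>" using \<delta> B1 by (simp add: field_simps mult_le_cancel_left1)
    have n0: "norm (\<psi> t) \<le> 2 * \<delta> * B\<^sup>2" if "t \<in> {?a..?b}" for t
    proof -
      have "norm (\<psi> t) \<le> (2 * \<delta>) * (B * B)" unfolding \<psi>_def norm_mult
        by (intro mult_mono np[OF that] nr B) (use B1 \<delta> in auto)
      then show ?thesis by (simp add: power2_eq_square)
    qed
    \<comment> \<open>The three terms of \<open>e2\<close> contribute 8, 2 and 2: the first is |t -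
      t0| <= 2 \<delta> times four terms of size at most B^2 / \<delta>^2.\<close>
    have n2: "norm (\<psi>2 t) \<le> 12 * B\<^sup>2 / \<delta>" if "t \<in> {?a..?b}" for t
    proof -
      have a: "norm (r t * \<phi>2 t) \<le> B * B / \<delta>" "norm (r t * \<phi>1 t) \<le> B * B / \<delta>" 
        unfolding norm_mult by (rule order_trans[OF _ B\<delta>], intro mult_mono nr B; use B1 in simp)+
      have c: "norm (r1 t * \<phi>1 t) \<le> B * B / \<delta>" "norm (r1 t * \<phi> t) \<le> B * B / \<delta>"
        unfolding norm_mult using mult_mono[OF nr(2)[of t] B(2)[of t]] mult_mono[OF nr(2)[of t] B(1)[of t]] B1 \<delta> by simp_all
      have d: "norm (r2 t * \<phi> t) \<le> B * B / \<delta>\<^sup>2"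
        unfolding norm_mult using mult_mono[OF nr(3)[of t] B(1)[of t]] B1 \<delta> by simp
      have le: "B * B / \<delta> \<le> B * B / \<delta>\<^sup>2" using \<delta> B1 by (intro divide_left_mono) (auto simp: power2_eq_square mult_le_cancel_left1)
      have "norm (r t * \<phi>2 t + 2 * (r1 t * \<phi>1 t) + r2 t * \<phi> t) \<le> norm (r t * \<phi>2 t) + 2 * norm (r1 t * \<phi>1 t) + norm (r2 t * \<phi> t)"
        by (intro order_trans[OF norm_triangle_ineq] add_mono order_refl) (simp add: norm_mult)
      also have "\<dots> \<le> 4 * (B * B / \<delta>\<^sup>2)" using a(1) c(1) d le by linarith
      finally have "norm (p t) * norm (r t * \<phi>2 t + 2 * (r1 t * \<phi>1 t) + r2 t * \<phi> t) \<le> (2 * \<delta>) * (4 * (B * B / \<delta>\<^sup>2))"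
        by (intro mult_mono np[OF that]) (use \<delta> in auto)
      also have "\<dots> = 8 * (B * B / \<delta>)" using \<delta> by (simp add: power2_eq_square)
      finally have pp: "norm (p t * (r t * \<phi>2 t + 2 * (r1 t * \<phi>1 t) + r2 t * \<phi> t)) \<le> 8 * (B * B / \<delta>)" by (simp add: norm_mult)
      have "norm (\<psi>2 t) \<le> norm (p t * (r t * \<phi>2 t + 2 * (r1 t * \<phi>1 t) + r2 t * \<phi> t)) + 2 * norm (r t * \<phi>1 t) + 2 * norm (r1 t * \<phi> t)"
        unfolding e2 by (intro order_trans[OF norm_triangle_ineq] add_mono order_refl) (simp_all add: norm_mult)
      then show ?thesis using pp a(2) c(2) by (simp add: power2_eq_square)
    qed
    have int: "integrable lborel f" if "test_fun UNIV f" for f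
      using integrable_test_fun[OF that continuous_on_const[of UNIV 1]] by simp
    have f0: "norm (fourier \<psi> y) \<le> 4 * \<delta>\<^sup>2 * B\<^sup>2"
      using fourier_norm_le[OF t\<psi>, of y] L1_bound[OF int[OF t\<psi>] supp n0 ab(1)] ab(2) by (simp add: power2_eq_square mult_ac)
    have f2: "y\<^sup>2 * norm (fourier \<psi> y) \<le> 24 * B\<^sup>2"
    proof -
      have "fourier \<psi>2 y = \<i> * of_real y * (\<i> * of_real y * fourier \<psi> y)"
        by (simp only: fourier_deriv[OF \<psi>1(1) \<psi>2(1) \<psi>2(2)] fourier_deriv[OF t\<psi> \<psi>1(1) \<psi>1(2)])
      then have "norm (fourier \<psi>2 y) = y\<^sup>2 * norm (fourier \<psi> y)" by (simp add: norm_mult power2_eq_square)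
      moreover have "norm (fourier \<psi>2 y) \<le> 12 * B\<^sup>2 / \<delta> * (2 * \<delta>)"
        using fourier_norm_le[OF \<psi>2(1), of y] L1_bound[OF int[OF \<psi>2(1)] supp2 n2 ab(1)] ab(2) by simp
      ultimately show ?thesis using \<delta> by simp
    qed
    have "(1 + (\<delta> * y)\<^sup>2) * norm (fourier \<psi> y) = norm (fourier \<psi> y) + \<delta>\<^sup>2 * (y\<^sup>2 * norm (fourier \<psi> y))"
      by (simp add: algebra_simps)
    also have "\<dots> \<le> 4 * \<delta>\<^sup>2 * B\<^sup>2 + \<delta>\<^sup>2 * (24 * B\<^sup>2)" by (intro add_mono f0 mult_left_mono f2) auto
    also have "\<dots> = C * \<delta>\<^sup>2" by (simp add: C_def)
    finally have "norm (fourier \<psi> y) \<le> C * \<delta>\<^sup>2 / (1 + (\<delta> * y)\<^sup>2)"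
      by (subst pos_le_divide_eq) (auto simp: mult.commute add_pos_nonneg)
    then show "norm (fourier (\<lambda>t. (of_real t - of_real t0) * piece \<phi> \<delta> j t) y) \<le> C * \<delta>\<^sup>2 / (1 + (\<delta> * y)\<^sup>2)"
      by (simp only: \<psi>_eq)
  qed
qed

definition partial_transform :: "(real \<Rightarrow> complex) \<Rightarrow> real \<Rightarrow> real \<Rightarrow> complex" where
  "partial_transform g u x = (LINT y|lebesgue. indicator {0..x} y *\<^sub>R (g y * exp (- (\<i> * of_real (u * y)))))"

text \<open>Twisting \<open>g\<close> by the frequency t0 makes its primitive a partial transform,
  bounded by M; the opposite twist goes to the kernel, whose derivative then is, up to modulus 1,
  the transform of (t - t0) times the piece. Its L1 norm is at most C \<delta>^2 times the integral
  of 1 / (1 + (\<delta> y)^2), which is O(\<delta>).\<close>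

lemma pairing_piece_bound:
  assumes g: "g \<in> borel_measurable lebesgue" "\<And>x. norm (g x) \<le> B" "\<And>x. x < 0 \<Longrightarrow> g x = 0"
    and \<phi>: "test_fun UNIV \<phi>"
  shows "\<exists>C\<ge>0. \<forall>\<delta> j t0 M h. 0 < \<delta> \<longrightarrow> \<delta> \<le> 1 \<longrightarrow> t0 \<in> {\<delta> * of_int j..\<delta> * (of_int j + 2)} \<longrightarrow>
     (\<forall>x>0. norm (partial_transform g t0 x) \<le> M) \<longrightarrow> norm (pairing g (piece \<phi> \<delta> j) h) \<le> C * M * \<delta>"
proof -
  obtain C where C: "C \<ge> 0" "\<forall>\<delta> j t0 y. 0 < \<delta> \<longrightarrow> \<delta> \<le> 1 \<longrightarrow> t0 \<in> {\<delta> * of_int j..\<delta> * (of_int j + 2)} \<longrightarrow> 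
     norm (fourier (\<lambda>t. (of_real t - of_real t0) * piece \<phi> \<delta> j t) y) \<le> C * \<delta>\<^sup>2 / (1 + (\<delta> * y)\<^sup>2)"
    using fourier_piece_moment_bound[OF \<phi>] by auto
  define I where "I = (LINT y::real|lborel. 1 / (1 + y\<^sup>2))"
  have I0: "I \<ge> 0" unfolding I_def by (intro integral_nonneg_AE) auto
  show ?thesis
  proof (intro exI[of _ "C * I"] conjI allI impI)
    show "C * I \<ge> 0" using C I0 by simp
    fix \<delta> t0 M h :: real and j :: int
    assume \<delta>: "0 < \<delta>" "\<delta> \<le> 1" and t0: "t0 \<in> {\<delta> * of_int j..\<delta> * (of_int j + 2)}"
      and "\<forall>x>0. norm (partial_transform g t0 x) \<le> M"
    then have M: "norm (partial_transform g t0 x) \<le> M" if "x > 0" for x using that by blast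
    have M0: "M \<ge> 0" using M[of 1] norm_ge_zero order_trans zero_less_one by blast
    define f where "f = piece \<phi> \<delta> j"
    define \<psi> where "\<psi> = (\<lambda>t. (of_real t - of_real t0) * f t)"
    have tf: "test_fun UNIV f" unfolding f_def by (rule test_fun_piece[OF \<phi>])
    have t\<psi>: "test_fun UNIV \<psi>"
    proof -
      have "smooth_fun (\<lambda>t. of_real t + (- of_real t0))"
        by (intro smooth_fun_add smooth_fun_of_real smooth_fun_const)
      then show ?thesis unfolding \<psi>_def by (intro test_fun_mult tf) simp
    qed
    have b\<psi>: "norm (fourier \<psi> y) \<le> C * \<delta>\<^sup>2 / (1 + (\<delta> * y)\<^sup>2)" for y
      unfolding \<psi>_def f_def using C(2) \<delta> t0 by blast
    let ?e = "\<lambda>x. exp (\<i> * complex_of_real (x * t0))"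
    define \<Psi> where "\<Psi> = (\<lambda>x. ?e x * fourier f (x - h))"
    define \<Psi>' where "\<Psi>' = (\<lambda>x. - \<i> * ?e x * fourier \<psi> (x - h))"
    have fshift: "fourier (\<lambda>t. - (\<i> * of_real t) * f t) y = - \<i> * fourier \<psi> y - \<i> * of_real t0 * fourier f y" for y
    proof -
      have "fourier (\<lambda>t. - (\<i> * of_real t) * f t) y = 
        (LINT t|lborel. (- \<i>) * (exp (- (\<i> * of_real (t * y))) * \<psi> t) - (\<i> * of_real t0) * (exp (- (\<i> * of_real (t * y))) * f t))"
        unfolding fourier_def \<psi>_def by (intro Bochner_Integration.integral_cong) (auto simp: algebra_simps)
      also have "\<dots> = - \<i> * fourier \<psi> y - \<i> * of_real t0 * fourier f y"
        unfolding fourier_def integral_mult_right_zero[symmetric]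
        by (intro Bochner_Integration.integral_diff integrable_mult_right fourier_integrable[OF t\<psi>] fourier_integrable[OF tf])
      finally show ?thesis .
    qed
    have d\<Psi>: "(\<Psi> has_vector_derivative \<Psi>' x) (at x)" for x
    proof -
      have "((fourier f \<circ> (\<lambda>x. x - h)) has_vector_derivative 1 *\<^sub>R fourier (\<lambda>t. - (\<i> * of_real t) * f t) (x - h)) (at x)"
        by (rule vector_diff_chain_at[OF _ fourier_has_vector_derivative[OF tf]]) (auto intro!: derivative_eq_intros)
      then have d1: "((\<lambda>x. fourier f (x - h)) has_vector_derivative - \<i> * fourier \<psi> (x - h) - \<i> * of_real t0 * fourier f (x - h)) (at x)"
        by (simp only: o_def fshift scaleR_one)
      have d2: "(?e has_vector_derivative \<i> * of_real t0 * ?e x) (at x)"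
        using has_vector_derivative_exp_imaginary[of "-t0" x UNIV] by simp
      show ?thesis unfolding \<Psi>_def \<Psi>'_def
        using has_vector_derivative_mult[OF d2 d1] by (simp add: algebra_simps)
    qed
    have ne: "norm (?e x) = 1" for x by (rule norm_exp_imaginary)
    have cont: "continuous_on UNIV \<Psi>'" unfolding \<Psi>'_def
      by (intro continuous_intros continuous_on_compose2[OF continuous_on_fourier[OF t\<psi>, of UNIV]]) auto
    have n\<Psi>': "norm (\<Psi>' x) = norm (fourier \<psi> (x - h))" for x by (simp add: \<Psi>'_def norm_mult ne)
    have w: "integrable lborel (\<lambda>y. (1 + \<bar>y\<bar>) * norm (\<Psi>' y))"
    proof (rule Bochner_Integration.integrable_bound)
      show "integrable lborel (\<lambda>y. (1 + \<bar>h\<bar>) * ((1 + \<bar>y - h\<bar>) * norm (fourier \<psi> (y - h))))"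
        using lborel_integrable_real_affine[OF fourier_weight_integrable[OF t\<psi>], of 1 "-h"] 
        by (intro integrable_mult_right) simp
      have [measurable]: "fourier \<psi> \<in> borel_measurable borel" by (rule fourier_measurable[OF t\<psi>])
      show "(\<lambda>y. (1 + \<bar>y\<bar>) * norm (\<Psi>' y)) \<in> borel_measurable lborel" unfolding n\<Psi>' by measurable
      show "AE y in lborel. norm ((1 + \<bar>y\<bar>) * norm (\<Psi>' y)) \<le> norm ((1 + \<bar>h\<bar>) * ((1 + \<bar>y - h\<bar>) * norm (fourier \<psi> (y - h))))"
      proof (intro AE_I2)
        fix y
        have "1 + \<bar>y\<bar> \<le> (1 + \<bar>h\<bar>) * (1 + \<bar>y - h\<bar>)" by (rule one_plus_abs_le)
        then show "norm ((1 + \<bar>y\<bar>) * norm (\<Psi>' y)) \<le> norm ((1 + \<bar>h\<bar>) * ((1 + \<bar>y - h\<bar>) * norm (fourier \<psi> (y - h))))"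
          unfolding n\<Psi>' by (simp add: abs_mult mult.assoc[symmetric] mult_right_mono)
      qed
    qed
    have lim: "(\<Psi> \<longlongrightarrow> 0) at_top"
    proof (rule tendsto_norm_zero_cancel)
      have "filterlim (\<lambda>x. - h + x) at_infinity at_top"
        by (rule filterlim_at_top_imp_at_infinity, rule filterlim_tendsto_add_at_top[OF tendsto_const filterlim_ident])
      then have "((\<lambda>x. fourier f (- h + x)) \<longlongrightarrow> 0) at_top"
        by (rule filterlim_compose[OF tendsto_fourier_at_infinity[OF tf]])
      then show "((\<lambda>x. norm (\<Psi> x)) \<longlongrightarrow> 0) at_top" unfolding \<Psi>_def norm_mult ne by (simp add: tendsto_norm_zero)
    qed
    define q where "q = (\<lambda>x. g x * exp (- (\<i> * of_real (t0 * x))))"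
    have "norm (LINT x|lebesgue. q x * \<Psi> x) \<le> M * (LINT y|lborel. norm (\<Psi>' y))"
    proof (rule integration_by_parts_bound[OF _ _ _ _ d\<Psi> cont w lim])
      show "q \<in> borel_measurable lebesgue" unfolding q_def
        by (intro borel_measurable_times g borel_measurable_lebesgueI borel_measurable_continuous_onI continuous_intros)
      show "norm (q x) \<le> B" for x using g(2) by (simp add: q_def norm_mult norm_exp_imaginary)
      show "q x = 0" if "x < 0" for x using g(3)[OF that] by (simp add: q_def)
      show "norm (LINT y|lebesgue. indicator {0..x} y *\<^sub>R q y) \<le> M" if "x > 0" for x
        using M[OF that] by (simp add: partial_transform_def q_def)
    qed
    also have "(LINT x|lebesgue. q x * \<Psi> x) = pairing g f h"
      unfolding pairing_def q_def \<Psi>_def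
    proof (intro Bochner_Integration.integral_cong refl)
      fix x :: real
      have "exp (- (\<i> * of_real (t0 * x))) * ?e x = 1" by (simp add: mult_exp_exp mult.commute)
      then show "g x * exp (- (\<i> * of_real (t0 * x))) * (?e x * fourier f (x - h)) = g x * fourier f (x - h)"
        by (metis (no_types, lifting) mult.assoc mult.left_neutral)
    qed
    also have "M * (LINT y|lborel. norm (\<Psi>' y)) \<le> M * (C * I * \<delta>)"
    proof -
      have "(LINT y|lborel. norm (\<Psi>' y)) = (LINT y|lborel. norm (fourier \<psi> y))"
        unfolding n\<Psi>' by (subst (2) lborel_integral_real_affine[of 1 _ "-h"]) auto
      also have "\<dots> \<le> (LINT y|lborel. C * \<delta>\<^sup>2 * (1 / (1 + (\<delta> * y)\<^sup>2)))"
      proof (rule integral_mono)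
        show "integrable lborel (\<lambda>y. norm (fourier \<psi> y))" by (intro integrable_norm fourier_fun_integrable[OF t\<psi>])
        show "integrable lborel (\<lambda>y. C * \<delta>\<^sup>2 * (1 / (1 + (\<delta> * y)\<^sup>2)))"
          using lborel_integrable_real_affine[OF integrable_inverse_square, of \<delta> 0] \<delta> by (intro integrable_mult_right) simp
      qed (use b\<psi> in simp)
      also have "\<dots> = C * \<delta>\<^sup>2 * (I / \<delta>)"
        unfolding integral_mult_right_zero I_def using \<delta>
        by (subst (2) lborel_integral_real_affine[of \<delta> _ 0]) auto
      also have "\<dots> = C * I * \<delta>" using \<delta> by (simp add: power2_eq_square)
      finally show ?thesis using M0 by (rule mult_left_mono)
    qed
    finally show "norm (pairing g (piece \<phi> \<delta> j) h) \<le> C * I * M * \<delta>"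
      by (simp add: f_def mult_ac)
  qed
qed

text \<open>For fixed x the partial transform is continuous in the frequency, by dominated
  convergence on {0..x}. The sets on which Baire's theorem is used are therefore closed.\<close>

lemma closed_bounded_partial_transform:
  assumes g: "g \<in> borel_measurable lebesgue" "\<And>x. norm (g x) \<le> B" and E: "closed E"
  shows "closed {u\<in>E. \<forall>x>0. norm (partial_transform g u x) \<le> M}"
  unfolding closed_sequential_limits
proof (intro allI impI, elim conjE)
  fix v l assume v: "\<forall>n. v n \<in> {u\<in>E. \<forall>x>0. norm (partial_transform g u x) \<le> M}" and l: "v \<longlonglongrightarrow> l"
  have "l \<in> E" using E v l unfolding closed_sequential_limits by blast
  moreover have "norm (partial_transform g l x) \<le> M" if x: "x > 0" for x
  proof -
    have "(\<lambda>n. partial_transform g (v n) x) \<longlonglongrightarrow> partial_transform g l x"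
      unfolding partial_transform_def
    proof (rule integral_dominated_convergence[where w = "\<lambda>y. B * indicator {0..x} y"])
      have m: "(\<lambda>y. indicator {0..x} y *\<^sub>R (g y * exp (- (\<i> * of_real (u * y))))) \<in> borel_measurable lebesgue" for u
        by (intro borel_measurable_scaleR borel_measurable_indicator borel_measurable_times g 
          borel_measurable_lebesgueI borel_measurable_continuous_onI continuous_intros) auto
      show "(\<lambda>y. indicator {0..x} y *\<^sub>R (g y * exp (- (\<i> * of_real (l * y))))) \<in> borel_measurable lebesgue"
        "\<And>n. (\<lambda>y. indicator {0..x} y *\<^sub>R (g y * exp (- (\<i> * of_real (v n * y))))) \<in> borel_measurable lebesgue" 
        by (rule m)+
      show "integrable lebesgue (\<lambda>y. B * indicator {0..x} y)" by (intro integrable_mult_right integrable_indicator_Icc)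
      show "AE y in lebesgue. (\<lambda>n. indicator {0..x} y *\<^sub>R (g y * exp (- (\<i> * of_real (v n * y)))))
          \<longlonglongrightarrow> indicator {0..x} y *\<^sub>R (g y * exp (- (\<i> * of_real (l * y))))"
        by (intro AE_I2 tendsto_intros l)
      show "AE y in lebesgue. norm (indicator {0..x} y *\<^sub>R (g y * exp (- (\<i> * of_real (v n * y))))) \<le> B * indicator {0..x} y" for n
        using g(2) by (intro AE_I2) (auto simp: indicator_def norm_mult norm_exp_imaginary)
    qed
    then have "(\<lambda>n. norm (partial_transform g (v n) x)) \<longlonglongrightarrow> norm (partial_transform g l x)" by (rule tendsto_norm)
    then show ?thesis by (rule Lim_bounded[where M = 0]) (use v x in auto)
  qed
  ultimately show "l \<in> {u\<in>E. \<forall>x>0. norm (partial_transform g u x) \<le> M}" by blast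
qed

text \<open>Outer regularity puts Q into an open W of measure below e, and by compactness W contains
  a uniform neighbourhood of Q. For small \<delta>, each interval that meets Q thus contributes a
  disjoint set of measure \<delta> inside W, so their number is at most e / \<delta>.\<close>

lemma card_intervals_meeting_null_set:
  assumes Q: "compact Q" "Q \<in> null_sets lborel" and e: "e > 0"
  shows "\<exists>\<delta>>0. \<delta> \<le> 1 \<and> (\<forall>J. finite J \<longrightarrow> (\<forall>j\<in>J. Q \<inter> {\<delta> * of_int j..\<delta> * (of_int j + 2)} \<noteq> {}) \<longrightarrow> real (card J) * \<delta> \<le> e)"
proof -
  have QL: "Q \<in> null_sets lebesgue" by (rule null_sets_completionI[OF Q(2)])
  then have "Q \<in> sets lebesgue" by auto
  then obtain W where W: "open W" "Q \<subseteq> W" "emeasure lebesgue (W - Q) < ennreal e"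
    using sets_lebesgue_outer_open[OF _ e] by metis
  have Wl: "W \<in> sets lborel" using W(1) by simp
  have "emeasure lebesgue W = emeasure lebesgue (W - Q)"
    by (rule emeasure_Diff_null_set[symmetric]) (use QL Wl in auto)
  then have We: "emeasure lborel W < ennreal e" using W(3) Wl by simp
  obtain d where d: "d > 0" "\<And>x. x \<in> Q \<Longrightarrow> \<exists>G\<in>{W}. ball x d \<subseteq> G"
    using Heine_Borel_lemma[OF Q(1), of "{W}"] W(1,2) by auto
  define \<delta> where "\<delta> = min (d / 3) 1"
  have \<delta>: "\<delta> > 0" "\<delta> \<le> 1" "3 * \<delta> \<le> d" using d by (auto simp: \<delta>_def)
  have "real (card J) * \<delta> \<le> e" if J: "finite J" "\<forall>j\<in>J. Q \<inter> {\<delta> * of_int j..\<delta> * (of_int j + 2)} \<noteq> {}" for J :: "int set"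
  proof -
    \<comment> \<open>Neighbouring intervals of length 2 \<delta> overlap; their open left halves do
      not.\<close>
    define F where "F j = {\<delta> * of_int j<..<\<delta> * (of_int j + 1)}" for j :: int
    have disj: "disjoint_family_on F J"
      unfolding disjoint_family_on_def
    proof (intro ballI impI)
      fix i j :: int assume "i \<noteq> j"
      show "F i \<inter> F j = {}"
      proof (rule ccontr)
        assume "F i \<inter> F j \<noteq> {}"
        then obtain x where "x \<in> F i" "x \<in> F j" by blast
        then have "\<delta> * of_int i < \<delta> * (of_int j + 1)" "\<delta> * of_int j < \<delta> * (of_int i + 1)" unfolding F_def by auto
        then have "real_of_int i < of_int j + 1" "real_of_int j < of_int i + 1" using \<delta>(1) mult_less_cancel_left_pos by blast+
        then show False using \<open>i \<noteq> j\<close> by linarith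
      qed
    qed
    have sub: "F j \<subseteq> W" if "j \<in> J" for j
    proof -
      have "Q \<inter> {\<delta> * of_int j..\<delta> * (of_int j + 2)} \<noteq> {}" using J(2) that by simp
      then obtain x where x: "x \<in> Q" "x \<in> {\<delta> * of_int j..\<delta> * (of_int j + 2)}" by (metis disjoint_iff)
      have "F j \<subseteq> ball x d"
      proof
        fix y assume y: "y \<in> F j"
        then have "\<delta> * of_int j < y" "y < \<delta> * of_int j + \<delta>" "\<delta> * of_int j \<le> x" "x \<le> \<delta> * of_int j + \<delta> * 2" 
          using x(2) unfolding F_def by (simp_all add: distrib_left)
        then have "\<bar>x - y\<bar> \<le> 2 * \<delta>" by linarith
        then show "y \<in> ball x d" using \<delta> by (simp add: dist_real_def)
      qed
      then show ?thesis using d(2)[OF x(1)] by blast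
    qed
    have "(\<Sum>j\<in>J. emeasure lborel (F j)) = emeasure lborel (\<Union>j\<in>J. F j)"
      by (rule sum_emeasure[OF _ disj J(1)]) (auto simp: F_def)
    also have "\<dots> \<le> emeasure lborel W" by (rule emeasure_mono) (use sub Wl in auto)
    also have "\<dots> \<le> ennreal e" using We by simp
    also have "(\<Sum>j\<in>J. emeasure lborel (F j)) = (\<Sum>j\<in>J. ennreal \<delta>)"
      unfolding F_def using \<delta>(1) by (intro sum.cong) (auto simp: algebra_simps)
    also have "\<dots> = ennreal (real (card J) * \<delta>)" 
      using \<delta>(1) by (simp add: ennreal_mult ennreal_of_nat_eq_real_of_nat)
    finally show ?thesis using e by (simp add: ennreal_le_iff)
  qed
  then show ?thesis using \<delta> by blast
qed

lemma regular_everywhere: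
  assumes g: "g \<in> borel_measurable lebesgue" "\<And>x. norm (g x) \<le> B" "\<And>x. x < 0 \<Longrightarrow> g x = 0"
    and E: "closed E" "E \<in> null_sets lborel" "regular_on g (- E)"
    and bd: "\<And>u. u \<in> E \<Longrightarrow> \<exists>M. \<forall>x>0. norm (partial_transform g u x) \<le> M"
  shows "regular_on g UNIV"
proof -
  define G where "G = {V. open V \<and> regular_on g V}"
  define P where "P = - \<Union>G"
  have regP: "regular_on g (- P)" unfolding P_def
    using regular_on_Union[OF g(1,2), of G] by (simp add: G_def)
  have closedP: "closed P" unfolding P_def by (auto simp: G_def open_Union)
  have PE: "P \<subseteq> E" using E(1,3) by (auto simp: P_def G_def open_Compl)
  have Pnull: "P \<in> null_sets lborel" by (rule null_sets_subset[OF E(2) _ PE]) (use closedP in auto)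
  define EN where "EN n = {u\<in>E. \<forall>x>0. norm (partial_transform g u x) \<le> real n}" for n
  have closedEN: "closed (EN n)" for n unfolding EN_def by (rule closed_bounded_partial_transform[OF g(1,2) E(1)])
  have cover: "\<exists>n. u \<in> EN n" if u: "u \<in> E" for u
  proof -
    obtain M where M: "\<forall>x>0. norm (partial_transform g u x) \<le> M" using bd[OF u] by blast
    have "M \<le> real (nat \<lceil>M\<rceil>)" by linarith
    then show ?thesis using M u unfolding EN_def by (intro exI[of _ "nat \<lceil>M\<rceil>"]) (force intro: order_trans)
  qed
  have "P = {}"
  proof (rule ccontr)
    assume "P \<noteq> {}"
    \<comment> \<open>Otherwise every P - EN n is open and dense in the closed set P, hence so is
      their intersection; but the sets \<open>EN n\<close> cover P, so that intersection is
      empty.\<close>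
    have "\<exists>n. \<not> P \<subseteq> closure (P - EN n)"
    proof (rule ccontr)
      assume "\<not> (\<exists>n. \<not> P \<subseteq> closure (P - EN n))"
      then have dense: "\<And>n. P \<subseteq> closure (P - EN n)" by blast
      have "P \<subseteq> closure (\<Inter>(range (\<lambda>n. P - EN n)))"
      proof (rule Baire[OF closedP])
        fix T assume "T \<in> range (\<lambda>n. P - EN n)"
        then obtain n where T: "T = P - EN n" by blast
        have "T = P \<inter> - EN n" using T by blast
        moreover have "open (- EN n)" using closedEN by (simp add: open_Compl)
        ultimately show "openin (top_of_set P) T \<and> P \<subseteq> closure T" using dense[of n] T by (auto simp: openin_open)
      qed simp
      moreover have "\<Inter>(range (\<lambda>n. P - EN n)) = {}" using cover PE by blast
      ultimately have "P \<subseteq> closure {}" by (simp only:)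
      then show False using \<open>P \<noteq> {}\<close> by simp
    qed
    then obtain n p where p: "p \<in> P" "p \<notin> closure (P - EN n)" by blast
    \<comment> \<open>A neighbourhood of p inside which all of P satisfies the single bound n.
      Proving \<open>g\<close> regular on it contradicts p being outside the largest open set of
      regularity.\<close>
    define I where "I = - closure (P - EN n)"
    have I: "open I" "p \<in> I" "I \<inter> P \<subseteq> EN n" using p closure_subset[of "P - EN n"] by (auto simp: I_def)
    have "regular_on g I"
      unfolding regular_on_def
    proof (intro allI impI)
      fix \<phi> assume \<phi>: "test_fun I \<phi>"
      have \<phi>U: "test_fun UNIV \<phi>" by (rule test_fun_mono[OF \<phi>]) simp
      obtain C where C: "compact C" "C \<subseteq> I" "\<And>t. t \<notin> C \<Longrightarrow> \<phi> t = 0" using test_fun_support[OF \<phi>] by metis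
      define Q where "Q = C \<inter> P"
      have Q: "compact Q" unfolding Q_def using C(1) closedP by (rule compact_Int_closed)
      have Qnull: "Q \<in> null_sets lborel" by (rule null_sets_subset[OF Pnull]) (use Q in \<open>auto simp: Q_def compact_imp_closed\<close>)
      obtain K where K: "K \<ge> 0" "\<forall>\<delta> j t0 M h. 0 < \<delta> \<longrightarrow> \<delta> \<le> 1 \<longrightarrow> t0 \<in> {\<delta> * of_int j..\<delta> * (of_int j + 2)} \<longrightarrow>
         (\<forall>x>0. norm (partial_transform g t0 x) \<le> M) \<longrightarrow> norm (pairing g (piece \<phi> \<delta> j) h) \<le> K * M * \<delta>"
        using pairing_piece_bound[OF g \<phi>U] by auto
      show "(pairing g \<phi> \<longlongrightarrow> 0) at_top"
      proof (rule tendstoI)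
        fix \<epsilon> :: real assume \<epsilon>: "\<epsilon> > 0"
        \<comment> \<open>Chosen so that the pieces near P contribute at most K n e <= \<epsilon> /
          2; the added 1 keeps the denominator positive when K n = 0.\<close>
        define e where "e = \<epsilon> / (2 * (K * real n + 1))"
        have Kn: "K * real n \<ge> 0" using K(1) by simp
        have e: "e > 0" using \<epsilon> Kn by (simp add: e_def add_nonneg_pos)
        obtain \<delta> where \<delta>: "\<delta> > 0" "\<delta> \<le> 1" and cnt: "\<And>J. finite J \<Longrightarrow> 
            (\<forall>j\<in>J. Q \<inter> {\<delta> * of_int j..\<delta> * (of_int j + 2)} \<noteq> {}) \<Longrightarrow> real (card J) * \<delta> \<le> e"
          using card_intervals_meeting_null_set[OF Q Qnull e] by auto
        obtain J where J: "finite J" "\<phi> = (\<lambda>t. \<Sum>j\<in>J. piece \<phi> \<delta> j t)"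
          using partition_pieces[OF \<phi> \<delta>(1)] by metis
        define J1 where "J1 = {j\<in>J. Q \<inter> {\<delta> * of_int j..\<delta> * (of_int j + 2)} \<noteq> {}}"
        have fin: "finite J1" "J1 \<subseteq> J" using J(1) by (auto simp: J1_def)
        have split: "pairing g \<phi> h = (\<Sum>j\<in>J1. pairing g (piece \<phi> \<delta> j) h) + (\<Sum>j\<in>J - J1. pairing g (piece \<phi> \<delta> j) h)" for h
        proof -
          have "pairing g \<phi> h = (\<Sum>j\<in>J. pairing g (piece \<phi> \<delta> j) h)"
            by (subst J(2)) (rule pairing_sum[OF g(1,2)], rule test_fun_piece[OF \<phi>U])
          then show ?thesis using sum.subset_diff[OF fin(2) J(1)] by (simp add: add.commute)
        qed
        have near: "norm (\<Sum>j\<in>J1. pairing g (piece \<phi> \<delta> j) h) \<le> \<epsilon> / 2" for h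
        proof -
          have "norm (\<Sum>j\<in>J1. pairing g (piece \<phi> \<delta> j) h) \<le> (\<Sum>j\<in>J1. K * real n * \<delta>)"
          proof (rule sum_norm_le)
            fix j assume "j \<in> J1"
            then have "Q \<inter> {\<delta> * of_int j..\<delta> * (of_int j + 2)} \<noteq> {}" by (simp add: J1_def)
            then obtain t0 where t0: "t0 \<in> Q" "t0 \<in> {\<delta> * of_int j..\<delta> * (of_int j + 2)}" by (metis disjoint_iff)
            have "t0 \<in> EN n" using t0(1) C(2) I(3) by (auto simp: Q_def)
            then have "\<forall>x>0. norm (partial_transform g t0 x) \<le> real n" by (simp add: EN_def)
            then show "norm (pairing g (piece \<phi> \<delta> j) h) \<le> K * real n * \<delta>"
              using K(2) \<delta> t0(2) by blast
          qed
          also have "\<dots> = K * real n * (real (card J1) * \<delta>)" by simp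
          also have "\<dots> \<le> K * real n * e" by (intro mult_left_mono cnt fin Kn) (auto simp: J1_def)
          also have "\<dots> \<le> (K * real n + 1) * e" using e by (simp add: algebra_simps)
          also have "\<dots> = \<epsilon> / 2" using Kn by (simp add: e_def field_simps)
          finally show ?thesis .
        qed
        have "(pairing g (piece \<phi> \<delta> j) \<longlongrightarrow> 0) at_top" if "j \<in> J - J1" for j
        proof -
          \<comment> \<open>Within the support of \<phi>, such an interval contains no point of P,
            so the piece is a test function where regularity is already known.\<close>
          have "test_fun (- P) (piece \<phi> \<delta> j)"
            using that by (intro test_fun_pieceI[OF test_fun_smooth[OF \<phi>] C(1,3) \<delta>(1)]) (auto simp: J1_def Q_def)
          then show ?thesis using regP by (simp add: regular_on_def)
        qed
        then have "((\<lambda>h. \<Sum>j\<in>J - J1. pairing g (piece \<phi> \<delta> j) h) \<longlongrightarrow> (\<Sum>j\<in>J - J1. 0)) at_top"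
          by (intro tendsto_sum)
        then have "\<forall>\<^sub>F h in at_top. dist (\<Sum>j\<in>J - J1. pairing g (piece \<phi> \<delta> j) h) (\<Sum>j\<in>J - J1. 0) < \<epsilon> / 2"
          by (rule tendstoD) (use \<epsilon> in simp)
        then show "\<forall>\<^sub>F h in at_top. dist (pairing g \<phi> h) 0 < \<epsilon>"
        proof eventually_elim
          case (elim h)
          have "norm (pairing g \<phi> h) \<le> norm (\<Sum>j\<in>J1. pairing g (piece \<phi> \<delta> j) h) + norm (\<Sum>j\<in>J - J1. pairing g (piece \<phi> \<delta> j) h)"
            unfolding split by (rule norm_triangle_ineq)
          then show ?case using near[of h] elim by simp
        qed
      qed
    qed
    then have "I \<in> G" using I(1) by (simp add: G_def)
    then show False using I(2) p(1) by (auto simp: P_def)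
  qed
  then show ?thesis using regP by simp
qed

subsection \<open>The Tauberian theorem without main terms\<close>

definition slowly_decreasing_at_top :: "(real \<Rightarrow> real) \<Rightarrow> bool" where
  "slowly_decreasing_at_top r \<longleftrightarrow> (\<forall>\<epsilon>>0. \<exists>\<delta>>0. \<exists>X. \<forall>x\<ge>X. \<forall>u\<in>{0..\<delta>}. r (x + u) - r x \<ge> - \<epsilon>)"

lemma slowly_decreasing_at_topE:
  assumes "slowly_decreasing_at_top r" "\<epsilon> > 0"
  obtains \<delta> X where "\<delta> > 0" "X \<ge> 0" "\<And>x u. x \<ge> X \<Longrightarrow> 0 \<le> u \<Longrightarrow> u \<le> \<delta> \<Longrightarrow> r (x + u) - r x \<ge> - \<epsilon>"
proof -
  obtain \<delta> X where "\<delta> > 0" "\<forall>x\<ge>X. \<forall>u\<in>{0..\<delta>}. r (x + u) - r x \<ge> - \<epsilon>"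
    using assms unfolding slowly_decreasing_at_top_def by blast
  then show thesis by (intro that[of \<delta> "max X 0"]) auto
qed

text \<open>Chaining steps of length \<delta>, each losing at most 1, costs about u / \<delta> over
  a distance u.\<close>

lemma slowly_decreasing_linear:
  assumes "slowly_decreasing_at_top r"
  obtains C X where "C \<ge> 0" "X \<ge> 0" "\<And>x u. x \<ge> X \<Longrightarrow> u \<ge> 0 \<Longrightarrow> r (x + u) - r x \<ge> - C * (1 + u)"
proof -
  obtain \<delta> X where \<delta>: "\<delta> > 0" "X \<ge> 0" and s: "\<And>x u. x \<ge> X \<Longrightarrow> 0 \<le> u \<Longrightarrow> u \<le> \<delta> \<Longrightarrow> r (x + u) - r x \<ge> - 1"
    by (rule slowly_decreasing_at_topE[OF assms zero_less_one]) (rule that)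
  have step: "r (x + real n * \<delta>) - r x \<ge> - real n" if "x \<ge> X" for x n
  proof (induction n)
    case (Suc n)
    have "r (x + real n * \<delta> + \<delta>) - r (x + real n * \<delta>) \<ge> - 1" using that \<delta> by (intro s) (auto intro: add_increasing2)
    then show ?case using Suc by (simp add: algebra_simps)
  qed simp
  have "r (x + u) - r x \<ge> - (1 + 1 / \<delta>) * (1 + u)" if x: "x \<ge> X" and u: "u \<ge> 0" for x u
  proof -
    define n where "n = nat \<lfloor>u / \<delta>\<rfloor>"
    have n: "real n \<le> u / \<delta>" "u / \<delta> < real n + 1" using u \<delta> by (auto simp: n_def)
    then have n': "real n * \<delta> \<le> u" "u \<le> real n * \<delta> + \<delta>" using \<delta> by (auto simp: field_simps)
    have "r (x + real n * \<delta> + (u - real n * \<delta>)) - r (x + real n * \<delta>) \<ge> - 1"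
      using n' x \<delta> by (intro s) (auto intro: add_increasing2)
    then have "r (x + u) - r x \<ge> - (real n + 1)" using step[OF x, of n] by simp
    moreover have "real n + 1 \<le> u / \<delta> + 1" using n by simp
    moreover have "u / \<delta> + 1 \<le> (1 + 1 / \<delta>) * (1 + u)" using \<delta> u by (simp add: field_simps)
    ultimately show ?thesis by linarith
  qed
  then show thesis using \<delta> by (intro that[of "1 + 1 / \<delta>" X]) auto
qed

lemma integrable_mult_bounded:
  fixes f g :: "real \<Rightarrow> 'a :: {real_normed_field, banach, second_countable_topology}"
  assumes "integrable M f" "g \<in> borel_measurable M" "\<And>x. norm (g x) \<le> B"
  shows "integrable M (\<lambda>x. f x * g x)"
proof (rule Bochner_Integration.integrable_bound)
  show "integrable M (\<lambda>x. B * norm (f x))" by (intro integrable_mult_right integrable_norm assms)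
  show "(\<lambda>x. f x * g x) \<in> borel_measurable M" using assms by (intro borel_measurable_times) auto
  show "AE x in M. norm (f x * g x) \<le> norm (B * norm (f x))"
  proof (intro AE_I2)
    fix x
    have "norm (f x) * norm (g x) \<le> norm (f x) * B" by (intro mult_left_mono assms) auto
    moreover have "B \<ge> 0" using assms(3)[of x] norm_ge_zero order_trans by blast
    ultimately show "norm (f x * g x) \<le> norm (B * norm (f x))" by (simp add: norm_mult abs_mult mult.commute)
  qed
qed

lemma fourier_bounded:
  assumes "test_fun U \<phi>" obtains C where "\<And>y. norm (fourier \<phi> y) \<le> C"
  using fourier_norm_le[OF assms] by blast

section \<open>Passage to the boundary of the half-plane\<close>

text \<open>Fubini moves the test function from the line Re s = \<sigma> onto x, where it appears as
  its Fourier transform. Boundary behaviour in s thus becomes the limit of damped integrals of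
  \<open>g\<close> against a fast decaying kernel.\<close>

lemma laplace_pairing:
  fixes g :: "real \<Rightarrow> complex"
  assumes int: "integrable lebesgue (\<lambda>x. g x * exp (- of_real (\<sigma> * x)))"
    and meas: "g \<in> borel_measurable lebesgue"
    and F: "\<And>t. F (Complex \<sigma> t) = (LINT x|lebesgue. g x * exp (- Complex \<sigma> t * of_real x))"
    and \<phi>: "test_fun U \<phi>"
  shows "integral UNIV (\<lambda>t. F (Complex \<sigma> t) * \<phi> t) = (LINT x|lebesgue. g x * exp (- of_real (\<sigma> * x)) * fourier \<phi> x)"
proof -
  let ?e = "\<lambda>t x. exp (- (\<i> * complex_of_real (t * x)))"
  define q where "q = (\<lambda>x. g x * exp (- complex_of_real (\<sigma> * x)))"
  define f where "f t x = q x * (?e t x * \<phi> t)" for t x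
  have e: "g x * exp (- Complex \<sigma> t * of_real x) * \<phi> t = f t x" for t x
  proof -
    have "- Complex \<sigma> t * of_real x = - of_real (\<sigma> * x) + - (\<i> * complex_of_real (t * x))"
      by (simp add: complex_eq_iff)
    then have "exp (- Complex \<sigma> t * of_real x) = exp (- of_real (\<sigma> * x)) * ?e t x" by (simp only: exp_add)
    then show ?thesis unfolding f_def q_def by (simp only: mult_ac)
  qed
  have qm [measurable]: "q \<in> borel_measurable lebesgue" unfolding q_def
    by (intro borel_measurable_times meas borel_measurable_lebesgueI borel_measurable_continuous_onI continuous_intros)
  have c\<phi>: "continuous_on UNIV \<phi>" by (rule smooth_fun_continuous) (rule test_fun_smooth[OF \<phi>])
  have [measurable]: "\<phi> \<in> borel_measurable borel" by (intro borel_measurable_continuous_onI c\<phi>)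
  note [measurable] = borel_measurable_snd_lborel_lebesgue
  have fm: "case_prod f \<in> borel_measurable (lborel \<Otimes>\<^sub>M lebesgue)"
    unfolding f_def split_beta by measurable
  have intq: "integrable lebesgue (\<lambda>x. f t x)" for t
  proof -
    have "integrable lebesgue (\<lambda>x. q x * (?e t x * \<phi> t))" unfolding q_def
    proof (rule integrable_mult_bounded[OF int])
      show "(\<lambda>x. ?e t x * \<phi> t) \<in> borel_measurable lebesgue"
        by (intro borel_measurable_lebesgueI borel_measurable_continuous_onI continuous_intros)
      show "norm (?e t x * \<phi> t) \<le> norm (\<phi> t)" for x by (simp add: norm_mult norm_exp_imaginary)
    qed
    then show ?thesis by (simp add: f_def)
  qed
  have nf: "norm (f t x) = norm (\<phi> t) * norm (q x)" for t x
    by (simp add: f_def norm_mult norm_exp_imaginary)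
  have int\<phi>: "integrable lborel \<phi>"
    using integrable_test_fun[OF \<phi> continuous_on_const[of UNIV 1]] by simp
  have fi: "integrable (lborel \<Otimes>\<^sub>M lebesgue) (case_prod f)"
  proof (rule lborel_lebesgue.Fubini_integrable[OF fm])
    show "integrable lborel (\<lambda>t. LINT x|lebesgue. norm (case_prod f (t, x)))"
      unfolding prod.case nf integral_mult_right_zero by (intro integrable_mult_left integrable_norm int\<phi>)
    show "AE t in lborel. integrable lebesgue (\<lambda>x. case_prod f (t, x))"
      unfolding prod.case by (intro AE_I2 intq)
  qed
  have F\<phi>: "F (Complex \<sigma> t) * \<phi> t = (LINT x|lebesgue. f t x)" for t
    unfolding F integral_mult_left_zero[symmetric] e ..
  have "integral UNIV (\<lambda>t. F (Complex \<sigma> t) * \<phi> t) = (LINT t|lborel. LINT x|lebesgue. f t x)"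
    unfolding F\<phi> by (rule integral_lborel) (rule lborel_lebesgue.integrable_fst[OF fi])
  also have "\<dots> = (LINT x|lebesgue. LINT t|lborel. f t x)"
    by (rule lborel_lebesgue.Fubini_integral[OF fi, symmetric])
  also have "\<dots> = (LINT x|lebesgue. q x * fourier \<phi> x)"
    unfolding f_def integral_mult_right_zero fourier_def ..
  finally show ?thesis by (simp add: q_def)
qed

text \<open>The damping parameters 1 / (n + 1), decreasing to 0: along a sequence the monotone and
  dominated convergence theorems apply directly.\<close>

abbreviation abel :: "nat \<Rightarrow> real" where "abel n \<equiv> inverse (real (Suc n))"

lemma filterlim_abel: "filterlim abel (at_right 0) sequentially"
  unfolding filterlim_at using LIMSEQ_inverse_real_of_nat by (auto simp del: of_nat_Suc)

lemma abel_tendsto: "(\<lambda>n. a * exp (- (abel n * x)) * b) \<longlonglongrightarrow> a * (b :: real)"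
proof -
  have "(\<lambda>n. a * exp (- (abel n * x)) * b) \<longlonglongrightarrow> a * exp (- (0 * x)) * b"
    by (intro tendsto_intros LIMSEQ_inverse_real_of_nat)
  then show ?thesis by simp
qed

text \<open>The boundary distribution is used only through its values \<beta> h at the modulated
  test functions: they are the limits of the damped integrals with shifted kernel, and the
  pseudofunction condition is \<beta> h -> 0.\<close>

lemma boundary_limit:
  fixes g :: "real \<Rightarrow> complex"
  assumes int: "\<And>\<sigma>. \<sigma> > 0 \<Longrightarrow> integrable lebesgue (\<lambda>x. g x * exp (- of_real (\<sigma> * x)))"
    and meas: "g \<in> borel_measurable lebesgue"
    and F: "\<And>s. Re s > 0 \<Longrightarrow> F s = (LINT x|lebesgue. g x * exp (- s * of_real x))"
    and bb: "local_pseudofunction_bb F U"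
    and \<phi>: "test_fun U \<phi>"
  shows "\<exists>\<beta>. (\<forall>h. (\<lambda>n. LINT x|lebesgue. g x * exp (- of_real (abel n * x)) * fourier \<phi> (x - h)) \<longlonglongrightarrow> \<beta> h) \<and> (\<beta> \<longlongrightarrow> 0) at_top"
proof -
  obtain f where f: "\<And>\<phi>. test_fun U \<phi> \<Longrightarrow> ((\<lambda>\<sigma>. integral UNIV (\<lambda>t. F (Complex \<sigma> t) * \<phi> t)) \<longlongrightarrow> f \<phi>) (at_right 0)"
     "\<And>\<phi>. test_fun U \<phi> \<Longrightarrow> ((\<lambda>h::real. f (\<lambda>t. exp (\<i> * of_real (h * t)) * \<phi> t)) \<longlongrightarrow> 0) at_infinity"
    using bb unfolding local_pseudofunction_bb_def by blast
  define \<beta> where "\<beta> = (\<lambda>h::real. f (\<lambda>t. exp (\<i> * of_real (h * t)) * \<phi> t))"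
  have "(\<lambda>n. LINT x|lebesgue. g x * exp (- of_real (abel n * x)) * fourier \<phi> (x - h)) \<longlonglongrightarrow> \<beta> h" for h
  proof -
    have t: "test_fun U (\<lambda>t. exp (\<i> * of_real (h * t)) * \<phi> t)"
      using smooth_fun_exp[of "\<i> * of_real h"] by (intro test_fun_mult \<phi>) (simp add: mult.assoc)
    have "(\<lambda>n. integral UNIV (\<lambda>t. F (Complex (abel n) t) * (exp (\<i> * of_real (h * t)) * \<phi> t))) \<longlonglongrightarrow> \<beta> h"
      unfolding \<beta>_def by (rule filterlim_compose[OF f(1)[OF t] filterlim_abel])
    also have "(\<lambda>n. integral UNIV (\<lambda>t. F (Complex (abel n) t) * (exp (\<i> * of_real (h * t)) * \<phi> t))) =
       (\<lambda>n. LINT x|lebesgue. g x * exp (- of_real (abel n * x)) * fourier \<phi> (x - h))"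
    proof (rule ext)
      fix n
      show "integral UNIV (\<lambda>t. F (Complex (abel n) t) * (exp (\<i> * of_real (h * t)) * \<phi> t)) =
        (LINT x|lebesgue. g x * exp (- of_real (abel n * x)) * fourier \<phi> (x - h))"
        using laplace_pairing[OF int[of "abel n"] meas F t] by (simp add: fourier_modulate del: of_nat_Suc of_real_mult)
    qed
    finally show ?thesis .
  qed
  moreover have "(\<beta> \<longlongrightarrow> 0) at_top" unfolding \<beta>_def
    by (rule filterlim_mono[OF f(2)[OF \<phi>] order_refl at_top_le_at_infinity])
  ultimately show ?thesis by blast
qed

text \<open>On {..b} the damping factor is at least exp(-b), so integrability with damping gives
  integrability up to b.\<close>

lemma integrable_local_of_exp:
  fixes g :: "real \<Rightarrow> 'a :: {real_normed_field, banach, second_countable_topology}"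
  assumes int: "integrable lebesgue (\<lambda>x. g x * exp (- of_real x))" and g: "g \<in> borel_measurable lebesgue"
  shows "integrable lebesgue (\<lambda>x. indicator {..b} x *\<^sub>R g x)"
proof (rule Bochner_Integration.integrable_bound)
  show "integrable lebesgue (\<lambda>x. exp b * norm (g x * exp (- of_real x)))" 
    by (intro integrable_mult_right integrable_norm int)
  show "(\<lambda>x. indicator {..b} x *\<^sub>R g x) \<in> borel_measurable lebesgue"
    by (intro borel_measurable_scaleR borel_measurable_indicator g) auto
  show "AE x in lebesgue. norm (indicator {..b} x *\<^sub>R g x) \<le> norm (exp b * norm (g x * exp (- of_real x)))"
  proof (intro AE_I2)
    fix x :: real
    have e: "norm (exp (- of_real x) :: 'a) = exp (- x)" by (metis exp_of_real norm_of_real of_real_minus abs_exp_cancel)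
    show "norm (indicator {..b} x *\<^sub>R g x) \<le> norm (exp b * norm (g x * exp (- of_real x)))"
    proof (cases "x \<le> b")
      case True
      then have "1 \<le> exp (b - x)" by simp
      then have "norm (g x) * 1 \<le> norm (g x) * exp (b - x)" by (intro mult_left_mono) auto
      also have "exp (b - x) = exp b * exp (- x)" by (simp add: mult_exp_exp)
      also have "norm (g x) * (exp b * exp (- x)) = exp b * norm (g x * exp (- of_real x))" by (simp only: norm_mult e mult_ac)
      finally show ?thesis using True by simp
    qed simp
  qed
qed

text \<open>An Abel limit of a nonnegative integrand is an honest integral, by monotone convergence.
  The one-sided linear bound reduces \<open>r\<close> to this case at the price of a remainder that
  the kernel integrates absolutely.\<close>

lemma abel_limit_positive:
  fixes r K :: "real \<Rightarrow> real"
  assumes r: "r \<in> borel_measurable lebesgue" "\<And>x. x < 0 \<Longrightarrow> r x = 0"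
    and int: "\<And>\<sigma>. \<sigma> > 0 \<Longrightarrow> integrable lebesgue (\<lambda>x. r x * exp (- (\<sigma> * x)))"
    and low: "\<And>x. x \<ge> X \<Longrightarrow> r x \<ge> - D * (1 + x)" and X: "X \<ge> 0" and D: "D \<ge> 0"
    and K: "tauberian_kernel K"
    and lim: "(\<lambda>n. LINT x|lebesgue. r x * exp (- (abel n * x)) * K (x - y)) \<longlonglongrightarrow> b"
  shows "integrable lebesgue (\<lambda>x. r x * K (x - y))" "(LINT x|lebesgue. r x * K (x - y)) = b"
proof -
  interpret tauberian_kernel K by (rule K)
  \<comment> \<open>\<open>p\<close> is the tail made nonnegative by D (1 + x); the remainder
    \<open>s\<close> consists of the initial part of \<open>r\<close> and of the linear correction.
    Both vanish for x < 0, where the damping factor would decrease in n instead of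
    increasing.\<close>
  define p where "p x = (if x \<ge> X then r x + D * (1 + x) else 0)" for x
  define s where "s x = r x - p x" for x
  have [measurable]: "r \<in> borel_measurable lebesgue" by (rule r)
  have idm: "(\<lambda>x. x) \<in> borel_measurable (lebesgue :: real measure)" 
    using id_borel_measurable_lebesgue by (simp add: id_def)
  have pm: "p \<in> borel_measurable lebesgue"
  proof -
    have "(\<lambda>x. indicator {X..} x * (r x + D * (1 + x))) \<in> borel_measurable lebesgue"
      by (intro borel_measurable_times borel_measurable_add borel_measurable_indicator r borel_measurable_const idm) auto
    also have "(\<lambda>x. indicator {X..} x * (r x + D * (1 + x))) = p" by (auto simp: p_def indicator_def)
    finally show ?thesis .
  qed
  have sm: "s \<in> borel_measurable lebesgue" unfolding s_def[abs_def] by (intro borel_measurable_diff r pm)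
  have Km: "(\<lambda>x. K (x - y)) \<in> borel_measurable lebesgue" by (intro borel_measurable_lebesgueI) measurable
  have em: "(\<lambda>x. exp (- (\<sigma> * x))) \<in> borel_measurable lebesgue" for \<sigma> :: real
    by (intro borel_measurable_lebesgueI) measurable
  have p0: "p x \<ge> 0" for x 
  proof (cases "x \<ge> X")
    case True
    then show ?thesis using low[of x] unfolding p_def by simp
  qed (simp add: p_def)
  have pneg: "p x = 0" if "x < 0" for x using that X by (simp add: p_def)
  obtain KB where KB: "\<And>u. K u \<le> KB" using K_bounded by blast
  have KB': "norm (K u) \<le> KB" for u using KB[of u] K_nonneg[of u] by simp
  have sK: "integrable lebesgue (\<lambda>x. s x * K (x - y))"
  proof (rule Bochner_Integration.integrable_bound)
    have "integrable lebesgue (\<lambda>x. indicator {..X} x *\<^sub>R r x)"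
      by (rule integrable_local_of_exp[OF _ r(1)]) (use int[of 1] in simp)
    then have "integrable lebesgue (\<lambda>x. indicator {..X} x *\<^sub>R r x * K (x - y))"
      by (rule integrable_mult_bounded[OF _ Km KB'])
    moreover have "integrable lebesgue (\<lambda>x. (D * (1 + \<bar>y\<bar>)) * ((1 + \<bar>x - y\<bar>) * K (x - y)))"
      by (intro integrable_mult_right lebesgue_integrable_shift[OF K_weight])
    ultimately show "integrable lebesgue (\<lambda>x. norm (indicator {..X} x *\<^sub>R r x * K (x - y)) + (D * (1 + \<bar>y\<bar>)) * ((1 + \<bar>x - y\<bar>) * K (x - y)))"
      by (intro Bochner_Integration.integrable_add integrable_norm)
    show "(\<lambda>x. s x * K (x - y)) \<in> borel_measurable lebesgue" by (intro borel_measurable_times sm Km)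
    show "AE x in lebesgue. norm (s x * K (x - y)) \<le> norm (norm (indicator {..X} x *\<^sub>R r x * K (x - y)) + (D * (1 + \<bar>y\<bar>)) * ((1 + \<bar>x - y\<bar>) * K (x - y)))"
    proof (intro AE_I2)
      fix x :: real
      have pos: "0 \<le> (D * (1 + \<bar>y\<bar>)) * ((1 + \<bar>x - y\<bar>) * K (x - y))" using D K_nonneg by simp
      show "norm (s x * K (x - y)) \<le> norm (norm (indicator {..X} x *\<^sub>R r x * K (x - y)) + (D * (1 + \<bar>y\<bar>)) * ((1 + \<bar>x - y\<bar>) * K (x - y)))"
      proof (cases "x \<ge> X")
        case True
        have "1 + x \<le> (1 + \<bar>y\<bar>) * (1 + \<bar>x - y\<bar>)"
          using one_plus_abs_le[of x y] by linarith
        then have "D * (1 + x) * K (x - y) \<le> D * ((1 + \<bar>y\<bar>) * (1 + \<bar>x - y\<bar>)) * K (x - y)"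
          using D K_nonneg by (intro mult_right_mono mult_left_mono) auto
        moreover have "norm (s x * K (x - y)) = D * (1 + x) * K (x - y)"
          using True X D K_nonneg by (simp add: s_def p_def abs_mult)
        ultimately have "norm (s x * K (x - y)) \<le> (D * (1 + \<bar>y\<bar>)) * ((1 + \<bar>x - y\<bar>) * K (x - y))" by (simp add: mult_ac)
        then show ?thesis using pos by (smt (verit) norm_ge_zero real_norm_def)
      next
        case False
        then show ?thesis using pos by (simp add: s_def p_def)
      qed
    qed
  qed
  have s_le: "norm (s x * exp (- (abel n * x)) * K (x - y)) \<le> norm (s x * K (x - y))" for n x
  proof (cases "x < 0")
    case True then show ?thesis by (simp add: s_def r pneg)
  next
    case False
    then have "exp (- (abel n * x)) \<le> 1" by simp
    then have "\<bar>s x * K (x - y)\<bar> * exp (- (abel n * x)) \<le> \<bar>s x * K (x - y)\<bar> * 1" by (intro mult_left_mono) auto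
    then show ?thesis by (simp add: abs_mult mult_ac)
  qed
  have s_lim: "(\<lambda>n. LINT x|lebesgue. s x * exp (- (abel n * x)) * K (x - y)) \<longlonglongrightarrow> (LINT x|lebesgue. s x * K (x - y))"
  proof (rule integral_dominated_convergence[where w = "\<lambda>x. norm (s x * K (x - y))"])
    show "integrable lebesgue (\<lambda>x. norm (s x * K (x - y)))" by (rule integrable_norm[OF sK])
    show "AE x in lebesgue. (\<lambda>n. s x * exp (- (abel n * x)) * K (x - y)) \<longlonglongrightarrow> s x * K (x - y)"
      by (intro AE_I2 abel_tendsto)
    show "AE x in lebesgue. norm (s x * exp (- (abel n * x)) * K (x - y)) \<le> norm (s x * K (x - y))" for n
      by (intro AE_I2) (rule s_le)
  qed (intro borel_measurable_times sm Km em)+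
  have int_r: "integrable lebesgue (\<lambda>x. r x * exp (- (abel n * x)) * K (x - y))" for n
    by (rule integrable_mult_bounded[OF int Km KB']) simp
  have int_s: "integrable lebesgue (\<lambda>x. s x * exp (- (abel n * x)) * K (x - y))" for n
    by (rule Bochner_Integration.integrable_bound[OF sK])
       (intro borel_measurable_times sm Km em AE_I2 s_le)+
  have p_eq: "p x * exp (- (abel n * x)) * K (x - y) = r x * exp (- (abel n * x)) * K (x - y) - s x * exp (- (abel n * x)) * K (x - y)" for x n
    by (simp add: s_def algebra_simps)
  have int_p: "integrable lebesgue (\<lambda>x. p x * exp (- (abel n * x)) * K (x - y))" for n
    unfolding p_eq by (intro Bochner_Integration.integrable_diff int_r int_s)
  have p_lim: "(\<lambda>n. LINT x|lebesgue. p x * exp (- (abel n * x)) * K (x - y)) \<longlonglongrightarrow> b - (LINT x|lebesgue. s x * K (x - y))"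
    unfolding p_eq Bochner_Integration.integral_diff[OF int_r int_s] by (intro tendsto_diff lim s_lim)
  have mono: "AE x in lebesgue. mono (\<lambda>n. p x * exp (- (abel n * x)) * K (x - y))"
  proof (intro AE_I2 monoI)
    fix x :: real and m n :: nat assume "m \<le> n"
    show "p x * exp (- (abel m * x)) * K (x - y) \<le> p x * exp (- (abel n * x)) * K (x - y)"
    proof (cases "x < 0")
      case False
      have "abel n \<le> abel m" using \<open>m \<le> n\<close> by (intro le_imp_inverse_le) auto
      then have "abel n * x \<le> abel m * x" using False by (intro mult_right_mono) auto
      then show ?thesis by (intro mult_right_mono mult_left_mono p0 K_nonneg) auto
    qed (simp add: pneg)
  qed
  have conv: "AE x in lebesgue. (\<lambda>n. p x * exp (- (abel n * x)) * K (x - y)) \<longlonglongrightarrow> p x * K (x - y)"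
    by (intro AE_I2 abel_tendsto)
  have pK: "integrable lebesgue (\<lambda>x. p x * K (x - y))"
    by (rule integrable_monotone_convergence[OF int_p mono conv p_lim]) (intro borel_measurable_times pm Km)
  have pKv: "(LINT x|lebesgue. p x * K (x - y)) = b - (LINT x|lebesgue. s x * K (x - y))"
    by (rule integral_monotone_convergence[OF int_p mono conv p_lim]) (intro borel_measurable_times pm Km)
  have rps: "r x * K (x - y) = p x * K (x - y) + s x * K (x - y)" for x by (simp add: s_def algebra_simps)
  show "integrable lebesgue (\<lambda>x. r x * K (x - y))" unfolding rps by (intro Bochner_Integration.integrable_add pK sK)
  show "(LINT x|lebesgue. r x * K (x - y)) = b" unfolding rps Bochner_Integration.integral_add[OF pK sK] pKv by simp
qed

lemma bounded_of_boundary_limit: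
  fixes r :: "real \<Rightarrow> real"
  assumes r: "r \<in> borel_measurable lebesgue" "\<And>x. x < 0 \<Longrightarrow> r x = 0"
    and int: "\<And>\<sigma>. \<sigma> > 0 \<Longrightarrow> integrable lebesgue (\<lambda>x. r x * exp (- (\<sigma> * x)))"
    and slow: "slowly_decreasing_at_top r" and l: "l > 0"
    and lim: "\<And>y. (\<lambda>n. LINT x|lebesgue. r x * exp (- (abel n * x)) * pos_kernel (l * (x - y))) \<longlonglongrightarrow> b y"
    and b: "(b \<longlongrightarrow> 0) at_top"
  shows "\<exists>M X. \<forall>x\<ge>X. \<bar>r x\<bar> \<le> M"
proof -
  obtain C X where C: "C \<ge> 0" "X \<ge> 0" "\<And>x u. x \<ge> X \<Longrightarrow> u \<ge> 0 \<Longrightarrow> r (x + u) - r x \<ge> - C * (1 + u)"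
    using slowly_decreasing_linear[OF slow] by metis
  define D where "D = C + \<bar>r X\<bar>"
  have low: "r x \<ge> - D * (1 + x)" if "x \<ge> X" for x
  proof -
    have "r x \<ge> r X - C * (1 + (x - X))" using C(3)[of X "x - X"] that by simp
    moreover have "C * (1 + (x - X)) \<le> C * (1 + x)" using C by (intro mult_left_mono) auto
    moreover have "\<bar>r X\<bar> * 1 \<le> \<bar>r X\<bar> * (1 + x)" using that C by (intro mult_left_mono) auto
    ultimately show ?thesis by (simp add: D_def algebra_simps)
  qed
  have D: "D \<ge> 0" using C by (simp add: D_def)
  note K = pos_kernel_tauberian[OF l]
  interpret tauberian_kernel "\<lambda>u. pos_kernel (l * u)" by (rule K)
  note ab = abel_limit_positive[OF r int low C(2) D K lim]
  have "\<forall>\<^sub>F y in at_top. dist (b y) 0 < 1" by (rule tendstoD[OF b]) simp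
  then obtain Y where Y: "\<And>y. y \<ge> Y \<Longrightarrow> \<bar>b y\<bar> < 1" by (auto simp: eventually_at_top_linorder)
  have "\<exists>M. \<forall>x\<ge>X. \<bar>r x\<bar> \<le> M"
  proof (rule bounded_of_kernel_bounded[OF _ C(3,2,1) ab(1)])
    show "integrable lebesgue (\<lambda>x. indicator {..b} x * r x)" for b
      using integrable_local_of_exp[OF _ r(1), of b] int[of 1] by simp
    show "\<bar>LINT x|lebesgue. r x * pos_kernel (l * (x - y))\<bar> \<le> 1" if "y \<ge> Y" for y
      using Y[OF that] ab(2)[of y] by simp
  qed
  then show ?thesis by blast
qed

text \<open>The integral over any interval of length \<delta> is at most 2 M in modulus. Slow
  decrease keeps \<open>r\<close> above r x - 1 on such an interval to the right of x and below r x
  + 1 on one to the left, so both intervals bound r x. This serves the case 0 in E, where the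
  frequency is 0.\<close>

lemma bounded_of_partial_integrals:
  fixes r :: "real \<Rightarrow> real"
  assumes loc: "\<And>b. integrable lebesgue (\<lambda>x. indicator {..b} x * r x)"
    and slow: "slowly_decreasing_at_top r"
    and bd: "\<And>x. x > 0 \<Longrightarrow> \<bar>LINT y|lebesgue. indicator {0..x} y * r y\<bar> \<le> M"
  shows "\<exists>M X. \<forall>x\<ge>X. \<bar>r x\<bar> \<le> M"
proof -
  obtain \<delta> X where \<delta>: "\<delta> > 0" "X \<ge> 0" and s: "\<And>x u. x \<ge> X \<Longrightarrow> 0 \<le> u \<Longrightarrow> u \<le> \<delta> \<Longrightarrow> r (x + u) - r x \<ge> - 1"
    by (rule slowly_decreasing_at_topE[OF slow zero_less_one]) (rule that)
  have intI: "integrable lebesgue (\<lambda>x. indicator {a<..b} x * r x)" for a b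
    using integrable_mult_indicator[OF _ loc[of b], of "{a<..b}"]
    by (rule Bochner_Integration.integrable_cong[THEN iffD1, rotated 2]) (auto simp: indicator_def)
  have intI0: "integrable lebesgue (\<lambda>x. indicator {a..b} x * r x)" for a b
    using integrable_mult_indicator[OF _ loc[of b], of "{a..b}"]
    by (rule Bochner_Integration.integrable_cong[THEN iffD1, rotated 2]) (auto simp: indicator_def)
  have diff: "\<bar>LINT y|lebesgue. indicator {a<..b} y * r y\<bar> \<le> 2 * M" if "0 < a" "a \<le> b" for a b
  proof -
    have "(LINT y|lebesgue. indicator {a<..b} y * r y) = (LINT y|lebesgue. indicator {0..b} y * r y - indicator {0..a} y * r y)"
      by (intro Bochner_Integration.integral_cong) (use that in \<open>auto simp: indicator_def\<close>)
    also have "\<dots> = (LINT y|lebesgue. indicator {0..b} y * r y) - (LINT y|lebesgue. indicator {0..a} y * r y)"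
      by (rule Bochner_Integration.integral_diff[OF intI0 intI0])
    finally show ?thesis using bd[of a] bd[of b] that by linarith
  qed
  have intc: "integrable lebesgue (\<lambda>x. c * indicator {a<..b} x)" for a b c :: real
    by (intro integrable_mult_right integrable_real_indicator; cases "a \<le> b") auto
  have valc: "(LINT x|lebesgue. c * indicator {a<..b} x) = c * (b - a)" if "a \<le> b" for a b c :: real
    using that by simp
  \<comment> \<open>The margin \<delta> + 1 keeps the left endpoint x - \<delta> beyond X and
    strictly positive, as \<open>diff\<close> requires.\<close>
  have "\<bar>r x\<bar> \<le> 1 + 2 * M / \<delta>" if x: "x \<ge> X + \<delta> + 1" for x
  proof -
    have "(r x - 1) * \<delta> = (LINT y|lebesgue. (r x - 1) * indicator {x<..x + \<delta>} y)" using \<delta> by (subst valc) auto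
    also have "\<dots> \<le> (LINT y|lebesgue. indicator {x<..x + \<delta>} y * r y)"
    proof (intro integral_mono intI intc)
      fix y show "(r x - 1) * indicator {x<..x + \<delta>} y \<le> indicator {x<..x + \<delta>} y * r y"
        using s[of x "y - x"] x \<delta> by (auto simp: indicator_def)
    qed
    also have "\<dots> \<le> 2 * M" using diff[of x "x + \<delta>"] x \<delta> by simp
    finally have 1: "r x - 1 \<le> 2 * M / \<delta>" using \<delta> by (simp add: pos_le_divide_eq)
    have "- (2 * M) \<le> (LINT y|lebesgue. indicator {x - \<delta><..x} y * r y)" using diff[of "x - \<delta>" x] x \<delta> by simp
    also have "\<dots> \<le> (LINT y|lebesgue. (r x + 1) * indicator {x - \<delta><..x} y)"
    proof (intro integral_mono intI intc)
      fix y show "indicator {x - \<delta><..x} y * r y \<le> (r x + 1) * indicator {x - \<delta><..x} y"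
        using s[of y "x - y"] x \<delta> by (auto simp: indicator_def)
    qed
    also have "\<dots> = (r x + 1) * \<delta>" using \<delta> by (subst valc) auto
    finally have 2: "- (2 * M / \<delta>) \<le> r x + 1" using \<delta> by (simp add: field_simps)
    show ?thesis using 1 2 by linarith
  qed
  then show ?thesis by blast
qed

lemma borel_measurable_ReIm:
  fixes g :: "'a \<Rightarrow> complex"
  assumes "g \<in> borel_measurable M"
  shows "(\<lambda>x. Re (g x)) \<in> borel_measurable M" "(\<lambda>x. Im (g x)) \<in> borel_measurable M"
  using measurable_compose[OF assms, of Re borel] measurable_compose[OF assms, of Im borel]
  by (auto intro: borel_measurable_continuous_onI continuous_intros)

lemma test_fun_pos_kernel_scaled:
  assumes "l > 0" "{-l..l} \<subseteq> U" shows "test_fun U (\<lambda>t. pos_kernel_fun (t / l))"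
  by (rule test_fun_scale[OF smooth_fun_pos_kernel_fun pos_kernel_fun_eq_0 assms])

lemma fourier_pos_kernel_scaled:
  "l > 0 \<Longrightarrow> fourier (\<lambda>t. pos_kernel_fun (t / l)) y = of_real (l * pos_kernel (l * y))"
  by (simp add: fourier_scale fourier_pos_kernel_fun pos_kernel_def)

text \<open>The damping factor and the positive kernel are real, so \<open>p\<close> commutes with
  both, and limits for the complex \<open>g\<close> descend to its real and imaginary parts, the
  functions that are slowly decreasing.\<close>

lemma bounded_at_top_of_boundary:
  fixes g :: "real \<Rightarrow> complex"
  assumes meas: "g \<in> borel_measurable lebesgue" and g0: "\<And>x. x < 0 \<Longrightarrow> g x = 0"
    and int: "\<And>\<sigma>. \<sigma> > 0 \<Longrightarrow> integrable lebesgue (\<lambda>x. g x * exp (- of_real (\<sigma> * x)))"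
    and F: "\<And>s. Re s > 0 \<Longrightarrow> F s = (LINT x|lebesgue. g x * exp (- s * of_real x))"
    and bb: "local_pseudofunction_bb F (- E)" and E: "closed E"
    and bd: "\<And>u. u \<in> E \<Longrightarrow> \<exists>M. \<forall>x>0. norm (partial_transform g u x) \<le> M"
    and p: "p = Re \<or> p = Im"
    and slow: "slowly_decreasing_at_top (\<lambda>x. p (g x))"
  shows "\<exists>M X. \<forall>x\<ge>X. \<bar>p (g x)\<bar> \<le> M"
proof -
  have p_mult: "p (z * of_real c) = p z * c" for z c using p by auto
  have p_mult_exp: "p (z * exp (- of_real c)) = p z * exp (- c)" for z c
    using p_mult[of z "exp (- c)"] by (simp add: exp_of_real[symmetric])
  have p_norm: "\<bar>p z\<bar> \<le> norm z" for z using p abs_Re_le_cmod abs_Im_le_cmod by auto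
  have p_int: "integrable lebesgue (\<lambda>x. p (f x))" "(LINT x|lebesgue. p (f x)) = p (LINT x|lebesgue. f x)" 
    if "integrable lebesgue f" for f :: "real \<Rightarrow> complex" 
    using p that by auto
  have p_tendsto: "(f \<longlongrightarrow> b) A \<Longrightarrow> ((\<lambda>x. p (f x)) \<longlongrightarrow> p b) A" for f :: "'x \<Rightarrow> complex" and b A
    using p by (auto intro: tendsto_intros)
  have pm: "(\<lambda>x. p (g x)) \<in> borel_measurable lebesgue" using p borel_measurable_ReIm[OF meas] by auto
  have p0: "p (g x) = 0" if "x < 0" for x using p g0[OF that] by auto
  have pint: "integrable lebesgue (\<lambda>x. p (g x) * exp (- (\<sigma> * x)))" if "\<sigma> > 0" for \<sigma>
    using p_int(1)[OF int[OF that]] by (simp only: p_mult_exp)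
  show ?thesis
  proof (cases "0 \<in> E")
    case True
    obtain M where M: "\<forall>x>0. norm (partial_transform g 0 x) \<le> M" using bd[OF True] by blast
    have loc: "integrable lebesgue (\<lambda>x. indicator {..b} x *\<^sub>R g x)" for b
      by (rule integrable_local_of_exp[OF _ meas]) (use int[of 1] in simp)
    have loc': "integrable lebesgue (\<lambda>x. indicator {0..b} x *\<^sub>R g x)" for b
      using integrable_mult_indicator[OF _ loc[of b], of "{0..}"]
      by (rule Bochner_Integration.integrable_cong[THEN iffD1, rotated 2]) (auto simp: indicator_def)
    have p_ind: "p (indicator S x *\<^sub>R z) = indicator S x * p z" for S and x :: real and z using p by auto
    show ?thesis
    proof (rule bounded_of_partial_integrals[OF _ slow])
      show "integrable lebesgue (\<lambda>x. indicator {..b} x * p (g x))" for b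
        using p_int(1)[OF loc[of b]] by (simp add: p_ind)
      show "\<bar>LINT y|lebesgue. indicator {0..x} y * p (g y)\<bar> \<le> M" if "x > 0" for x
      proof -
        have "(LINT y|lebesgue. indicator {0..x} y * p (g y)) = p (partial_transform g 0 x)"
          unfolding partial_transform_def using p_int(2)[OF loc'[of x]] by (simp add: p_ind)
        then show ?thesis using p_norm[of "partial_transform g 0 x"] M that by (smt (verit))
      qed
    qed
  next
    case False
    have "open (- E)" using E by (simp add: open_Compl)
    then obtain e where e: "e > 0" "cball 0 e \<subseteq> - E" using False open_contains_cball by (metis ComplI)
    \<comment> \<open>\<open>pos_kernel_fun\<close> vanishes outside {-1..1}, so its dilation by
      \<open>l\<close> is supported in a neighbourhood of 0 that avoids E.\<close>
    define l where "l = e"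
    have l: "l > 0" "{-l..l} \<subseteq> - E" using e by (auto simp: l_def subset_eq dist_real_def)
    let ?\<phi> = "\<lambda>t. pos_kernel_fun (t / l)"
    have \<phi>: "test_fun (- E) ?\<phi>" by (rule test_fun_pos_kernel_scaled[OF l])
    obtain \<beta> where \<beta>: "\<And>h. (\<lambda>n. LINT x|lebesgue. g x * exp (- of_real (abel n * x)) * fourier ?\<phi> (x - h)) \<longlonglongrightarrow> \<beta> h"
      "(\<beta> \<longlongrightarrow> 0) at_top" using boundary_limit[OF int meas F bb \<phi>] by blast
    obtain C where C: "\<And>y. norm (fourier ?\<phi> y) \<le> C" using fourier_bounded[OF \<phi>] by metis
    have lim: "(\<lambda>n. LINT x|lebesgue. p (g x) * exp (- (abel n * x)) * pos_kernel (l * (x - y))) \<longlonglongrightarrow> p (\<beta> y) / l" for y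
    proof -
      have "(LINT x|lebesgue. p (g x) * exp (- (abel n * x)) * pos_kernel (l * (x - y))) = 
         p (LINT x|lebesgue. g x * exp (- of_real (abel n * x)) * fourier ?\<phi> (x - y)) / l" for n
      proof -
        have m: "(\<lambda>x. fourier ?\<phi> (x - y)) \<in> borel_measurable lebesgue"
          using lebesgue_integrable_shift[OF fourier_fun_integrable[OF \<phi>]] by auto
        have "integrable lebesgue (\<lambda>x. g x * exp (- of_real (abel n * x)) * fourier ?\<phi> (x - y))"
          by (rule integrable_mult_bounded[OF int m C]) simp
        from p_int(2)[OF this] 
        have "p (LINT x|lebesgue. g x * exp (- of_real (abel n * x)) * fourier ?\<phi> (x - y)) =
          (LINT x|lebesgue. p (g x) * exp (- (abel n * x)) * (l * pos_kernel (l * (x - y))))"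
          by (simp only: fourier_pos_kernel_scaled[OF l(1)] p_mult p_mult_exp)
        also have "\<dots> = (LINT x|lebesgue. l * (p (g x) * exp (- (abel n * x)) * pos_kernel (l * (x - y))))"
          by (simp only: mult_ac)
        also have "\<dots> = l * (LINT x|lebesgue. p (g x) * exp (- (abel n * x)) * pos_kernel (l * (x - y)))"
          by (rule integral_mult_right_zero)
        finally show ?thesis using l(1) by simp
      qed
      then show ?thesis using l(1) by (simp only:) (intro tendsto_divide p_tendsto \<beta>(1) tendsto_const, simp)
    qed
    have "((\<lambda>y. p (\<beta> y) / l) \<longlongrightarrow> p 0 / l) at_top" by (intro tendsto_divide p_tendsto \<beta>(2) tendsto_const) (use l in simp)
    moreover have "p 0 = 0" using p by auto
    ultimately have "((\<lambda>y. p (\<beta> y) / l) \<longlongrightarrow> 0) at_top" by simp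
    with pm p0 pint slow l(1) lim show ?thesis
      by (intro bounded_of_boundary_limit[where r = "\<lambda>x. p (g x)" and b = "\<lambda>y. p (\<beta> y) / l" and l = l])
  qed
qed

text \<open>The kernel moves away from the mass of \<open>f\<close>, so dominated convergence
  applies. This discards the initial segment of \<open>g\<close>, which is integrable but possibly
  unbounded.\<close>

lemma tendsto_pairing_compact_part:
  assumes "integrable lebesgue f" "test_fun U \<phi>"
  shows "((\<lambda>h. LINT x|lebesgue. f x * fourier \<phi> (x - h)) \<longlongrightarrow> 0) at_top"
proof -
  obtain C where C: "\<And>y. norm (fourier \<phi> y) \<le> C" using fourier_bounded[OF assms(2)] by metis
  have m: "(\<lambda>x. fourier \<phi> (x - y)) \<in> borel_measurable lebesgue" for y
    using lebesgue_integrable_shift[OF fourier_fun_integrable[OF assms(2)]] by auto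
  have "((\<lambda>h. LINT x|lebesgue. f x * fourier \<phi> (x - h)) \<longlongrightarrow> (LINT (x::real)|lebesgue. (0::complex))) at_top"
  proof (rule integral_dominated_convergence_at_top[where w = "\<lambda>x. C * norm (f x)"])
    show "integrable lebesgue (\<lambda>x. C * norm (f x))" by (intro integrable_mult_right integrable_norm assms)
    show "AE x in lebesgue. ((\<lambda>h. f x * fourier \<phi> (x - h)) \<longlongrightarrow> 0) at_top"
    proof (intro AE_I2)
      fix x :: real
      have "filterlim (\<lambda>h. x - h) at_bot at_top"
        using filterlim_tendsto_add_at_top[OF tendsto_const[of "-x"] filterlim_ident]
        by (simp add: filterlim_uminus_at_top)
      then have "filterlim (\<lambda>h. x - h) at_infinity at_top" by (rule filterlim_mono[OF _ at_bot_le_at_infinity order_refl])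
      then have "((\<lambda>h. fourier \<phi> (x - h)) \<longlongrightarrow> 0) at_top"
        by (rule filterlim_compose[OF tendsto_fourier_at_infinity[OF assms(2)]])
      from tendsto_mult[OF tendsto_const this, of "f x"] show "((\<lambda>h. f x * fourier \<phi> (x - h)) \<longlongrightarrow> 0) at_top" by simp
    qed
    show "\<forall>\<^sub>F h in at_top. AE x in lebesgue. norm (f x * fourier \<phi> (x - h)) \<le> C * norm (f x)"
      by (intro always_eventually allI AE_I2) (use C in \<open>simp add: norm_mult mult.commute[of C] mult_left_mono\<close>)
    show "(\<lambda>x. f x * fourier \<phi> (x - h)) \<in> borel_measurable lebesgue" for h
      using assms(1) by (intro borel_measurable_times m) auto
  qed auto
  then show ?thesis by simp
qed

text \<open>Boundedness holds only from some X on, whereas localisation wants a bounded function.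
  Hence \<open>g\<close> is split at X: the initial part \<open>g1\<close> is integrable and
  negligible in every limit, and the argument runs for the bounded part \<open>g2\<close>.\<close>

lemma tauberian_singular_set:
  fixes g :: "real \<Rightarrow> complex"
  assumes meas: "g \<in> borel_measurable lebesgue" and g0: "\<And>x. x < 0 \<Longrightarrow> g x = 0"
    and int: "\<And>\<sigma>. \<sigma> > 0 \<Longrightarrow> integrable lebesgue (\<lambda>x. g x * exp (- of_real (\<sigma> * x)))"
    and F: "\<And>s. Re s > 0 \<Longrightarrow> F s = (LINT x|lebesgue. g x * exp (- s * of_real x))"
    and bb: "local_pseudofunction_bb F (- E)" and E: "closed E" "E \<in> null_sets lborel"
    and bd: "\<And>u. u \<in> E \<Longrightarrow> \<exists>M. \<forall>x>0. norm (partial_transform g u x) \<le> M"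
    and slow: "slowly_decreasing_at_top (\<lambda>x. Re (g x))" "slowly_decreasing_at_top (\<lambda>x. Im (g x))"
  shows "(g \<longlongrightarrow> 0) at_top"
proof -
  note bdd = bounded_at_top_of_boundary[OF meas g0 int F bb E(1) bd]
  obtain M1 X1 where 1: "\<And>x. x \<ge> X1 \<Longrightarrow> \<bar>Re (g x)\<bar> \<le> M1" using bdd[of Re] slow(1) by blast
  obtain M2 X2 where 2: "\<And>x. x \<ge> X2 \<Longrightarrow> \<bar>Im (g x)\<bar> \<le> M2" using bdd[of Im] slow(2) by blast
  define X where "X = max 0 (max X1 X2)"
  define B where "B = max 0 (M1 + M2)"
  have gB: "norm (g x) \<le> B" if "x \<ge> X" for x
    using 1[of x] 2[of x] that cmod_le[of "g x"] by (simp add: X_def B_def)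
  define g1 where "g1 x = indicator {..<X} x *\<^sub>R g x" for x
  define g2 where "g2 x = indicator {X..} x *\<^sub>R g x" for x
  have g12: "g x = g1 x + g2 x" for x by (simp add: g1_def g2_def indicator_def)
  have m1: "g1 \<in> borel_measurable lebesgue" and m2: "g2 \<in> borel_measurable lebesgue"
    unfolding g1_def[abs_def] g2_def[abs_def] 
    by (intro borel_measurable_scaleR borel_measurable_indicator meas; simp)+
  have g2B: "norm (g2 x) \<le> B" for x using gB[of x] by (auto simp: g2_def indicator_def B_def)
  have g20: "g2 x = 0" if "x < 0" for x using g0[OF that] by (simp add: g2_def)
  have "integrable lebesgue (\<lambda>x. indicator {..X} x *\<^sub>R g x)"
    by (rule integrable_local_of_exp[OF _ meas]) (use int[of 1] in simp)
  from integrable_mult_indicator[OF _ this, of "{..<X}"] have g1i: "integrable lebesgue g1"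
    by (rule Bochner_Integration.integrable_cong[THEN iffD1, rotated 2]) (auto simp: g1_def indicator_def)
  have em: "(\<lambda>x. exp (- of_real (c * x)) :: complex) \<in> borel_measurable lebesgue" for c :: real
    by (intro borel_measurable_lebesgueI borel_measurable_continuous_onI continuous_intros)
  have en: "norm (exp (- of_real (abel n * x)) :: complex) \<le> 1" if "x \<ge> 0" for n x
    using that by (simp add: norm_exp_eq_Re)
  have reg: "regular_on g2 (- E)"
    unfolding regular_on_def
  proof (intro allI impI)
    fix \<phi> assume \<phi>: "test_fun (- E) \<phi>"
    obtain \<beta> where \<beta>: "\<And>h. (\<lambda>n. LINT x|lebesgue. g x * exp (- of_real (abel n * x)) * fourier \<phi> (x - h)) \<longlonglongrightarrow> \<beta> h"
      "(\<beta> \<longlongrightarrow> 0) at_top" using boundary_limit[OF int meas F bb \<phi>] by blast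
    have m: "(\<lambda>x. fourier \<phi> (x - h)) \<in> borel_measurable lebesgue" for h
      using lebesgue_integrable_shift[OF fourier_fun_integrable[OF \<phi>]] by auto
    obtain C where C: "\<And>y. norm (fourier \<phi> y) \<le> C" using fourier_bounded[OF \<phi>] by metis
    have i1: "integrable lebesgue (\<lambda>x. g1 x * fourier \<phi> (x - h))" for h
      by (rule integrable_mult_bounded[OF g1i m C])
    have i2: "integrable lebesgue (\<lambda>x. g2 x * fourier \<phi> (x - h))" for h
      by (rule pairing_integrable[OF m2 g2B \<phi>])
    have sum: "g x * fourier \<phi> (x - h) = g1 x * fourier \<phi> (x - h) + g2 x * fourier \<phi> (x - h)" for x h
      unfolding g12[of x] by (simp add: distrib_right)
    have i: "integrable lebesgue (\<lambda>x. g x * fourier \<phi> (x - h))" for h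
      unfolding sum by (intro Bochner_Integration.integrable_add i1 i2)
    \<comment> \<open>Now that \<open>g\<close> times the kernel is known to be integrable, the
      damping can be removed under the integral; this identifies \<beta> h with the undamped
      pairing.\<close>
    have "(\<lambda>n. LINT x|lebesgue. g x * exp (- of_real (abel n * x)) * fourier \<phi> (x - h)) \<longlonglongrightarrow> (LINT x|lebesgue. g x * fourier \<phi> (x - h))" for h
    proof (rule integral_dominated_convergence[where w = "\<lambda>x. norm (g x * fourier \<phi> (x - h))"])
      show "integrable lebesgue (\<lambda>x. norm (g x * fourier \<phi> (x - h)))" by (intro integrable_norm i)
      show "AE x in lebesgue. (\<lambda>n. g x * exp (- of_real (abel n * x)) * fourier \<phi> (x - h)) \<longlonglongrightarrow> g x * fourier \<phi> (x - h)"
      proof (intro AE_I2)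
        fix x :: real
        have "(\<lambda>n. g x * exp (- of_real (abel n * x)) * fourier \<phi> (x - h)) \<longlonglongrightarrow> g x * exp (- of_real (0 * x)) * fourier \<phi> (x - h)"
          by (intro tendsto_intros LIMSEQ_inverse_real_of_nat)
        then show "(\<lambda>n. g x * exp (- of_real (abel n * x)) * fourier \<phi> (x - h)) \<longlonglongrightarrow> g x * fourier \<phi> (x - h)" by simp
      qed
      show "AE x in lebesgue. norm (g x * exp (- of_real (abel n * x)) * fourier \<phi> (x - h)) \<le> norm (g x * fourier \<phi> (x - h))" for n
      proof (intro AE_I2)
        fix x :: real
        show "norm (g x * exp (- of_real (abel n * x)) * fourier \<phi> (x - h)) \<le> norm (g x * fourier \<phi> (x - h))"
        proof (cases "x < 0")
          case False
          have "norm (g x * fourier \<phi> (x - h)) * norm (exp (- of_real (abel n * x)) :: complex) \<le> norm (g x * fourier \<phi> (x - h)) * 1"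
            by (intro mult_left_mono en) (use False in auto)
          then show ?thesis by (simp only: norm_mult mult_ac mult_1_right)
        qed (simp add: g0)
      qed
    qed (intro borel_measurable_times meas m em)+
    then have "(LINT x|lebesgue. g x * fourier \<phi> (x - h)) = \<beta> h" for h
      using LIMSEQ_unique[OF _ \<beta>(1)] by blast
    then have "pairing g2 \<phi> h = \<beta> h - (LINT x|lebesgue. g1 x * fourier \<phi> (x - h))" for h
      using Bochner_Integration.integral_add[OF i1 i2, of h h] unfolding pairing_def sum by (simp add: algebra_simps)
    moreover have "((\<lambda>h. \<beta> h - (LINT x|lebesgue. g1 x * fourier \<phi> (x - h))) \<longlongrightarrow> 0 - 0) at_top"
      by (intro tendsto_diff \<beta>(2) tendsto_pairing_compact_part[OF g1i \<phi>])
    ultimately have "(\<lambda>h. pairing g2 \<phi> h) = (\<lambda>h. \<beta> h - (LINT x|lebesgue. g1 x * fourier \<phi> (x - h)))" 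
      "((\<lambda>h. \<beta> h - (LINT x|lebesgue. g1 x * fourier \<phi> (x - h))) \<longlongrightarrow> 0) at_top" by auto
    then show "(pairing g2 \<phi> \<longlongrightarrow> 0) at_top" by simp
  qed
  have bd2: "\<exists>M. \<forall>x>0. norm (partial_transform g2 u x) \<le> M" if u: "u \<in> E" for u
  proof -
    obtain M where M: "\<And>x. x > 0 \<Longrightarrow> norm (partial_transform g u x) \<le> M" using bd[OF u] by blast
    let ?e = "\<lambda>y. exp (- (\<i> * complex_of_real (u * y)))"
    have me: "?e \<in> borel_measurable lebesgue"
      by (intro borel_measurable_lebesgueI borel_measurable_continuous_onI continuous_intros)
    \<comment> \<open>Cutting off the initial part changes a partial transform by at most the L1
      norm of \<open>g1\<close>.\<close>
    have "norm (partial_transform g2 u x) \<le> M + (LINT y|lebesgue. norm (g1 y))" if x: "x > 0" for x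
    proof -
      have "integrable lebesgue (\<lambda>y. indicator {0..x} y *\<^sub>R g1 y)" by (rule integrable_mult_indicator[OF _ g1i]) simp
      from integrable_mult_bounded[OF this me, of 1] 
      have j1: "integrable lebesgue (\<lambda>y. indicator {0..x} y *\<^sub>R (g1 y * ?e y))" by (simp add: norm_exp_imaginary)
      have "integrable lebesgue (\<lambda>y. complex_of_real (indicator {0..x} y))"
        by (intro integrable_of_real integrable_indicator_Icc)
      from integrable_mult_bounded[OF this, of "\<lambda>y. g2 y * ?e y" B] 
      have j2: "integrable lebesgue (\<lambda>y. indicator {0..x} y *\<^sub>R (g2 y * ?e y))"
        using g2B m2 me by (simp add: scaleR_conv_of_real norm_mult norm_exp_imaginary borel_measurable_times)
      have "partial_transform g u x = partial_transform g1 u x + partial_transform g2 u x"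
        unfolding partial_transform_def Bochner_Integration.integral_add[OF j1 j2, symmetric] g12 
        by (intro Bochner_Integration.integral_cong) (auto simp: algebra_simps)
      moreover have "norm (partial_transform g1 u x) \<le> (LINT y|lebesgue. norm (g1 y))"
        unfolding partial_transform_def
        by (rule Bochner_Integration.integral_norm_bound_integral[OF j1 integrable_norm[OF g1i]])
           (auto simp: indicator_def norm_mult norm_exp_imaginary)
      ultimately show ?thesis using M[OF x] norm_triangle_ineq4[of "partial_transform g u x" "partial_transform g1 u x"] by simp
    qed
    then show ?thesis by blast
  qed
  have all: "regular_on g2 UNIV" by (rule regular_everywhere[OF m2 g2B g20 E reg bd2])
  have part: "((\<lambda>x. p (g2 x)) \<longlongrightarrow> 0) at_top" if p: "p = Re \<or> p = Im" and s: "slowly_decreasing_at_top (\<lambda>x. p (g x))" for p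
  proof (rule tendsto_0_of_kernel_tendsto_0)
    show "(\<lambda>x. p (g2 x)) \<in> borel_measurable lebesgue" using p borel_measurable_ReIm[OF m2] by auto
    show "\<bar>p (g2 x)\<bar> \<le> B" for x
      using p g2B[of x] abs_Re_le_cmod[of "g2 x"] abs_Im_le_cmod[of "g2 x"] by auto
    show "\<exists>\<delta>>0. \<exists>X. \<forall>x\<ge>X. \<forall>u\<in>{0..\<delta>}. p (g2 (x + u)) - p (g2 x) \<ge> - \<epsilon>" if "\<epsilon> > 0" for \<epsilon>
    proof -
      obtain \<delta> X' where \<delta>: "\<delta> > 0" "\<And>x u. x \<ge> X' \<Longrightarrow> 0 \<le> u \<Longrightarrow> u \<le> \<delta> \<Longrightarrow> p (g (x + u)) - p (g x) \<ge> - \<epsilon>"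
        using slowly_decreasing_at_topE[OF s \<open>\<epsilon> > 0\<close>] by metis
      then show ?thesis by (intro exI[of _ \<delta>] conjI exI[of _ "max X X'"]) (auto simp: g2_def)
    qed
    show "((\<lambda>y. LINT x|lebesgue. p (g2 x) * pos_kernel (l * (x - y))) \<longlongrightarrow> 0) at_top" if l: "l > 0" for l
    proof -
      let ?\<phi> = "\<lambda>t. pos_kernel_fun (t / l)"
      have \<phi>: "test_fun UNIV ?\<phi>" by (rule test_fun_pos_kernel_scaled[OF l]) simp
      have lim: "(pairing g2 ?\<phi> \<longlongrightarrow> 0) at_top" using all \<phi> by (simp add: regular_on_def)
      have "(LINT x|lebesgue. p (g2 x) * pos_kernel (l * (x - y))) = p (pairing g2 ?\<phi> y) / l" for y
      proof -
        have i: "integrable lebesgue (\<lambda>x. g2 x * fourier ?\<phi> (x - y))" by (rule pairing_integrable[OF m2 g2B \<phi>])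
        have "p (LINT x|lebesgue. f x) = (LINT x|lebesgue. p (f x))" if "integrable lebesgue f" for f :: "real \<Rightarrow> complex"
          using p that by auto
        from this[OF i] have "p (pairing g2 ?\<phi> y) = (LINT x|lebesgue. p (g2 x * fourier ?\<phi> (x - y)))"
          unfolding pairing_def .
        also have "\<dots> = (LINT x|lebesgue. l * (p (g2 x) * pos_kernel (l * (x - y))))"
          unfolding fourier_pos_kernel_scaled[OF l] using p by (intro Bochner_Integration.integral_cong) auto
        also have "\<dots> = l * (LINT x|lebesgue. p (g2 x) * pos_kernel (l * (x - y)))" by (rule integral_mult_right_zero)
        finally show ?thesis using l by simp
      qed
      moreover have "((\<lambda>y. p (pairing g2 ?\<phi> y) / l) \<longlongrightarrow> 0 / l) at_top"
      proof (rule tendsto_divide[OF _ tendsto_const])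
        show "((\<lambda>y. p (pairing g2 ?\<phi> y)) \<longlongrightarrow> 0) at_top"
          using p tendsto_Re[OF lim] tendsto_Im[OF lim] by auto
      qed (use l in simp)
      ultimately show ?thesis by simp
    qed
  qed
  have "((\<lambda>x. Complex (Re (g2 x)) (Im (g2 x))) \<longlongrightarrow> Complex 0 0) at_top"
    by (intro tendsto_Complex part slow) auto
  then have "(g2 \<longlongrightarrow> 0) at_top" by (simp add: zero_complex.code[symmetric])
  then show ?thesis
  proof (rule Lim_transform_eventually)
    show "\<forall>\<^sub>F x in at_top. g2 x = g x" using eventually_ge_at_top[of X] by eventually_elim (simp add: g2_def)
  qed
qed

subsection \<open>Laplace transforms of powers and logarithms\<close>

text \<open>Termwise integration of the exponential series, dominated by the exponential moment of
  order r. It is applied with L x = - x to get analyticity in s, and with L x = ln x to get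
  derivatives in the exponent.\<close>

lemma exponential_moment:
  fixes W :: "'a \<Rightarrow> complex" and L :: "'a \<Rightarrow> real"
  assumes [measurable]: "W \<in> borel_measurable M" "L \<in> borel_measurable M" 
    and int: "integrable M (\<lambda>x. norm (W x) * exp (r * \<bar>L x\<bar>))" and z: "norm z \<le> r"
  shows "(\<lambda>j. z ^ j / fact j * (LINT x|M. W x * of_real (L x ^ j))) sums (LINT x|M. W x * exp (z * of_real (L x)))" (is ?sums)
    and "r > 0 \<Longrightarrow> integrable M (\<lambda>x. W x * of_real (L x ^ j))"
proof -
  have r0: "r \<ge> 0" using z norm_ge_zero order_trans by blast
  have term_le: "norm (W x) * (r ^ j * \<bar>L x\<bar> ^ j / fact j) \<le> norm (W x) * exp (r * \<bar>L x\<bar>)" for x j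
  proof (intro mult_left_mono)
    have "(\<Sum>i\<in>{j}. (r * \<bar>L x\<bar>) ^ i / fact i) \<le> (\<Sum>i. (r * \<bar>L x\<bar>) ^ i / fact i)"
      using r0 by (intro sum_le_suminf) (auto simp: divide_inverse mult.commute intro!: summable_exp)
    then show "r ^ j * \<bar>L x\<bar> ^ j / fact j \<le> exp (r * \<bar>L x\<bar>)"
      by (simp add: exp_def scaleR_conv_of_real divide_inverse mult.commute power_mult_distrib)
  qed auto
  have int_j: "integrable M (\<lambda>x. norm (W x) * (r ^ j * \<bar>L x\<bar> ^ j / fact j))" for j
    by (rule Bochner_Integration.integrable_bound[OF int]) (use term_le r0 in \<open>auto simp: abs_mult\<close>)
  show "integrable M (\<lambda>x. W x * of_real (L x ^ j))" if "r > 0"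
  proof (rule Bochner_Integration.integrable_bound)
    show "integrable M (\<lambda>x. fact j / r ^ j * (norm (W x) * (r ^ j * \<bar>L x\<bar> ^ j / fact j)))"
      by (intro integrable_mult_right int_j)
    show "AE x in M. norm (W x * of_real (L x ^ j)) \<le> norm (fact j / r ^ j * (norm (W x) * (r ^ j * \<bar>L x\<bar> ^ j / fact j)))"
      using that by (intro AE_I2) (simp add: norm_mult norm_power abs_mult power_abs)
  qed measurable
  define f where "f j x = z ^ j / fact j * (W x * of_real (L x ^ j))" for j x
  have [measurable]: "f j \<in> borel_measurable M" for j unfolding f_def[abs_def] by measurable
  have nf: "norm (f j x) \<le> norm (W x) * (r ^ j * \<bar>L x\<bar> ^ j / fact j)" for j x
  proof -
    have "norm (f j x) = norm (W x) * (norm z ^ j * \<bar>L x\<bar> ^ j / fact j)"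
      by (simp add: f_def norm_mult norm_power norm_divide power_abs)
    also have "\<dots> \<le> norm (W x) * (r ^ j * \<bar>L x\<bar> ^ j / fact j)"
      using z by (intro mult_left_mono divide_right_mono mult_right_mono power_mono) auto
    finally show ?thesis .
  qed
  have nf': "norm (f j x) \<le> norm (W x) * ((r * \<bar>L x\<bar>) ^ j /\<^sub>R fact j)" for j x
  proof -
    have "(r * \<bar>L x\<bar>) ^ j /\<^sub>R fact j = r ^ j * \<bar>L x\<bar> ^ j / fact j"
      by (simp add: power_mult_distrib divide_inverse mult.commute)
    then show ?thesis using nf[of j x] by (simp only:)
  qed
  have int_f: "integrable M (f j)" for j
    by (rule Bochner_Integration.integrable_bound[OF int_j[of j]]) (use nf r0 in \<open>auto simp: abs_mult\<close>)
  have f_eq: "f j x = W x * ((z * of_real (L x)) ^ j /\<^sub>R fact j)" for j x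
    by (simp add: f_def scaleR_conv_of_real power_mult_distrib divide_inverse)
  have fsums: "(\<lambda>j. f j x) sums (W x * exp (z * of_real (L x)))" for x
    unfolding f_eq by (intro sums_mult exp_converges)
  have "(\<lambda>j. LINT x|M. f j x) sums (LINT x|M. (\<Sum>j. f j x))"
  proof (rule sums_integral[OF int_f])
    show "AE x in M. summable (\<lambda>j. norm (f j x))"
    proof (intro AE_I2)
      fix x
      show "summable (\<lambda>j. norm (f j x))"
      proof (rule summable_comparison_test')
        show "summable (\<lambda>j. norm (W x) * ((r * \<bar>L x\<bar>) ^ j /\<^sub>R fact j))" 
          by (intro summable_mult summable_exp_generic)
        show "norm (norm (f j x)) \<le> norm (W x) * ((r * \<bar>L x\<bar>) ^ j /\<^sub>R fact j)" if "j \<ge> 0" for j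
          using nf'[of j x] by (simp only: norm_ge_zero real_norm_def abs_of_nonneg)
      qed
    qed
    show "summable (\<lambda>j. LINT x|M. norm (f j x))"
    proof (rule summableI_nonneg_bounded)
      show "0 \<le> (LINT x|M. norm (f j x))" for j by simp
      fix n
      have "(\<Sum>j<n. LINT x|M. norm (f j x)) = (LINT x|M. (\<Sum>j<n. norm (f j x)))"
        by (rule Bochner_Integration.integral_sum[symmetric]) (intro integrable_norm int_f)
      also have "\<dots> \<le> (LINT x|M. norm (W x) * exp (r * \<bar>L x\<bar>))"
      proof (intro integral_mono Bochner_Integration.integrable_sum integrable_norm int_f int)
        fix x
        have "(\<Sum>j<n. norm (f j x)) \<le> (\<Sum>j<n. norm (W x) * ((r * \<bar>L x\<bar>) ^ j /\<^sub>R fact j))"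
          by (intro sum_mono nf')
        also have "\<dots> = norm (W x) * (\<Sum>j<n. (r * \<bar>L x\<bar>) ^ j /\<^sub>R fact j)" by (simp only: sum_distrib_left)
        also have "(\<Sum>j<n. (r * \<bar>L x\<bar>) ^ j /\<^sub>R fact j) \<le> exp (r * \<bar>L x\<bar>)"
          unfolding exp_def using r0 by (intro sum_le_suminf summable_exp_generic) auto
        finally show "(\<Sum>j<n. norm (f j x)) \<le> norm (W x) * exp (r * \<bar>L x\<bar>)" by (simp add: mult_left_mono)
      qed
      finally show "(\<Sum>j<n. LINT x|M. norm (f j x)) \<le> (LINT x|M. norm (W x) * exp (r * \<bar>L x\<bar>))" .
    qed
  qed
  also have "(\<lambda>x. \<Sum>j. f j x) = (\<lambda>x. W x * exp (z * of_real (L x)))"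
    using fsums by (simp add: sums_iff fun_eq_iff)
  finally show ?sums by (simp only: f_def integral_mult_right_zero)
qed

text \<open>From this form both analyticity at 0 and the higher derivatives at 0, which are the
  moments, can be read off.\<close>

lemma exponential_moment_fps:
  fixes W :: "'a \<Rightarrow> complex" and L :: "'a \<Rightarrow> real"
  assumes "W \<in> borel_measurable M" "L \<in> borel_measurable M" 
    and "integrable M (\<lambda>x. norm (W x) * exp (r * \<bar>L x\<bar>))" and r: "r > 0"
  shows "(\<lambda>z. LINT x|M. W x * exp (z * of_real (L x))) has_fps_expansion Abs_fps (\<lambda>j. (LINT x|M. W x * of_real (L x ^ j)) / fact j)"
proof (rule has_fps_expansionI)
  have "\<forall>\<^sub>F z in nhds (0::complex). norm z < r" using r eventually_nhds_in_open[of "ball 0 r" "0::complex"] by simp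
  then show "\<forall>\<^sub>F z in nhds 0. (\<lambda>j. fps_nth (Abs_fps (\<lambda>j. (LINT x|M. W x * of_real (L x ^ j)) / fact j)) j * z ^ j) sums (LINT x|M. W x * exp (z * of_real (L x)))"
  proof eventually_elim
    case (elim z)
    then show ?case using exponential_moment(1)[OF assms(1-3), of z] by (simp add: mult_ac)
  qed
qed

section \<open>The Gamma integral as a function of s and of its exponent\<close>

text \<open>This is x^(w-1) e^(-s x), written as a single exponential so that a change of w or s is
  just another exponential factor.\<close>

definition mellin_kernel :: "complex \<Rightarrow> complex \<Rightarrow> real \<Rightarrow> complex" where
  "mellin_kernel \<omega> s x = (if 0 < x then exp ((\<omega> - 1) * of_real (ln x) - s * of_real x) else 0)"

lemma mellin_kernel_measurable [measurable]: "mellin_kernel \<omega> s \<in> borel_measurable borel"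
  unfolding mellin_kernel_def[abs_def] by measurable

lemma mellin_kernel_integrable:
  assumes "Re \<omega> > 0" "Re s > 0"
  shows "integrable lborel (mellin_kernel \<omega> s)"
proof -
  have "(\<lambda>t. complex_of_real t powr (\<omega> - 1) / of_real (exp (Re s * t))) absolutely_integrable_on {0<..}"
    by (rule absolutely_integrable_Gamma_integral[OF assms])
  then have "integrable lebesgue (\<lambda>t. norm (indicator {0<..} t *\<^sub>R (complex_of_real t powr (\<omega> - 1) / of_real (exp (Re s * t)))))"
    by (intro integrable_norm) (simp add: set_integrable_def)
  also have "(\<lambda>t. norm (indicator {0<..} t *\<^sub>R (complex_of_real t powr (\<omega> - 1) / of_real (exp (Re s * t))))) = 
      (\<lambda>t. norm (mellin_kernel \<omega> s t))"
    by (auto simp: mellin_kernel_def fun_eq_iff indicator_def powr_def norm_divide norm_exp_eq_Re exp_diff Ln_of_real)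
  finally have "integrable lborel (\<lambda>t. norm (mellin_kernel \<omega> s t))" by (subst (asm) integrable_completion) measurable
  then show ?thesis by (subst (asm) integrable_norm_iff) measurable
qed

definition mellin :: "complex \<Rightarrow> complex \<Rightarrow> complex" where
  "mellin \<omega> s = (LINT x|lborel. mellin_kernel \<omega> s x)"

lemma mellin_1: assumes "Re \<omega> > 0" shows "mellin \<omega> 1 = Gamma \<omega>"
proof -
  have "((\<lambda>t. if t \<in> {0<..} then complex_of_real t powr (\<omega> - 1) / of_real (exp t) else 0) has_integral Gamma \<omega>) UNIV"
    using Gamma_integral_complex'[OF assms] by (subst has_integral_restrict_UNIV)
  also have "(\<lambda>t. if t \<in> {0<..} then complex_of_real t powr (\<omega> - 1) / of_real (exp t) else 0) = mellin_kernel \<omega> 1"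
    by (auto simp: mellin_kernel_def fun_eq_iff powr_def exp_diff Ln_of_real exp_of_real)
  finally have "(mellin_kernel \<omega> 1 has_integral Gamma \<omega>) UNIV" .
  moreover have "(mellin_kernel \<omega> 1 has_integral mellin \<omega> 1) UNIV"
    unfolding mellin_def by (rule has_integral_integral_lborel) (rule mellin_kernel_integrable, use assms in auto)
  ultimately show ?thesis by (rule has_integral_unique[symmetric])
qed

lemma mellin_real:
  assumes \<omega>: "Re \<omega> > 0" and a: "a > 0"
  shows "mellin \<omega> (of_real a) = Gamma \<omega> * exp (- \<omega> * of_real (ln a))"
proof -
  have k: "mellin_kernel \<omega> (of_real a) (inverse a * x) = exp ((1 - \<omega>) * of_real (ln a)) * mellin_kernel \<omega> 1 x" for x
  proof (cases "x > 0")
    case True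
    then have lnx: "ln (inverse a * x) = ln x - ln a" using a by (simp add: ln_mult ln_inverse)
    have ax: "complex_of_real a * of_real (inverse a * x) = of_real x" using a by (simp flip: of_real_mult)
    have pos: "0 < inverse a * x" using True a by simp
    show ?thesis unfolding mellin_kernel_def lnx ax if_P[OF pos] if_P[OF True] mult_exp_exp
      by (simp add: algebra_simps)
  next
    case False
    then have "\<not> 0 < inverse a * x" using a by (simp add: zero_less_mult_iff)
    then show ?thesis using False by (simp add: mellin_kernel_def)
  qed
  have "mellin \<omega> (of_real a) = \<bar>inverse a\<bar> *\<^sub>R (LINT x|lborel. mellin_kernel \<omega> (of_real a) (0 + inverse a * x))"
    unfolding mellin_def by (rule lborel_integral_real_affine) (use a in simp)
  also have "\<dots> = inverse a *\<^sub>R (exp ((1 - \<omega>) * of_real (ln a)) * mellin \<omega> 1)"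
    using a by (simp add: k mellin_def)
  also have "inverse a = exp (- ln a)" using a by (simp add: exp_minus)
  also have "exp (- ln a) *\<^sub>R (exp ((1 - \<omega>) * of_real (ln a)) * mellin \<omega> 1) = exp (- \<omega> * of_real (ln a)) * mellin \<omega> 1"
  proof -
    have "of_real (exp (- ln a)) * exp ((1 - \<omega>) * of_real (ln a)) = exp (- \<omega> * complex_of_real (ln a))"
      by (simp only: exp_of_real[symmetric] mult_exp_exp) (simp add: algebra_simps)
    then show ?thesis by (simp only: scaleR_conv_of_real mult.assoc[symmetric])
  qed
  finally show ?thesis using mellin_1[OF \<omega>] by (simp add: mult.commute)
qed

lemma mellin_holomorphic:
  assumes \<omega>: "Re \<omega> > 0"
  shows "mellin \<omega> holomorphic_on {s. Re s > 0}"
  unfolding holomorphic_on_def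
proof
  fix s0 :: complex assume "s0 \<in> {s. Re s > 0}"
  then have s0: "Re s0 > 0" by simp
  \<comment> \<open>Half of Re s0: spending r of the decay on the exponential moment leaves Re s0 -
    r = r > 0 for convergence.\<close>
  define r where "r = Re s0 / 2"
  have r: "r > 0" using s0 by (simp add: r_def)
  have "(\<lambda>z. LINT x|lborel. mellin_kernel \<omega> s0 x * exp (z * of_real (- x))) has_fps_expansion
     Abs_fps (\<lambda>j. (LINT x|lborel. mellin_kernel \<omega> s0 x * of_real ((- x) ^ j)) / fact j)"
  proof (rule exponential_moment_fps[OF _ _ _ r])
    have "integrable lborel (\<lambda>x. norm (mellin_kernel \<omega> (of_real r) x))" 
      by (intro integrable_norm mellin_kernel_integrable \<omega>) (use r in simp)
    also have "(\<lambda>x. norm (mellin_kernel \<omega> (of_real r) x)) = (\<lambda>x. norm (mellin_kernel \<omega> s0 x) * exp (r * \<bar>- x\<bar>))"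
      by (auto simp: fun_eq_iff mellin_kernel_def norm_exp_eq_Re r_def mult_exp_exp algebra_simps)
    finally show "integrable lborel (\<lambda>x. norm (mellin_kernel \<omega> s0 x) * exp (r * \<bar>- x\<bar>))" .
  qed measurable
  then have "(\<lambda>z. LINT x|lborel. mellin_kernel \<omega> s0 x * exp (z * of_real (- x))) analytic_on {0}"
    by (rule has_fps_expansion_imp_analytic_0)
  also have "(\<lambda>z. LINT x|lborel. mellin_kernel \<omega> s0 x * exp (z * of_real (- x))) = (\<lambda>z. mellin \<omega> (s0 + z))"
    unfolding mellin_def by (intro ext Bochner_Integration.integral_cong) 
      (auto simp: mellin_kernel_def mult_exp_exp algebra_simps)
  finally have "(\<lambda>z. mellin \<omega> (s0 + z)) field_differentiable (at 0)"
    by (simp add: analytic_on_imp_differentiable_at)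
  then have "((\<lambda>z. mellin \<omega> (s0 + z)) \<circ> (\<lambda>s. s - s0)) field_differentiable (at s0)"
    by (intro field_differentiable_compose derivative_intros) auto
  then have "mellin \<omega> field_differentiable (at s0)" by (simp add: o_def)
  then show "mellin \<omega> field_differentiable (at s0 within {s. Re s > 0})" by (rule field_differentiable_at_within)
qed

text \<open>The substitution x -> x / s reduces to the Gamma integral only for real s > 0; both
  sides are holomorphic in the half-plane, so the identity theorem carries the formula from the
  positive axis to all of it.\<close>

lemma mellin_eq:
  assumes \<omega>: "Re \<omega> > 0" and s: "Re s > 0"
  shows "mellin \<omega> s = Gamma \<omega> * exp (- \<omega> * Ln s)"
proof -
  let ?H = "{s::complex. Re s > 0}" and ?U = "complex_of_real ` {0<..}"
  have H: "open ?H" "connected ?H" by (auto intro: convex_connected simp: open_halfspace_Re_gt convex_halfspace_Re_gt)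
  have "mellin \<omega> s - Gamma \<omega> * exp (- \<omega> * Ln s) = 0"
  proof (rule analytic_continuation[where f = "\<lambda>s. mellin \<omega> s - Gamma \<omega> * exp (- \<omega> * Ln s)" and S = ?H and U = ?U and \<xi> = 1])
    show "(\<lambda>s. mellin \<omega> s - Gamma \<omega> * exp (- \<omega> * Ln s)) holomorphic_on ?H"
      by (intro holomorphic_intros mellin_holomorphic \<omega>) (auto simp: complex_nonpos_Reals_iff)
    show "1 islimpt ?U" unfolding islimpt_approachable
    proof (intro allI impI)
      fix e :: real assume e: "e > 0"
      show "\<exists>x'\<in>?U. x' \<noteq> 1 \<and> dist x' 1 < e"
      proof (rule bexI[of _ "complex_of_real (1 + e / 2)"])
        show "complex_of_real (1 + e / 2) \<in> ?U" by (rule imageI) (use e in simp)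
        show "complex_of_real (1 + e / 2) \<noteq> 1 \<and> dist (complex_of_real (1 + e / 2)) 1 < e"
          using e by (simp add: dist_norm norm_divide)
      qed
    qed
    show "mellin \<omega> z - Gamma \<omega> * exp (- \<omega> * Ln z) = 0" if "z \<in> ?U" for z
      using that mellin_real[OF \<omega>] by (auto simp: Ln_of_real)
  qed (use H s in auto)
  then show ?thesis by simp
qed

lemma mellin_log_moment:
  assumes \<omega>: "\<omega> > 0" and s: "Re s > 0"
  shows "integrable lborel (\<lambda>x. mellin_kernel (of_real \<omega>) s x * of_real (ln x ^ j))"
    and "(LINT x|lborel. mellin_kernel (of_real \<omega>) s x * of_real (ln x ^ j)) = (deriv ^^ j) (\<lambda>w. mellin w s) (of_real \<omega>)"
proof -
  \<comment> \<open>With r = \<omega> / 2 both exponents \<omega> + r and \<omega> - r stay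
    positive, and x^r + x^(-r) dominates exp(r |ln x|).\<close>
  define r where "r = \<omega> / 2"
  have r: "r > 0" "r < \<omega>" using \<omega> by (auto simp: r_def)
  let ?W = "mellin_kernel (of_real \<omega>) s"
  have "integrable lborel (\<lambda>x. norm (mellin_kernel (of_real (\<omega> + r)) s x) + norm (mellin_kernel (of_real (\<omega> - r)) s x))"
    using r s \<omega> by (intro Bochner_Integration.integrable_add integrable_norm mellin_kernel_integrable) auto
  then have int: "integrable lborel (\<lambda>x. norm (?W x) * exp (r * \<bar>ln x\<bar>))"
  proof (rule Bochner_Integration.integrable_bound)
    show "AE x in lborel. norm (norm (?W x) * exp (r * \<bar>ln x\<bar>)) \<le> norm (norm (mellin_kernel (of_real (\<omega> + r)) s x) + norm (mellin_kernel (of_real (\<omega> - r)) s x))"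
    proof (intro AE_I2)
      fix x :: real
      have "norm (?W x) * exp (r * \<bar>ln x\<bar>) \<le> norm (mellin_kernel (of_real (\<omega> + r)) s x) + norm (mellin_kernel (of_real (\<omega> - r)) s x)"
      proof (cases "x > 0")
        case True
        have "norm (?W x) * exp (r * ln x) = norm (mellin_kernel (of_real (\<omega> + r)) s x)" 
          "norm (?W x) * exp (r * (- ln x)) = norm (mellin_kernel (of_real (\<omega> - r)) s x)"
          using True by (simp_all add: mellin_kernel_def norm_exp_eq_Re mult_exp_exp algebra_simps)
        then show ?thesis by (cases "ln x \<ge> 0") auto
      qed (simp add: mellin_kernel_def)
      then show "norm (norm (?W x) * exp (r * \<bar>ln x\<bar>)) \<le> norm (norm (mellin_kernel (of_real (\<omega> + r)) s x) + norm (mellin_kernel (of_real (\<omega> - r)) s x))"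
        by simp
    qed
  qed measurable
  show "integrable lborel (\<lambda>x. ?W x * of_real (ln x ^ j))"
    by (rule exponential_moment(2)[OF _ _ int, of 0]) (use r in auto)
  have "(\<lambda>z. LINT x|lborel. ?W x * exp (z * of_real (ln x))) has_fps_expansion
     Abs_fps (\<lambda>j. (LINT x|lborel. ?W x * of_real (ln x ^ j)) / fact j)"
    by (rule exponential_moment_fps[OF _ _ int r(1)]) measurable
  also have "(\<lambda>z. LINT x|lborel. ?W x * exp (z * of_real (ln x))) = (\<lambda>z. mellin (of_real \<omega> + z) s)"
    unfolding mellin_def by (intro ext Bochner_Integration.integral_cong) 
      (auto simp: mellin_kernel_def mult_exp_exp algebra_simps)
  finally have "fps_nth (Abs_fps (\<lambda>j. (LINT x|lborel. ?W x * of_real (ln x ^ j)) / fact j)) j = 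
      (deriv ^^ j) (\<lambda>z. mellin (of_real \<omega> + z) s) 0 / fact j"
    by (rule fps_nth_fps_expansion)
  then show "(LINT x|lborel. ?W x * of_real (ln x ^ j)) = (deriv ^^ j) (\<lambda>w. mellin w s) (of_real \<omega>)"
    using higher_deriv_shift_0[of j "\<lambda>w. mellin w s" "of_real \<omega>"] by (simp add: o_def)
qed

lemma higher_deriv_exp_linear: "(deriv ^^ n) (\<lambda>w. exp (c * w)) = (\<lambda>w. c ^ n * exp (c * w :: complex))"
proof (induction n)
  case (Suc n)
  have "deriv (\<lambda>w. c ^ n * exp (c * w)) w = c ^ Suc n * exp (c * w)" for w
    by (rule DERIV_imp_deriv) (auto intro!: derivative_eq_intros)
  then show ?case by (simp add: Suc fun_eq_iff)
qed simp

text \<open>\<open>Dj\<close> is defined by real derivatives, whereas the Leibniz rule is applied to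
  holomorphic functions of the exponent; for an entire function that is real on the real axis the
  two kinds of derivatives agree there.\<close>

lemma higher_deriv_of_real:
  assumes "F holomorphic_on UNIV" "\<And>x. F (of_real x) = of_real (f x)"
  shows "(deriv ^^ j) F (of_real x) = of_real ((deriv ^^ j) f x)"
  using assms
proof (induction j arbitrary: F f)
  case (Suc j)
  have "deriv F (of_real x) = of_real (deriv f x)" for x
  proof -
    have "(F has_field_derivative deriv F (of_real x)) (at (of_real x))"
      using Suc.prems(1) by (intro holomorphic_derivI[of _ UNIV]) auto
    from has_vector_derivative_real_field[OF this, of UNIV]
    have d: "((\<lambda>x. of_real (f x)) has_vector_derivative deriv F (of_real x)) (at x)" by (simp add: Suc.prems(2))
    have "((\<lambda>x. Im (of_real (f x))) has_vector_derivative Im (deriv F (of_real x))) (at x)"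
      by (rule bounded_linear.has_vector_derivative[OF bounded_linear_Im d])
    then have "((\<lambda>x. 0) has_vector_derivative Im (deriv F (of_real x))) (at x)" by simp
    then have im: "Im (deriv F (of_real x)) = 0" using vector_derivative_unique_at has_vector_derivative_const by blast
    have "((\<lambda>x. Re (of_real (f x))) has_vector_derivative Re (deriv F (of_real x))) (at x)"
      by (rule bounded_linear.has_vector_derivative[OF bounded_linear_Re d])
    then have "(f has_real_derivative Re (deriv F (of_real x))) (at x)" 
      by (simp add: has_real_derivative_iff_has_vector_derivative)
    then have "deriv f x = Re (deriv F (of_real x))" by (rule DERIV_imp_deriv)
    then show ?thesis using im by (simp add: complex_eq_iff)
  qed
  then have "(deriv ^^ j) (deriv F) (of_real x) = of_real ((deriv ^^ j) (deriv f) x)"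
    using Suc.prems(1) by (intro Suc.IH holomorphic_deriv) auto
  then show ?case by (simp add: funpow_Suc_right del: funpow.simps)
qed simp

lemma Dj_complex: "(deriv ^^ j) rGamma (complex_of_real \<omega>) = of_real (Dj j \<omega>)"
  unfolding Dj_def by (rule higher_deriv_of_real) (auto intro: holomorphic_intros simp: rGamma_complex_of_real)

text \<open>
  The \<open>k\<close>-th derivative of \<open>x\<^sup>\<omega>\<^sup>-\<^sup>1 / \<Gamma>(\<omega>)\<close> in \<open>\<omega>\<close>, at \<open>\<omega> = \<beta> + 1\<close>: its Laplace transform is therefore
  the \<open>k\<close>-th derivative of \<open>s\<^sup>-\<^sup>\<omega>\<close>.
\<close>
definition power_log :: "nat \<Rightarrow> real \<Rightarrow> real \<Rightarrow> complex" where
  "power_log k \<beta> x = of_real (x powr \<beta>) * (\<Sum>j=0..k. of_nat (k choose j) * of_real (Dj j (\<beta> + 1)) * of_real (ln x ^ (k - j)))"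

lemma laplace_power_log:
  assumes \<beta>: "\<beta> \<ge> 0" and s: "Re s > 0"
  shows "integrable lborel (\<lambda>x. (if 0 < x then power_log k \<beta> x else 0) * exp (- s * of_real x))"
    and "(LINT x|lborel. (if 0 < x then power_log k \<beta> x else 0) * exp (- s * of_real x)) = Ln (1 / s) ^ k / s powr of_real (\<beta> + 1)"
proof -
  define \<omega> where "\<omega> = \<beta> + 1"
  have \<omega>: "\<omega> > 0" using \<beta> by (simp add: \<omega>_def)
  have eq: "(if 0 < x then power_log k \<beta> x else 0) * exp (- s * of_real x) = 
     (\<Sum>j=0..k. of_nat (k choose j) * of_real (Dj j \<omega>) * (mellin_kernel (of_real \<omega>) s x * of_real (ln x ^ (k - j))))" for x
  proof (cases "x > 0")
    case True
    have e: "of_real (x powr \<beta>) * exp (- s * of_real x) = mellin_kernel (of_real \<omega>) s x"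
      using True by (simp add: mellin_kernel_def \<omega>_def powr_def exp_of_real[symmetric] mult_exp_exp)
    have "power_log k \<beta> x * exp (- s * of_real x) = mellin_kernel (of_real \<omega>) s x * 
        (\<Sum>j=0..k. of_nat (k choose j) * of_real (Dj j \<omega>) * of_real (ln x ^ (k - j)))"
      unfolding power_log_def \<omega>_def[symmetric] e[symmetric] by (simp only: mult_ac)
    also have "\<dots> = (\<Sum>j=0..k. of_nat (k choose j) * of_real (Dj j \<omega>) * (mellin_kernel (of_real \<omega>) s x * of_real (ln x ^ (k - j))))"
      unfolding sum_distrib_left by (intro sum.cong refl) (simp only: mult_ac)
    finally show ?thesis using True by simp
  qed (simp add: mellin_kernel_def)
  show "integrable lborel (\<lambda>x. (if 0 < x then power_log k \<beta> x else 0) * exp (- s * of_real x))"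
    unfolding eq by (intro Bochner_Integration.integrable_sum integrable_mult_right mellin_log_moment(1)[OF \<omega> s])
  let ?H = "{w::complex. Re w > 0}"
  have H: "open ?H" "of_real \<omega> \<in> ?H" using \<omega> by (auto simp: open_halfspace_Re_gt)
  have hol: "(\<lambda>w. mellin w s) holomorphic_on ?H"
  proof -
    have "(\<lambda>w. Gamma w * exp (- w * Ln s)) holomorphic_on ?H"
      by (intro holomorphic_intros) (auto elim!: nonpos_Ints_cases)
    then show ?thesis by (rule holomorphic_transform) (use mellin_eq[OF _ s] in auto)
  qed
  have "(LINT x|lborel. (if 0 < x then power_log k \<beta> x else 0) * exp (- s * of_real x)) = 
    (\<Sum>j=0..k. of_nat (k choose j) * (deriv ^^ j) rGamma (of_real \<omega>) * (deriv ^^ (k - j)) (\<lambda>w. mellin w s) (of_real \<omega>))"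
    unfolding eq Dj_complex mellin_log_moment(2)[OF \<omega> s, symmetric]
    by (subst Bochner_Integration.integral_sum)
      (intro integrable_mult_right mellin_log_moment(1)[OF \<omega> s], simp only: integral_mult_right_zero)
  \<comment> \<open>The Leibniz rule read backwards: the binomial sum in \<open>power_log\<close> is
    what it produces for 1 / Gamma times the Gamma integral, and that product collapses to exp(- w
    Ln s).\<close>
  also have "\<dots> = (deriv ^^ k) (\<lambda>w. rGamma w * mellin w s) (of_real \<omega>)"
    by (rule higher_deriv_mult[symmetric, OF _ hol H]) (rule holomorphic_rGamma)
  also have "\<dots> = (deriv ^^ k) (\<lambda>w. exp ((- Ln s) * w)) (of_real \<omega>)"
  proof (rule higher_deriv_transform_within_open[where S = ?H])
    show "(\<lambda>w. rGamma w * mellin w s) holomorphic_on ?H" by (intro holomorphic_intros hol)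
    show "(\<lambda>w. exp (- Ln s * w)) holomorphic_on ?H" by (intro holomorphic_intros)
    show "rGamma w * mellin w s = exp (- Ln s * w)" if "w \<in> ?H" for w
    proof -
      have "w \<notin> \<int>\<^sub>\<le>\<^sub>0" using that by (auto elim!: nonpos_Ints_cases)
      then have "rGamma w * Gamma w = 1" by (simp add: Gamma_def rGamma_eq_zero_iff)
      then show ?thesis using that by (simp add: mellin_eq[OF _ s] mult.assoc[symmetric] mult.commute)
    qed
  qed (use H in auto)
  also have "\<dots> = Ln (1 / s) ^ k / s powr of_real (\<beta> + 1)"
  proof -
    have "s \<notin> \<real>\<^sub>\<le>\<^sub>0" using s by (auto simp: complex_nonpos_Reals_iff)
    then have "Ln (1 / s) = - Ln s" by (simp add: Ln_inverse inverse_eq_divide[symmetric])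
    moreover have "s \<noteq> 0" using s by auto
    ultimately show ?thesis unfolding higher_deriv_exp_linear
      by (simp add: powr_def \<omega>_def exp_minus divide_inverse mult.commute)
  qed
  finally show "(LINT x|lborel. (if 0 < x then power_log k \<beta> x else 0) * exp (- s * of_real x)) = Ln (1 / s) ^ k / s powr of_real (\<beta> + 1)" .
qed

subsection \<open>Main terms\<close>

text \<open>Two-sided and in norm, so that it survives multiplication by complex constants and can
  be subtracted from a slowly decreasing function.\<close>

definition uniformly_continuous_at_top :: "(real \<Rightarrow> complex) \<Rightarrow> bool" where
  "uniformly_continuous_at_top f \<longleftrightarrow> (\<forall>\<epsilon>>0. \<exists>\<delta>>0. \<exists>X. \<forall>x\<ge>X. \<forall>u\<in>{0..\<delta>}. norm (f (x + u) - f x) \<le> \<epsilon>)"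

lemma uniformly_continuous_at_top_add:
  assumes "uniformly_continuous_at_top f" "uniformly_continuous_at_top g"
  shows "uniformly_continuous_at_top (\<lambda>x. f x + g x)"
  unfolding uniformly_continuous_at_top_def
proof (intro allI impI)
  fix \<epsilon> :: real assume "\<epsilon> > 0"
  then have e: "\<epsilon> / 2 > 0" by simp
  obtain d X where 1: "d > 0" "\<forall>x\<ge>X. \<forall>u\<in>{0..d}. norm (f (x + u) - f x) \<le> \<epsilon> / 2"
    using assms(1) e unfolding uniformly_continuous_at_top_def by blast
  obtain d' X' where 2: "d' > 0" "\<forall>x\<ge>X'. \<forall>u\<in>{0..d'}. norm (g (x + u) - g x) \<le> \<epsilon> / 2"
    using assms(2) e unfolding uniformly_continuous_at_top_def by blast
  show "\<exists>\<delta>>0. \<exists>X. \<forall>x\<ge>X. \<forall>u\<in>{0..\<delta>}. norm (f (x + u) + g (x + u) - (f x + g x)) \<le> \<epsilon>"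
  proof (intro exI conjI allI impI ballI)
    show "min d d' > 0" using 1 2 by simp
    fix x u assume "x \<ge> max X X'" "u \<in> {0..min d d'}"
    then have "norm (f (x + u) - f x) \<le> \<epsilon> / 2" "norm (g (x + u) - g x) \<le> \<epsilon> / 2" using 1 2 by auto
    then show "norm (f (x + u) + g (x + u) - (f x + g x)) \<le> \<epsilon>"
      using norm_triangle_ineq[of "f (x + u) - f x" "g (x + u) - g x"] by (simp add: algebra_simps)
  qed
qed

lemma uniformly_continuous_at_top_lipschitz:
  assumes "\<And>x u. x \<ge> X \<Longrightarrow> u \<ge> 0 \<Longrightarrow> norm (f (x + u) - f x) \<le> C * u"
  shows "uniformly_continuous_at_top f"
  unfolding uniformly_continuous_at_top_def
proof (intro allI impI)
  fix \<epsilon> :: real assume \<epsilon>: "\<epsilon> > 0"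
  define \<delta> where "\<delta> = \<epsilon> / (\<bar>C\<bar> + 1)"
  have \<delta>: "\<delta> > 0" using \<epsilon> by (simp add: \<delta>_def add_nonneg_pos)
  show "\<exists>\<delta>>0. \<exists>X. \<forall>x\<ge>X. \<forall>u\<in>{0..\<delta>}. norm (f (x + u) - f x) \<le> \<epsilon>"
  proof (intro exI conjI allI impI ballI)
    show "\<delta> > 0" by (rule \<delta>)
    fix x u assume x: "x \<ge> X" "u \<in> {0..\<delta>}"
    have "norm (f (x + u) - f x) \<le> C * u" using assms x by auto
    also have "\<dots> \<le> (\<bar>C\<bar> + 1) * \<delta>" using x by (intro mult_mono) auto
    also have "\<dots> = \<epsilon>" by (simp add: \<delta>_def)
    finally show "norm (f (x + u) - f x) \<le> \<epsilon>" .
  qed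
qed

lemma uniformly_continuous_at_top_cmult:
  assumes "uniformly_continuous_at_top f" shows "uniformly_continuous_at_top (\<lambda>x. c * f x)"
  unfolding uniformly_continuous_at_top_def
proof (intro allI impI)
  fix \<epsilon> :: real assume \<epsilon>: "\<epsilon> > 0"
  then have "\<epsilon> / (norm c + 1) > 0" by (simp add: add_nonneg_pos)
  then obtain d X where 1: "d > 0" "\<forall>x\<ge>X. \<forall>u\<in>{0..d}. norm (f (x + u) - f x) \<le> \<epsilon> / (norm c + 1)"
    using assms(1) unfolding uniformly_continuous_at_top_def by blast
  show "\<exists>\<delta>>0. \<exists>X. \<forall>x\<ge>X. \<forall>u\<in>{0..\<delta>}. norm (c * f (x + u) - c * f x) \<le> \<epsilon>"
  proof (intro exI conjI allI impI ballI)
    show "d > 0" by (rule 1)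
    fix x u assume "x \<ge> X" "u \<in> {0..d}"
    then have "norm (f (x + u) - f x) \<le> \<epsilon> / (norm c + 1)" using 1 by auto
    then have "(norm c + 1) * norm (f (x + u) - f x) \<le> \<epsilon>" 
      by (subst (asm) pos_le_divide_eq) (simp_all add: add_nonneg_pos mult.commute)
    moreover have "norm (c * f (x + u) - c * f x) = norm c * norm (f (x + u) - f x)"
      by (simp add: norm_mult[symmetric] right_diff_distrib)
    ultimately show "norm (c * f (x + u) - c * f x) \<le> \<epsilon>"
      using norm_ge_zero[of "f (x + u) - f x"] by (simp only: distrib_right mult_1_left)
  qed
qed

lemma uniformly_continuous_at_top_0: "uniformly_continuous_at_top (\<lambda>x. 0)"
  by (rule uniformly_continuous_at_top_lipschitz[where C = 0]) simp

lemma slowly_decreasing_diff: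
  assumes "slowly_decreasing_at_top (\<lambda>x. p (f x))" "uniformly_continuous_at_top m" "p = Re \<or> p = Im"
  shows "slowly_decreasing_at_top (\<lambda>x. p (f x - m x))"
  unfolding slowly_decreasing_at_top_def
proof (intro allI impI)
  fix \<epsilon> :: real assume "\<epsilon> > 0"
  then have e: "\<epsilon> / 2 > 0" by simp
  obtain d X where 1: "d > 0" "\<forall>x\<ge>X. \<forall>u\<in>{0..d}. p (f (x + u)) - p (f x) \<ge> - (\<epsilon> / 2)"
    using assms(1) e unfolding slowly_decreasing_at_top_def by blast
  obtain d' X' where 2: "d' > 0" "\<forall>x\<ge>X'. \<forall>u\<in>{0..d'}. norm (m (x + u) - m x) \<le> \<epsilon> / 2"
    using assms(2) e unfolding uniformly_continuous_at_top_def by blast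
  show "\<exists>\<delta>>0. \<exists>X. \<forall>x\<ge>X. \<forall>u\<in>{0..\<delta>}. p (f (x + u) - m (x + u)) - p (f x - m x) \<ge> - \<epsilon>"
  proof (intro exI conjI allI impI ballI)
    show "min d d' > 0" using 1 2 by simp
    fix x u assume xu: "x \<ge> max X X'" "u \<in> {0..min d d'}"
    have "p (f (x + u)) - p (f x) \<ge> - (\<epsilon> / 2)" using 1 xu by auto
    moreover have "norm (m (x + u) - m x) \<le> \<epsilon> / 2" using 2 xu by auto
    moreover have "\<bar>p (m (x + u) - m x)\<bar> \<le> norm (m (x + u) - m x)"
      using assms(3) abs_Re_le_cmod abs_Im_le_cmod by auto
    moreover have "p (a - b) = p a - p b" for a b using assms(3) by auto
    ultimately show "p (f (x + u) - m (x + u)) - p (f x - m x) \<ge> - \<epsilon>" by simp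
  qed
qed

text \<open>What a function must satisfy to be subtracted from \<open>\<tau>\<close>, with
  \<open>L\<close> its absolutely convergent Laplace transform. The pairs (m, L) are closed under
  linear combinations, so only x, e^(itx) and x^\<beta> log^j x need individual treatment.\<close>

definition main_term :: "(real \<Rightarrow> complex) \<Rightarrow> (complex \<Rightarrow> complex) \<Rightarrow> bool" where
  "main_term m L \<longleftrightarrow> m \<in> borel_measurable borel \<and> (\<forall>x\<le>0. m x = 0) \<and> uniformly_continuous_at_top m \<and>
    (\<forall>s. Re s > 0 \<longrightarrow> integrable lborel (\<lambda>x. m x * exp (- s * of_real x)) \<and> (LINT x|lborel. m x * exp (- s * of_real x)) = L s)"

lemma main_term_add:
  assumes "main_term m L" "main_term m' L'" shows "main_term (\<lambda>x. m x + m' x) (\<lambda>s. L s + L' s)"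
  using assms unfolding main_term_def distrib_right
  by (auto intro: uniformly_continuous_at_top_add)

lemma main_term_cmult:
  assumes "main_term m L" shows "main_term (\<lambda>x. c * m x) (\<lambda>s. c * L s)"
  using assms unfolding main_term_def mult.assoc
  by (auto intro: uniformly_continuous_at_top_cmult)

lemma main_term_0: "main_term (\<lambda>x. 0) (\<lambda>s. 0)"
  unfolding main_term_def
  by (simp add: uniformly_continuous_at_top_0)

lemma main_term_sum:
  assumes "\<And>i. i \<in> I \<Longrightarrow> main_term (m i) (L i)"
  shows "main_term (\<lambda>x. \<Sum>i\<in>I. m i x) (\<lambda>s. \<Sum>i\<in>I. L i s)"
  using assms by (induction I rule: infinite_finite_induct) (auto intro: main_term_0 main_term_add)

lemma main_term_linear: "main_term (\<lambda>x. if 0 < x then of_real x else 0) (\<lambda>s. 1 / s\<^sup>2)"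
proof -
  let ?m = "\<lambda>x::real. if 0 < x then complex_of_real x else 0"
  have eq: "?m x * exp (- s * of_real x) = mellin_kernel 2 s x" for s x
  proof (cases "x > 0")
    case True
    have "mellin_kernel 2 s x = exp (of_real (ln x)) * exp (- s * of_real x)" using True by (simp add: mellin_kernel_def mult_exp_exp)
    also have "exp (complex_of_real (ln x)) = of_real x" using True by (simp add: exp_of_real)
    finally show ?thesis using True by simp
  qed (simp add: mellin_kernel_def)
  have "(LINT x|lborel. mellin_kernel 2 s x) = 1 / s\<^sup>2" if "Re s > 0" for s
  proof -
    have "s \<noteq> 0" using that by auto
    then have "exp (- (2 * Ln s)) = 1 / s\<^sup>2" by (simp add: exp_minus exp_double divide_inverse)
    moreover have "Gamma (2::complex) = 1" using Gamma_fact[of 1, where 'a = complex] by (simp add: eval_nat_numeral)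
    ultimately show ?thesis using mellin_eq[OF _ that, of 2] by (simp add: mellin_def)
  qed
  then show ?thesis unfolding main_term_def eq
    by (auto intro!: mellin_kernel_integrable uniformly_continuous_at_top_lipschitz[where C = 1 and X = 1] simp flip: of_real_diff)
qed

lemma norm_exp_i_diff: "norm (exp (\<i> * of_real b) - exp (\<i> * of_real a)) \<le> \<bar>b - a\<bar>"
proof -
  have "exp (\<i> * of_real b) - exp (\<i> * of_real a) = exp (\<i> * of_real a) * (exp (\<i> * of_real (b - a)) - 1)"
    by (simp add: right_diff_distrib mult_exp_exp)
  moreover have "norm (exp (\<i> * of_real (b - a)) - 1) \<le> \<bar>b - a\<bar>"
    unfolding dist_exp_i_1 using abs_sin_x_le_abs_x[of "(b - a) / 2"] by simp
  ultimately show ?thesis by (simp add: norm_mult norm_exp_imaginary)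
qed

text \<open>The factor e^(itx) shifts s to s - it in the Gamma integral with exponent 1.\<close>

lemma main_term_exp: "main_term (\<lambda>x. if 0 < x then exp (\<i> * of_real (t * x)) else 0) (\<lambda>s. 1 / (s - \<i> * of_real t))"
proof -
  let ?m = "\<lambda>x::real. if 0 < x then exp (\<i> * complex_of_real (t * x)) else 0"
  have eq: "?m x * exp (- s * of_real x) = mellin_kernel 1 (s - \<i> * of_real t) x" for s x
    by (simp add: mellin_kernel_def mult_exp_exp algebra_simps)
  have "(LINT x|lborel. mellin_kernel 1 (s - \<i> * of_real t) x) = 1 / (s - \<i> * of_real t)" if "Re s > 0" for s
  proof -
    have r: "Re (s - \<i> * of_real t) > 0" using that by simp
    then have "s - \<i> * of_real t \<noteq> 0" by (metis less_irrefl zero_complex.simps(1))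
    then have "exp (- Ln (s - \<i> * of_real t)) = 1 / (s - \<i> * of_real t)" by (simp add: exp_minus divide_inverse)
    then show ?thesis using mellin_eq[OF _ r, of 1] by (simp add: mellin_def)
  qed
  moreover have "uniformly_continuous_at_top ?m"
  proof (rule uniformly_continuous_at_top_lipschitz[where C = "\<bar>t\<bar>" and X = 1])
    fix x u :: real assume "x \<ge> 1" "u \<ge> 0"
    then show "norm (?m (x + u) - ?m x) \<le> \<bar>t\<bar> * u"
      using norm_exp_i_diff[of "t * (x + u)" "t * x"] by (simp add: algebra_simps abs_mult)
  qed
  moreover have "?m \<in> borel_measurable borel" by measurable
  ultimately show ?thesis unfolding main_term_def eq by (auto intro!: mellin_kernel_integrable)
qed

lemma powr_ln_power_bounded:
  fixes \<beta> :: real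
  assumes "\<beta> < 1"
  obtains C where "C \<ge> 0" "\<And>x. x \<ge> 1 \<Longrightarrow> x powr (\<beta> - 1) * ln x ^ n \<le> C"
proof -
  \<comment> \<open>ln x <= x^c / c turns the n-th power of the logarithm into x^(c n), and c n <= 1
    - \<beta>; the denominator n + 1 also covers n = 0.\<close>
  define c where "c = (1 - \<beta>) / (real n + 1)"
  have c: "c > 0" using assms by (simp add: c_def)
  have "x powr (\<beta> - 1) * ln x ^ n \<le> (1 / c) ^ n" if x: "x \<ge> 1" for x
  proof -
    have "ln x \<le> x powr c / c" using x c by (rule ln_powr_bound)
    then have "ln x ^ n \<le> (x powr c / c) ^ n" using x by (intro power_mono) auto
    also have "\<dots> = x powr (c * real n) * (1 / c) ^ n"
      using x by (simp add: power_divide powr_powr[symmetric] powr_realpow)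
    finally have "x powr (\<beta> - 1) * ln x ^ n \<le> x powr (\<beta> - 1) * (x powr (c * real n) * (1 / c) ^ n)"
      by (intro mult_left_mono) auto
    also have "\<dots> = x powr (\<beta> - 1 + c * real n) * (1 / c) ^ n" by (simp add: powr_add)
    also have "\<dots> \<le> 1 * (1 / c) ^ n"
    proof (rule mult_right_mono)
      have "c * real n \<le> c * (real n + 1)" using c by simp
      also have "\<dots> = 1 - \<beta>" by (simp add: c_def)
      finally have "x powr (\<beta> - 1 + c * real n) \<le> x powr 0" using x by (intro powr_mono) auto
      then show "x powr (\<beta> - 1 + c * real n) \<le> 1" using x by simp
    qed (use c in simp)
    finally show ?thesis by simp
  qed
  then show thesis using c by (intro that[of "(1 / c) ^ n"]) auto
qed

text \<open>The derivative is bounded on {1..} because the negative power x^(\<beta>-1) beats every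
  power of the logarithm. Here \<beta> < 1 is essential: x ln x is not uniformly continuous at
  infinity.\<close>

lemma uniformly_continuous_at_top_powr_ln:
  assumes "0 \<le> \<beta>" "\<beta> < 1"
  shows "uniformly_continuous_at_top (\<lambda>x. of_real (x powr \<beta> * ln x ^ n))"
proof -
  obtain C1 where C1: "C1 \<ge> 0" "\<And>x. x \<ge> 1 \<Longrightarrow> x powr (\<beta> - 1) * ln x ^ n \<le> C1" using powr_ln_power_bounded[OF assms(2)] by metis
  obtain C2 where C2: "C2 \<ge> 0" "\<And>x. x \<ge> 1 \<Longrightarrow> x powr (\<beta> - 1) * ln x ^ (n - 1) \<le> C2" using powr_ln_power_bounded[OF assms(2)] by metis
  define C where "C = C1 + real n * C2"
  let ?f = "\<lambda>x. x powr \<beta> * ln x ^ n"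
  \<comment> \<open>For n = 0 the truncated exponent n - 1 does no harm, as its factor n is
    zero.\<close>
  let ?f' = "\<lambda>x. \<beta> * (x powr (\<beta> - 1) * ln x ^ n) + real n * (x powr (\<beta> - 1) * ln x ^ (n - 1))"
  have d: "(?f has_real_derivative ?f' x) (at x)" if "x \<ge> 1" for x
  proof -
    have "((\<lambda>x. x powr \<beta>) has_real_derivative \<beta> * x powr (\<beta> - 1)) (at x)" using that by (intro has_real_derivative_powr) auto
    moreover have "((\<lambda>x. ln x ^ n) has_real_derivative real n * ln x ^ (n - 1) * (1 / x)) (at x)"
      using that by (auto intro!: derivative_eq_intros)
    ultimately have "(?f has_real_derivative \<beta> * x powr (\<beta> - 1) * ln x ^ n + real n * ln x ^ (n - 1) * (1 / x) * x powr \<beta>) (at x)"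
      by (rule DERIV_mult)
    moreover have e: "x powr (\<beta> - 1) = (1 / x) * x powr \<beta>" using that by (simp add: powr_diff)
    have "\<beta> * x powr (\<beta> - 1) * ln x ^ n + real n * ln x ^ (n - 1) * (1 / x) * x powr \<beta> = ?f' x"
      unfolding e by (simp only: mult_ac)
    ultimately show ?thesis by (simp only:)
  qed
  have b: "\<bar>?f' x\<bar> \<le> C" if "x \<ge> 1" for x
  proof -
    have "0 \<le> x powr (\<beta> - 1) * ln x ^ n" "0 \<le> x powr (\<beta> - 1) * ln x ^ (n - 1)" using that by auto
    moreover have "\<beta> * (x powr (\<beta> - 1) * ln x ^ n) \<le> 1 * C1" using C1 that assms by (intro mult_mono) auto
    moreover have "real n * (x powr (\<beta> - 1) * ln x ^ (n - 1)) \<le> real n * C2" using C2 that by (intro mult_left_mono) auto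
    moreover have "0 \<le> \<beta> * (x powr (\<beta> - 1) * ln x ^ n)" "0 \<le> real n * (x powr (\<beta> - 1) * ln x ^ (n - 1))"
      using assms that by auto
    ultimately show ?thesis by (simp add: C_def)
  qed
  show ?thesis
  proof (rule uniformly_continuous_at_top_lipschitz[where C = C and X = 1])
    fix x u :: real assume x: "x \<ge> 1" "u \<ge> 0"
    have "norm (?f (x + u) - ?f x) \<le> C * norm (x + u - x)"
    proof (rule field_differentiable_bound[where S = "{1..}" and f = ?f and f' = ?f' and B = C and x = "x + u" and y = x])
      show "(?f has_real_derivative ?f' z) (at z within {1..})" if "z \<in> {1..}" for z
        by (rule has_field_derivative_at_within[OF d]) (use that in simp)
      show "norm (?f' z) \<le> C" if "z \<in> {1..}" for z unfolding real_norm_def by (rule b) (use that in simp)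
    qed (use x in auto)
    then show "norm (complex_of_real (?f (x + u)) - of_real (?f x)) \<le> C * u" 
      using x by (simp only: of_real_diff[symmetric] norm_of_real real_norm_def) simp
  qed
qed

lemma main_term_power_log:
  assumes \<beta>: "0 \<le> \<beta>" "\<beta> < 1"
  shows "main_term (\<lambda>x. if 0 < x then power_log k \<beta> x else 0) (\<lambda>s. Ln (1 / s) ^ k / s powr of_real (\<beta> + 1))"
proof -
  have "uniformly_continuous_at_top (\<lambda>x. \<Sum>j=0..k. (of_nat (k choose j) * of_real (Dj j (\<beta> + 1))) * of_real (x powr \<beta> * ln x ^ (k - j)))"
    (is "uniformly_continuous_at_top ?s")
  proof -
    have "uniformly_continuous_at_top (\<lambda>x. \<Sum>j\<in>J. (of_nat (k choose j) * of_real (Dj j (\<beta> + 1))) * of_real (x powr \<beta> * ln x ^ (k - j)))" 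
      for J :: "nat set"
    proof (induction J rule: infinite_finite_induct)
      case (insert j J)
      show ?case unfolding sum.insert[OF insert.hyps]
        by (intro uniformly_continuous_at_top_add uniformly_continuous_at_top_cmult uniformly_continuous_at_top_powr_ln \<beta> insert.IH)
    qed (simp_all add: uniformly_continuous_at_top_0)
    then show ?thesis .
  qed
  moreover have pl: "power_log k \<beta> x = ?s x" for x
    by (simp add: power_log_def sum_distrib_left mult_ac)
  ultimately have uc: "uniformly_continuous_at_top (power_log k \<beta>)" by (simp only: pl[abs_def])
  have "uniformly_continuous_at_top (\<lambda>x. if 0 < x then power_log k \<beta> x else 0)"
    unfolding uniformly_continuous_at_top_def
  proof (intro allI impI)
    fix \<epsilon> :: real assume "\<epsilon> > 0"
    then obtain d X where "d > 0" "\<forall>x\<ge>X. \<forall>u\<in>{0..d}. norm (power_log k \<beta> (x + u) - power_log k \<beta> x) \<le> \<epsilon>"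
      using uc unfolding uniformly_continuous_at_top_def by blast
    then show "\<exists>\<delta>>0. \<exists>X. \<forall>x\<ge>X. \<forall>u\<in>{0..\<delta>}. norm ((if 0 < x + u then power_log k \<beta> (x + u) else 0) - (if 0 < x then power_log k \<beta> x else 0)) \<le> \<epsilon>"
      by (intro exI[of _ d] conjI exI[of _ "max X 1"]) auto
  qed
  moreover have "(\<lambda>x. if 0 < x then power_log k \<beta> x else 0) \<in> borel_measurable borel"
    unfolding power_log_def by measurable
  ultimately show ?thesis unfolding main_term_def
    using laplace_power_log[OF \<beta>(1)] by auto
qed

subsection \<open>Laplace transforms of slowly decreasing functions\<close>

lemma slowly_decreasing_real_at_top:
  assumes "slowly_decreasing_real r" shows "slowly_decreasing_at_top r"
  unfolding slowly_decreasing_at_top_def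
proof (intro allI impI)
  fix \<epsilon> :: real assume "\<epsilon> > 0"
  then obtain \<delta> where \<delta>: "\<delta> > 0" "Liminf at_top (\<lambda>x. INF h\<in>{0..\<delta>}. ereal (r (x + h) - r x)) > - ereal \<epsilon>"
    using assms unfolding slowly_decreasing_real_def by blast
  have "\<forall>\<^sub>F x in at_top. - ereal \<epsilon> < (INF h\<in>{0..\<delta>}. ereal (r (x + h) - r x))"
    by (rule less_LiminfD[OF \<delta>(2)])
  then obtain X where X: "\<And>x. x \<ge> X \<Longrightarrow> - ereal \<epsilon> < (INF h\<in>{0..\<delta>}. ereal (r (x + h) - r x))"
    by (auto simp: eventually_at_top_linorder)
  have "r (x + u) - r x \<ge> - \<epsilon>" if "x \<ge> X" "u \<in> {0..\<delta>}" for x u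
  proof -
    have "- ereal \<epsilon> < ereal (r (x + u) - r x)"
      by (rule less_le_trans[OF X[OF that(1)] INF_lower[OF that(2)]])
    then show ?thesis by simp
  qed
  then show "\<exists>\<delta>>0. \<exists>X. \<forall>x\<ge>X. \<forall>u\<in>{0..\<delta>}. - \<epsilon> \<le> r (x + u) - r x" using \<delta>(1) by blast
qed

lemma measurable_of_locally_integrable:
  fixes f :: "real \<Rightarrow> complex"
  assumes "\<forall>a b. f absolutely_integrable_on {a..b}"
  shows "f \<in> borel_measurable lebesgue"
proof (rule borel_measurable_LIMSEQ_metric)
  show "(\<lambda>x. indicator {-real n..real n} x *\<^sub>R f x) \<in> borel_measurable lebesgue" for n
  proof -
    have "f absolutely_integrable_on {-real n..real n}" using assms by blast
    then have "integrable lebesgue (\<lambda>x. indicator {-real n..real n} x *\<^sub>R f x)" by (simp only: set_integrable_def)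
    then show ?thesis by (rule borel_measurable_integrable)
  qed
  show "(\<lambda>n. indicator {-real n..real n} x *\<^sub>R f x) \<longlonglongrightarrow> f x" for x
  proof (rule tendsto_eventually)
    show "\<forall>\<^sub>F n in sequentially. indicator {-real n..real n} x *\<^sub>R f x = f x"
      using eventually_ge_at_top[of "nat \<lceil>\<bar>x\<bar>\<rceil>"]
    proof eventually_elim
      case (elim n)
      then have "x \<in> {-real n..real n}" by (simp add: nat_le_iff ceiling_le_iff abs_le_iff)
      then show ?case by simp
    qed
  qed
qed

lemma integrable_linear_exp:
  assumes "\<sigma> > 0"
  shows "integrable lborel (\<lambda>x::real. indicator {0<..} x * ((1 + x) * exp (- (\<sigma> * x))))"
proof -
  have "integrable lborel (\<lambda>x. norm (mellin_kernel 1 (of_real \<sigma>) x) + norm (mellin_kernel 2 (of_real \<sigma>) x))"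
    using assms by (intro Bochner_Integration.integrable_add integrable_norm mellin_kernel_integrable) auto
  also have "(\<lambda>x. norm (mellin_kernel 1 (of_real \<sigma>) x) + norm (mellin_kernel 2 (of_real \<sigma>) x)) = (\<lambda>x. indicator {0<..} x * ((1 + x) * exp (- (\<sigma> * x))))"
  proof
    fix x :: real
    show "norm (mellin_kernel 1 (of_real \<sigma>) x) + norm (mellin_kernel 2 (of_real \<sigma>) x) = indicator {0<..} x * ((1 + x) * exp (- (\<sigma> * x)))"
    proof (cases "x > 0")
      case True
      then have "exp (ln x - \<sigma> * x) = x * exp (- (\<sigma> * x))" by (simp add: exp_diff exp_minus divide_inverse)
      then show ?thesis using True by (simp add: mellin_kernel_def norm_exp_eq_Re distrib_right)
    qed (simp add: mellin_kernel_def)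
  qed
  finally show ?thesis .
qed

text \<open>For a function bounded below by an integrable one, convergence of the integrals over
  {0..n} already means integrability. Slow decrease supplies a linear lower bound, which is
  integrable against exp(- \<sigma> x); so the improper transform converges absolutely.\<close>

lemma integrable_of_convergent_transform:
  fixes r :: "real \<Rightarrow> real"
  assumes r: "r \<in> borel_measurable lebesgue" "\<And>x. x < 0 \<Longrightarrow> r x = 0"
    and loc: "\<And>b. integrable lebesgue (\<lambda>x. indicator {0..b} x * r x)"
    and slow: "slowly_decreasing_at_top r" and \<sigma>: "\<sigma> > 0"
    and lim: "(\<lambda>n. LINT x|lebesgue. indicator {0..real n} x * (r x * exp (- (\<sigma> * x)))) \<longlonglongrightarrow> l"
  shows "integrable lebesgue (\<lambda>x. r x * exp (- (\<sigma> * x)))"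
proof -
  obtain C X0 where C: "C \<ge> 0" "X0 \<ge> 0" "\<And>x u. x \<ge> X0 \<Longrightarrow> u \<ge> 0 \<Longrightarrow> r (x + u) - r x \<ge> - C * (1 + u)"
    using slowly_decreasing_linear[OF slow] by metis
  \<comment> \<open>The added 1 makes X positive, so that {X..} lies inside {0<..}, the domain of
    \<open>integrable_linear_exp\<close>.\<close>
  define X where "X = X0 + 1"
  have X: "X > 0" "X \<ge> X0" using C by (auto simp: X_def)
  define D where "D = C + \<bar>r X\<bar>"
  have D: "D \<ge> 0" using C by (simp add: D_def)
  have low: "r x + D * (1 + x) \<ge> 0" if "x \<ge> X" for x
  proof -
    have "r x \<ge> r X - C * (1 + (x - X))" using C(3)[of X "x - X"] that X by simp
    moreover have "C * (1 + (x - X)) \<le> C * (1 + x)" using C X by (intro mult_left_mono) auto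
    moreover have "\<bar>r X\<bar> * 1 \<le> \<bar>r X\<bar> * (1 + x)" using that X by (intro mult_left_mono) auto
    ultimately show ?thesis by (simp add: D_def algebra_simps)
  qed
  let ?e = "\<lambda>x. exp (- (\<sigma> * x))"
  have idm: "(\<lambda>x. x) \<in> borel_measurable (lebesgue :: real measure)" 
    using id_borel_measurable_lebesgue by (simp add: id_def)
  have em: "?e \<in> borel_measurable lebesgue" by (intro borel_measurable_lebesgueI) measurable
  define p where "p x = indicator {X..} x * ((r x + D * (1 + x)) * ?e x)" for x
  define s where "s x = indicator {0..X} x * r x * (indicator {..<X} x * ?e x) - indicator {X..} x * (D * ((1 + x) * ?e x))" for x
  have rps: "r x * ?e x = p x + s x" for x
    using r(2)[of x] X by (auto simp: p_def s_def indicator_def algebra_simps)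
  have p0: "p x \<ge> 0" for x using low[of x] by (simp add: p_def indicator_def)
  have pm: "p \<in> borel_measurable lebesgue" unfolding p_def[abs_def]
    by (intro borel_measurable_times borel_measurable_add borel_measurable_indicator r borel_measurable_const idm em) auto
  have "integrable lebesgue (\<lambda>x. indicator {0..X} x * r x * (indicator {..<X} x * ?e x))"
  proof -
    have "integrable lebesgue (\<lambda>x. indicator {0..X} x * r x * (indicator {0..<X} x * ?e x))"
    proof (rule integrable_mult_bounded[OF loc])
      show "(\<lambda>x. indicator {0..<X} x * ?e x) \<in> borel_measurable lebesgue"
        by (intro borel_measurable_times borel_measurable_indicator em) auto
      show "norm (indicator {0..<X} x * ?e x) \<le> 1" for x
        using \<sigma> by (auto simp: indicator_def)
    qed
    then show ?thesis by (rule Bochner_Integration.integrable_cong[THEN iffD1, rotated 2]) (auto simp: indicator_def)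
  qed
  moreover have "integrable lebesgue (\<lambda>x. indicator {X..} x * (D * ((1 + x) * ?e x)))"
  proof -
    have "integrable lebesgue (\<lambda>x::real. indicator {0<..} x * ((1 + x) * ?e x))"
      using integrable_linear_exp[OF \<sigma>] by (subst integrable_completion) measurable
    from integrable_mult_right[OF integrable_mult_indicator[OF _ this, of "{X..}"], of D]
    show ?thesis by (rule Bochner_Integration.integrable_cong[THEN iffD1, rotated 2]) (use X in \<open>auto simp: indicator_def\<close>)
  qed
  ultimately have si: "integrable lebesgue s" unfolding s_def[abs_def] by (rule Bochner_Integration.integrable_diff)
  let ?I = "\<lambda>n x. indicator {0..real n} x :: real"
  have ilim: "(\<lambda>n. ?I n x * f x) \<longlonglongrightarrow> f x" if "x \<ge> 0" for x and f :: "real \<Rightarrow> real"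
  proof (rule tendsto_eventually)
    show "\<forall>\<^sub>F n in sequentially. ?I n x * f x = f x"
      using eventually_ge_at_top[of "nat \<lceil>x\<rceil>"]
    proof eventually_elim
      case (elim n)
      then have "x \<le> real n" by linarith
      then show ?case using that by simp
    qed
  qed
  have sneg: "s x = 0" and pneg: "p x = 0" if "x < 0" for x using that X by (auto simp: s_def p_def)
  have si_n: "integrable lebesgue (\<lambda>x. ?I n x * s x)" for n
    using integrable_mult_indicator[OF _ si, of "{0..real n}"] by simp
  have ri_n: "integrable lebesgue (\<lambda>x. ?I n x * (r x * ?e x))" for n
  proof -
    have "integrable lebesgue (\<lambda>x. indicator {0..real n} x * r x * (indicator {0..real n} x * ?e x))"
    proof (rule integrable_mult_bounded[OF loc])
      show "(\<lambda>x. indicator {0..real n} x * ?e x) \<in> borel_measurable lebesgue"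
        by (intro borel_measurable_times borel_measurable_indicator em) auto
      show "norm (indicator {0..real n} x * ?e x) \<le> 1" for x
        using \<sigma> by (auto simp: indicator_def)
    qed
    then show ?thesis by (rule Bochner_Integration.integrable_cong[THEN iffD1, rotated 2]) (auto simp: indicator_def)
  qed
  have s_lim: "(\<lambda>n. LINT x|lebesgue. ?I n x * s x) \<longlonglongrightarrow> (LINT x|lebesgue. s x)"
  proof (rule integral_dominated_convergence[where w = "\<lambda>x. norm (s x)"])
    show "AE x in lebesgue. (\<lambda>n. ?I n x * s x) \<longlonglongrightarrow> s x"
    proof (intro AE_I2)
      fix x :: real
      show "(\<lambda>n. ?I n x * s x) \<longlonglongrightarrow> s x" by (cases "x < 0") (auto simp: sneg intro!: ilim)
    qed
    show "AE x in lebesgue. norm (?I n x * s x) \<le> norm (s x)" for n by (intro AE_I2) (auto simp: indicator_def)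
    show "s \<in> borel_measurable lebesgue" using si by auto
    show "(\<lambda>x. ?I n x * s x) \<in> borel_measurable lebesgue" for n using si_n[of n] by auto
  qed (use si in auto)
  have p_eq: "?I n x * p x = ?I n x * (r x * ?e x) - ?I n x * s x" for n x by (simp add: rps algebra_simps)
  have pi_n: "integrable lebesgue (\<lambda>x. ?I n x * p x)" for n
    unfolding p_eq by (intro Bochner_Integration.integrable_diff ri_n si_n)
  have p_lim: "(\<lambda>n. LINT x|lebesgue. ?I n x * p x) \<longlonglongrightarrow> l - (LINT x|lebesgue. s x)"
    unfolding p_eq Bochner_Integration.integral_diff[OF ri_n si_n] by (intro tendsto_diff lim s_lim)
  have "integrable lebesgue p"
  proof (rule integrable_monotone_convergence[OF pi_n _ _ p_lim pm])
    show "AE x in lebesgue. mono (\<lambda>n. ?I n x * p x)"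
      by (intro AE_I2 monoI mult_right_mono p0) (auto simp: indicator_def)
    show "AE x in lebesgue. (\<lambda>n. ?I n x * p x) \<longlonglongrightarrow> p x"
    proof (intro AE_I2)
      fix x :: real
      show "(\<lambda>n. ?I n x * p x) \<longlonglongrightarrow> p x" by (cases "x < 0") (auto simp: pneg intro!: ilim)
    qed
  qed
  then show ?thesis unfolding rps using si by (rule Bochner_Integration.integrable_add)
qed

lemma set_integrable_exp_mult:
  fixes \<tau> :: "real \<Rightarrow> complex"
  assumes "\<tau> absolutely_integrable_on {a..b}"
  shows "integrable lebesgue (\<lambda>x. indicator {a..b} x *\<^sub>R (\<tau> x * exp (z * of_real x)))"
proof -
  have c: "continuous_on {a..b} (\<lambda>x. exp (z * of_real x))" by (intro continuous_intros)
  then have "bounded ((\<lambda>x. exp (z * of_real x)) ` {a..b})" by (intro compact_imp_bounded compact_continuous_image) auto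
  then obtain B where B: "\<forall>x\<in>{a..b}. norm (exp (z * of_real x)) \<le> B" unfolding bounded_iff by auto
  have i: "integrable lebesgue (\<lambda>x. indicator {a..b} x *\<^sub>R \<tau> x)" using assms by (simp only: set_integrable_def)
  have "integrable lebesgue (\<lambda>x. indicator {a..b} x *\<^sub>R \<tau> x * (indicator {a..b} x *\<^sub>R exp (z * of_real x)))"
  proof (rule integrable_mult_bounded[OF i])
    show "(\<lambda>x. indicator {a..b} x *\<^sub>R exp (z * of_real x)) \<in> borel_measurable lebesgue"
      by (intro borel_measurable_scaleR borel_measurable_indicator borel_measurable_lebesgueI borel_measurable_continuous_onI continuous_intros) auto
    show "norm (indicator {a..b} x *\<^sub>R exp (z * of_real x)) \<le> max B 0" for x using B by (auto simp: indicator_def intro: max.coboundedI1)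
  qed
  then show ?thesis by (rule Bochner_Integration.integrable_cong[THEN iffD1, rotated 2]) (auto simp: indicator_def)
qed

lemma laplace_trunc_eq:
  fixes \<tau> :: "real \<Rightarrow> complex"
  assumes "\<forall>a b. \<tau> absolutely_integrable_on {a..b}"
  shows "laplace_trunc \<tau> s T = (LINT x|lebesgue. indicator {0..T} x *\<^sub>R (\<tau> x * exp (- s * of_real x)))"
proof -
  have "set_integrable lebesgue {0..T} (\<lambda>x. \<tau> x * exp (- s * of_real x))"
    unfolding set_integrable_def by (rule set_integrable_exp_mult) (use assms in blast)
  from set_lebesgue_integral_eq_integral(2)[OF this] show ?thesis
    unfolding laplace_trunc_def set_lebesgue_integral_def by simp
qed

text \<open>Absolute convergence depends on Re s alone, so it is proved at real \<sigma> for the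
  real and imaginary parts. Dominated convergence then identifies the limit defining
  \<open>laplace\<close> with a Lebesgue integral.\<close>

lemma laplace_absolutely_convergent:
  fixes \<tau> :: "real \<Rightarrow> complex"
  assumes loc: "\<forall>a b. \<tau> absolutely_integrable_on {a..b}"
    and slow: "slowly_decreasing \<tau>" and vanish: "\<forall>x<0. \<tau> x = 0"
    and lap: "\<forall>s. Re s > 0 \<longrightarrow> laplace_converges \<tau> s" and s: "Re s > 0"
  shows "integrable lebesgue (\<lambda>x. \<tau> x * exp (- s * of_real x))"
    and "laplace \<tau> s = (LINT x|lebesgue. \<tau> x * exp (- s * of_real x))"
proof -
  have m: "\<tau> \<in> borel_measurable lebesgue" by (rule measurable_of_locally_integrable[OF loc])
  define \<sigma> where "\<sigma> = Re s"
  have \<sigma>: "\<sigma> > 0" using s by (simp add: \<sigma>_def)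
  have "laplace_converges \<tau> (of_real \<sigma>)" using lap \<sigma> by simp
  then obtain l where "(laplace_trunc \<tau> (of_real \<sigma>) \<longlongrightarrow> l) at_top" unfolding laplace_converges_def by blast
  then have lim: "(\<lambda>n. laplace_trunc \<tau> (of_real \<sigma>) (real n)) \<longlonglongrightarrow> l"
    by (rule filterlim_compose) (rule filterlim_real_sequentially)
  have part: "integrable lebesgue (\<lambda>x. p (\<tau> x) * exp (- (\<sigma> * x)))" if p: "p = Re \<or> p = Im" for p
  proof (rule integrable_of_convergent_transform[OF _ _ _ _ \<sigma>])
    show "(\<lambda>x. p (\<tau> x)) \<in> borel_measurable lebesgue" using p borel_measurable_ReIm[OF m] by auto
    show "p (\<tau> x) = 0" if "x < 0" for x using vanish that p by auto
    have p_int: "integrable lebesgue (\<lambda>x. p (f x))" "(LINT x|lebesgue. p (f x)) = p (LINT x|lebesgue. f x)" 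
      if "integrable lebesgue f" for f :: "real \<Rightarrow> complex" 
      using p that by auto
    have p_ind: "p (indicator S x *\<^sub>R z) = indicator S x * p z" for S and x :: real and z using p by auto
    have p_exp: "p (z * exp (- of_real \<sigma> * of_real x)) = p z * exp (- (\<sigma> * x))" for z x
    proof -
      have "exp (- of_real \<sigma> * of_real x) = complex_of_real (exp (- (\<sigma> * x)))" by (simp add: exp_of_real[symmetric])
      then show ?thesis using p by auto
    qed
    show "integrable lebesgue (\<lambda>x. indicator {0..b} x * p (\<tau> x))" for b
    proof -
      have "\<tau> absolutely_integrable_on {0..b}" using loc by blast
      then have "integrable lebesgue (\<lambda>x. indicator {0..b} x *\<^sub>R \<tau> x)" by (simp only: set_integrable_def)
      from p_int(1)[OF this] show ?thesis by (simp only: p_ind)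
    qed
    show "slowly_decreasing_at_top (\<lambda>x. p (\<tau> x))"
      using slow p slowly_decreasing_real_at_top unfolding slowly_decreasing_def by auto
    have "(\<lambda>n. p (laplace_trunc \<tau> (of_real \<sigma>) (real n))) \<longlonglongrightarrow> p l"
      using p tendsto_Re[OF lim] tendsto_Im[OF lim] by auto
    also have "(\<lambda>n. p (laplace_trunc \<tau> (of_real \<sigma>) (real n))) = 
       (\<lambda>n. LINT x|lebesgue. indicator {0..real n} x * (p (\<tau> x) * exp (- (\<sigma> * x))))"
    proof
      fix n
      have "\<tau> absolutely_integrable_on {0..real n}" using loc by blast
      from p_int(2)[OF set_integrable_exp_mult[OF this, of "- of_real \<sigma>"]]
      show "p (laplace_trunc \<tau> (of_real \<sigma>) (real n)) = (LINT x|lebesgue. indicator {0..real n} x * (p (\<tau> x) * exp (- (\<sigma> * x))))"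
        unfolding laplace_trunc_eq[OF loc] by (simp only: p_ind p_exp)
    qed
    finally show "(\<lambda>n. LINT x|lebesgue. indicator {0..real n} x * (p (\<tau> x) * exp (- (\<sigma> * x)))) \<longlonglongrightarrow> p l" .
  qed
  show int: "integrable lebesgue (\<lambda>x. \<tau> x * exp (- s * of_real x))"
  proof (rule Bochner_Integration.integrable_bound)
    show "integrable lebesgue (\<lambda>x. norm (Re (\<tau> x) * exp (- (\<sigma> * x))) + norm (Im (\<tau> x) * exp (- (\<sigma> * x))))"
      by (intro Bochner_Integration.integrable_add integrable_norm part) auto
    show "(\<lambda>x. \<tau> x * exp (- s * of_real x)) \<in> borel_measurable lebesgue"
      by (intro borel_measurable_times m borel_measurable_lebesgueI borel_measurable_continuous_onI continuous_intros)
    show "AE x in lebesgue. norm (\<tau> x * exp (- s * of_real x)) \<le> norm (norm (Re (\<tau> x) * exp (- (\<sigma> * x))) + norm (Im (\<tau> x) * exp (- (\<sigma> * x))))"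
    proof (intro AE_I2)
      fix x
      have "norm (\<tau> x * exp (- s * of_real x)) = norm (\<tau> x) * exp (- (\<sigma> * x))"
        by (simp add: norm_mult norm_exp_eq_Re \<sigma>_def)
      also have "\<dots> \<le> (\<bar>Re (\<tau> x)\<bar> + \<bar>Im (\<tau> x)\<bar>) * exp (- (\<sigma> * x))" by (intro mult_right_mono cmod_le) auto
      finally show "norm (\<tau> x * exp (- s * of_real x)) \<le> norm (norm (Re (\<tau> x) * exp (- (\<sigma> * x))) + norm (Im (\<tau> x) * exp (- (\<sigma> * x))))"
        by (simp add: abs_mult distrib_right)
    qed
  qed
  have "((\<lambda>T. LINT x|lebesgue. indicator {0..T} x *\<^sub>R (\<tau> x * exp (- s * of_real x))) \<longlongrightarrow> (LINT x|lebesgue. \<tau> x * exp (- s * of_real x))) at_top"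
  proof (rule integral_dominated_convergence_at_top[where w = "\<lambda>x. norm (\<tau> x * exp (- s * of_real x))"])
    show "AE x in lebesgue. ((\<lambda>T. indicator {0..T} x *\<^sub>R (\<tau> x * exp (- s * of_real x))) \<longlongrightarrow> \<tau> x * exp (- s * of_real x)) at_top"
    proof (intro AE_I2 tendsto_eventually)
      fix x :: real
      show "\<forall>\<^sub>F T in at_top. indicator {0..T} x *\<^sub>R (\<tau> x * exp (- s * of_real x)) = \<tau> x * exp (- s * of_real x)"
        using eventually_ge_at_top[of x] by eventually_elim (use vanish in \<open>auto simp: indicator_def not_le\<close>)
    qed
    show "\<forall>\<^sub>F T in at_top. AE x in lebesgue. norm (indicator {0..T} x *\<^sub>R (\<tau> x * exp (- s * of_real x))) \<le> norm (\<tau> x * exp (- s * of_real x))"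
      by (intro always_eventually allI AE_I2) (auto simp: indicator_def)
    show "(\<lambda>x. indicator {0..T} x *\<^sub>R (\<tau> x * exp (- s * of_real x))) \<in> borel_measurable lebesgue" for T
      using int by (intro borel_measurable_scaleR borel_measurable_indicator borel_measurable_integrable) auto
  qed (use int in auto)
  then show "laplace \<tau> s = (LINT x|lebesgue. \<tau> x * exp (- s * of_real x))"
    unfolding laplace_def laplace_trunc_eq[OF loc] by (intro tendsto_Lim) auto
qed

text \<open>The integrand has the bounded primitive e^(i(t-u)y) / (i(t-u)). At u = t the integral
  would be x itself; this is why the frequencies t_n must avoid E.\<close>

lemma partial_transform_exp_bounded:
  assumes "t \<noteq> u"
  shows "\<exists>M. \<forall>x>0. norm (partial_transform (\<lambda>x. if 0 < x then exp (\<i> * of_real (t * x)) else 0) u x) \<le> M"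
proof (intro exI allI impI)
  fix x :: real assume x: "x > 0"
  define c where "c = \<i> * complex_of_real (t - u)"
  have c: "c \<noteq> 0" using assms by (simp add: c_def)
  have cexp: "exp (\<i> * of_real (t * y)) * exp (- (\<i> * of_real (u * y))) = exp (c * of_real y)" for y
    by (simp add: c_def mult_exp_exp algebra_simps)
  have d: "((\<lambda>y. exp (c * of_real y) / c) has_vector_derivative exp (c * of_real y)) (at y within {0..x})" for y
  proof -
    have "((\<lambda>z. exp (c * z) / c) has_field_derivative exp (c * of_real y)) (at (of_real y))"
      using c by (auto intro!: derivative_eq_intros)
    from has_vector_derivative_real_field[OF this] show ?thesis .
  qed
  have "(LINT y|lborel. indicator {0..x} y *\<^sub>R exp (c * of_real y)) = exp (c * of_real x) / c - exp (c * of_real 0) / c"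
    using x d by (intro integral_FTC_Icc) (auto intro!: continuous_intros)
  moreover have "partial_transform (\<lambda>x. if 0 < x then exp (\<i> * of_real (t * x)) else 0) u x = (LINT y|lborel. indicator {0..x} y *\<^sub>R exp (c * of_real y))"
  proof -
    have "partial_transform (\<lambda>x. if 0 < x then exp (\<i> * of_real (t * x)) else 0) u x = 
      (LINT y|lborel. indicator {0..x} y *\<^sub>R ((if 0 < y then exp (\<i> * of_real (t * y)) else 0) * exp (- (\<i> * of_real (u * y)))))"
      unfolding partial_transform_def by (rule integral_completion) measurable
    also have "\<dots> = (LINT y|lborel. indicator {0..x} y *\<^sub>R exp (c * of_real y))"
    proof (rule integral_cong_AE)
      have "AE y in lborel. y \<noteq> (0::real)" by (rule AE_lborel_singleton)
      then show "AE y in lborel. indicator {0..x} y *\<^sub>R ((if 0 < y then exp (\<i> * of_real (t * y)) else 0) * exp (- (\<i> * of_real (u * y)))) = indicator {0..x} y *\<^sub>R exp (c * of_real y)"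
        by (rule AE_mp) (auto simp: indicator_def cexp simp del: of_real_mult intro!: AE_I2)
    qed measurable
    finally show ?thesis .
  qed
  moreover have "norm (exp (c * of_real x) / c - exp (c * of_real 0) / c) \<le> 2 / norm c"
  proof -
    have "norm (exp (c * of_real x)) = 1" by (simp add: c_def norm_exp_eq_Re)
    then have "norm (exp (c * of_real x) - 1) \<le> 2" 
      using norm_triangle_ineq4[of "exp (c * of_real x)" 1] by (simp only: norm_one)
    then show ?thesis by (simp add: diff_divide_distrib[symmetric] norm_divide divide_right_mono)
  qed
  ultimately show "norm (partial_transform (\<lambda>x. if 0 < x then exp (\<i> * of_real (t * x)) else 0) u x) \<le> 2 / norm c" by simp
qed

text \<open>Uniform continuity of \<open>m\<close> at infinity preserves slow decrease, and both
  transforms converge absolutely, so the difference is a legitimate input for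
  \<open>tauberian_singular_set\<close>.\<close>

lemma tauberian_main_term:
  fixes \<tau> :: "real \<Rightarrow> complex"
  assumes loc: "\<forall>a b. \<tau> absolutely_integrable_on {a..b}"
    and slow: "slowly_decreasing \<tau>" and vanish: "\<forall>x<0. \<tau> x = 0"
    and lap: "\<forall>s. Re s > 0 \<longrightarrow> laplace_converges \<tau> s"
    and m: "main_term m L"
    and F: "\<And>s. F s = laplace \<tau> s - L s"
    and bb: "local_pseudofunction_bb F (- E)" and E: "closed E" "E \<in> null_sets lborel"
    and bd: "\<And>u. u \<in> E \<Longrightarrow> \<exists>M. \<forall>x>0. norm (partial_transform (\<lambda>x. \<tau> x - m x) u x) \<le> M"
  shows "((\<lambda>x. \<tau> x - m x) \<longlongrightarrow> 0) at_top"
proof (rule tauberian_singular_set[OF _ _ _ _ bb E bd])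
  have mm: "m \<in> borel_measurable borel" and m0: "\<And>x. x \<le> 0 \<Longrightarrow> m x = 0" and mu: "uniformly_continuous_at_top m"
    and mi: "\<And>s. Re s > 0 \<Longrightarrow> integrable lborel (\<lambda>x. m x * exp (- s * of_real x))"
    and mv: "\<And>s. Re s > 0 \<Longrightarrow> (LINT x|lborel. m x * exp (- s * of_real x)) = L s"
    using m unfolding main_term_def by auto
  have meas: "(\<lambda>x. m x * exp (- s * of_real x)) \<in> borel_measurable lborel" for s
    using mm by measurable
  have mi': "integrable lebesgue (\<lambda>x. m x * exp (- s * of_real x))" if "Re s > 0" for s
    using mi[OF that] meas by (subst integrable_completion)
  have mv': "(LINT x|lebesgue. m x * exp (- s * of_real x)) = L s" if "Re s > 0" for s
    using mv[OF that] meas by (subst integral_completion)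
  have \<tau>m: "\<tau> \<in> borel_measurable lebesgue" by (rule measurable_of_locally_integrable[OF loc])
  note la = laplace_absolutely_convergent[OF loc slow vanish lap]
  have i: "integrable lebesgue (\<lambda>x. (\<tau> x - m x) * exp (- s * of_real x))" if "Re s > 0" for s
    unfolding left_diff_distrib by (intro Bochner_Integration.integrable_diff la mi' that)
  show "(\<lambda>x. \<tau> x - m x) \<in> borel_measurable lebesgue"
    by (intro borel_measurable_diff \<tau>m borel_measurable_lebesgueI mm)
  show "\<tau> x - m x = 0" if "x < 0" for x using vanish m0[of x] that by simp
  show "integrable lebesgue (\<lambda>x. (\<tau> x - m x) * exp (- of_real (\<sigma> * x)))" if "\<sigma> > 0" for \<sigma>
    using i[of "of_real \<sigma>"] that by simp
  show "F s = (LINT x|lebesgue. (\<tau> x - m x) * exp (- s * of_real x))" if "Re s > 0" for s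
    unfolding left_diff_distrib Bochner_Integration.integral_diff[OF la(1)[OF that] mi'[OF that]] F la(2)[OF that] mv'[OF that] ..
  show "slowly_decreasing_at_top (\<lambda>x. Re (\<tau> x - m x))" "slowly_decreasing_at_top (\<lambda>x. Im (\<tau> x - m x))"
    using slow slowly_decreasing_diff[OF _ mu] slowly_decreasing_real_at_top unfolding slowly_decreasing_def by blast+
qed

lemma partial_transform_exp_sum_bounded:
  assumes "\<And>n. n \<in> I \<Longrightarrow> t n \<noteq> u" "finite I"
  shows "\<exists>M. \<forall>x>0. norm (partial_transform (\<lambda>x. \<Sum>n\<in>I. b n * (if 0 < x then exp (\<i> * of_real (t n * x)) else 0)) u x) \<le> M"
proof -
  let ?e = "\<lambda>n x. if 0 < x then exp (\<i> * complex_of_real (t n * x)) else 0"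
  have "\<forall>n\<in>I. \<exists>M. \<forall>x>0. norm (partial_transform (?e n) u x) \<le> M"
    using partial_transform_exp_bounded assms(1) by blast
  then obtain M where M: "\<And>n x. n \<in> I \<Longrightarrow> x > 0 \<Longrightarrow> norm (partial_transform (?e n) u x) \<le> M n" by metis
  have "norm (partial_transform (\<lambda>x. \<Sum>n\<in>I. b n * ?e n x) u x) \<le> (\<Sum>n\<in>I. norm (b n) * M n)" if x: "x > 0" for x
  proof -
    have int: "integrable lebesgue (\<lambda>y. indicator {0..x} y *\<^sub>R (?e n y * exp (- (\<i> * of_real (u * y)))))" for n
    proof (rule Bochner_Integration.integrable_bound)
      show "integrable lebesgue (\<lambda>y. indicator {0..x} y :: real)" by (rule integrable_indicator_Icc)
      show "(\<lambda>y. indicator {0..x} y *\<^sub>R (?e n y * exp (- (\<i> * of_real (u * y))))) \<in> borel_measurable lebesgue"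
        by (intro borel_measurable_lebesgueI) measurable
    qed (auto simp: indicator_def norm_mult norm_exp_imaginary simp del: of_real_mult)
    have "partial_transform (\<lambda>x. \<Sum>n\<in>I. b n * ?e n x) u x = 
      (LINT y|lebesgue. (\<Sum>n\<in>I. b n * (indicator {0..x} y *\<^sub>R (?e n y * exp (- (\<i> * of_real (u * y)))))))"
      unfolding partial_transform_def sum_distrib_right scaleR_sum_right
      by (intro Bochner_Integration.integral_cong sum.cong refl) (simp add: scaleR_conv_of_real mult_ac)
    also have "\<dots> = (\<Sum>n\<in>I. b n * partial_transform (?e n) u x)"
      unfolding partial_transform_def
      by (subst Bochner_Integration.integral_sum) (intro integrable_mult_right int, simp only: integral_mult_right_zero)
    also have "norm \<dots> \<le> (\<Sum>n\<in>I. norm (b n) * M n)"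
      using M[OF _ x] by (intro sum_norm_le) (auto simp: norm_mult intro!: mult_left_mono)
    finally show ?thesis .
  qed
  then show ?thesis by blast
qed

lemma partial_transform_diff_bounded:
  fixes \<tau> :: "real \<Rightarrow> complex"
  assumes loc: "\<forall>a b. \<tau> absolutely_integrable_on {a..b}"
    and \<tau>: "\<forall>x>0. norm (integral {0..x} (\<lambda>y. \<tau> y * exp (- \<i> * of_real (u * y)))) < M"
    and m: "m \<in> borel_measurable borel" "\<And>x. norm (m x) \<le> B" 
    and mb: "\<forall>x>0. norm (partial_transform m u x) \<le> M'"
  shows "\<forall>x>0. norm (partial_transform (\<lambda>x. \<tau> x - m x) u x) \<le> M + M'"
proof (intro allI impI)
  fix x :: real assume x: "x > 0"
  let ?e = "\<lambda>y. exp (- (\<i> * complex_of_real (u * y)))"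
  \<comment> \<open>Hypothesis (II) concerns the truncated transform at the boundary point s = iu,
    so \<open>laplace_trunc_eq\<close> converts its gauge integral to a Lebesgue integral.\<close>
  have tr: "laplace_trunc \<tau> (\<i> * of_real u) x = integral {0..x} (\<lambda>y. \<tau> y * exp (- \<i> * of_real (u * y)))"
    unfolding laplace_trunc_def by (simp add: mult.assoc)
  have pt: "partial_transform \<tau> u x = laplace_trunc \<tau> (\<i> * of_real u) x"
    unfolding laplace_trunc_eq[OF loc] partial_transform_def by (simp add: mult.assoc)
  have "\<tau> absolutely_integrable_on {0..x}" using loc by blast
  from set_integrable_exp_mult[OF this, of "- (\<i> * of_real u)"]
  have i1: "integrable lebesgue (\<lambda>y. indicator {0..x} y *\<^sub>R (\<tau> y * ?e y))" by (simp add: mult.assoc)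
  have i2: "integrable lebesgue (\<lambda>y. indicator {0..x} y *\<^sub>R (m y * ?e y))"
  proof (rule Bochner_Integration.integrable_bound)
    show "integrable lebesgue (\<lambda>y. B * indicator {0..x} y :: real)" by (intro integrable_mult_right integrable_indicator_Icc)
    show "(\<lambda>y. indicator {0..x} y *\<^sub>R (m y * ?e y)) \<in> borel_measurable lebesgue"
      by (intro borel_measurable_lebesgueI borel_measurable_scaleR borel_measurable_indicator borel_measurable_times m(1)
          borel_measurable_continuous_onI continuous_intros) auto
    show "AE y in lebesgue. norm (indicator {0..x} y *\<^sub>R (m y * ?e y)) \<le> norm (B * indicator {0..x} y)"
    proof (intro AE_I2)
      fix y
      have "norm (m y * ?e y) \<le> \<bar>B\<bar>" using m(2)[of y] by (simp add: norm_mult norm_exp_imaginary del: of_real_mult)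
      then show "norm (indicator {0..x} y *\<^sub>R (m y * ?e y)) \<le> norm (B * indicator {0..x} y)" by (simp add: indicator_def)
    qed
  qed
  have "partial_transform (\<lambda>x. \<tau> x - m x) u x = partial_transform \<tau> u x - partial_transform m u x"
    unfolding partial_transform_def left_diff_distrib scaleR_diff_right by (rule Bochner_Integration.integral_diff[OF i1 i2])
  moreover have "norm (partial_transform \<tau> u x) < M" unfolding pt tr using \<tau> x by blast
  moreover have "norm (partial_transform m u x) \<le> M'" using mb x by blast
  ultimately show "norm (partial_transform (\<lambda>x. \<tau> x - m x) u x) \<le> M + M'"
    using norm_triangle_ineq4[of "partial_transform \<tau> u x" "partial_transform m u x"] by simp
qed

section \<open>Assembly of the two statements\<close>

text \<open>The terms with coefficient \<open>c n\<close> are the case without logarithm, where D_0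
  = 1 / Gamma; so \<open>power_log\<close> covers both kinds of singularity at s = 0.\<close>

lemma power_log_0: "c * power_log 0 \<beta> x = of_real (x powr \<beta>) * (c / of_real (Gamma (\<beta> + 1)))"
  by (simp add: power_log_def Dj_def rGamma_inverse_Gamma divide_inverse)

theorem theorem1p3:
  fixes \<tau> :: "real \<Rightarrow> complex"
    and m :: nat and \<beta> :: "nat \<Rightarrow> real" and k :: "nat \<Rightarrow> nat"
  assumes loc_int: "\<forall>a b. \<tau> absolutely_integrable_on {a..b}"
    and slow: "slowly_decreasing \<tau>"
    and vanish: "\<forall>x<0. \<tau> x = 0"
    and lap: "\<forall>s. Re s > 0 \<longrightarrow> laplace_converges \<tau> s"
    and beta_mono: "\<forall>i j. 1 \<le> i \<longrightarrow> i \<le> j \<longrightarrow> j \<le> m \<longrightarrow> \<beta> i \<le> \<beta> j"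
    and beta_range: "\<forall>n\<in>{1..m}. 0 \<le> \<beta> n \<and> \<beta> n < 1"
  shows
    "(\<forall>(a::complex) (N::nat) (b::nat \<Rightarrow> complex) (t::nat \<Rightarrow> real) (c::nat \<Rightarrow> complex) (d::nat \<Rightarrow> complex).
        local_pseudofunction_bb
          (\<lambda>s. laplace \<tau> s - a / s\<^sup>2 - (\<Sum>n=1..N. b n / (s - \<i> * of_real (t n)))
               - (\<Sum>n=1..m. (c n + d n * (Ln (1 / s)) ^ k n) / s powr (of_real (\<beta> n + 1))))
          UNIV
        \<longrightarrow>
        ((\<lambda>x. \<tau> x - (a * of_real x + (\<Sum>n=1..N. b n * exp (\<i> * of_real (t n * x)))
            + (\<Sum>n=1..m. of_real (x powr \<beta> n) *
                 (c n / of_real (Gamma (\<beta> n + 1))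
                  + d n * (\<Sum>j=0..k n. of_nat (k n choose j) * of_real (Dj j (\<beta> n + 1))
                                      * of_real ((ln x) ^ (k n - j)))))))
          \<longlongrightarrow> 0) at_top)
     \<and>
     (\<forall>(E::real set) (N::nat) (b::nat \<Rightarrow> complex) (t::nat \<Rightarrow> real).
        closed E \<and> E \<in> null_sets lborel
        \<and> local_pseudofunction_bb
            (\<lambda>s. laplace \<tau> s - (\<Sum>n=1..N. b n / (s - \<i> * of_real (t n)))) (- E)
        \<and> (\<forall>u\<in>E. \<exists>M>0. \<forall>x>0.
              norm (integral {0..x} (\<lambda>y. \<tau> y * exp (- \<i> * of_real (u * y)))) < M)
        \<and> E \<inter> t ` {1..N} = {}
        \<longrightarrow>
        ((\<lambda>x. \<tau> x - (\<Sum>n=1..N. b n * exp (\<i> * of_real (t n * x)))) \<longlongrightarrow> 0) at_top)"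
proof (intro conjI allI impI)
  fix a :: complex and N :: nat and b :: "nat \<Rightarrow> complex" and t :: "nat \<Rightarrow> real" and c d :: "nat \<Rightarrow> complex"
  assume bb: "local_pseudofunction_bb
          (\<lambda>s. laplace \<tau> s - a / s\<^sup>2 - (\<Sum>n=1..N. b n / (s - \<i> * of_real (t n)))
               - (\<Sum>n=1..m. (c n + d n * (Ln (1 / s)) ^ k n) / s powr (of_real (\<beta> n + 1))))
          UNIV" (is "local_pseudofunction_bb ?F UNIV")
  \<comment> \<open>The asymptotic expression cut off at 0, as \<open>main_term\<close> demands; it
    agrees with the claimed one for x > 0, which is enough for the limit.\<close>
  define M where "M x = a * (if 0 < x then of_real x else 0)
     + (\<Sum>n=1..N. b n * (if 0 < x then exp (\<i> * of_real (t n * x)) else 0))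
     + (\<Sum>n=1..m. c n * (if 0 < x then power_log 0 (\<beta> n) x else 0) + d n * (if 0 < x then power_log (k n) (\<beta> n) x else 0))" for x
  \<comment> \<open>Left unsimplified, with the zeroth power of the logarithm, in the shape that the
    rules for \<open>main_term\<close> produce.\<close>
  define L where "L s = (a * (1 / s\<^sup>2) + (\<Sum>n=1..N. b n * (1 / (s - \<i> * of_real (t n))))
     + (\<Sum>n=1..m. c n * (Ln (1 / s) ^ 0 / s powr of_real (\<beta> n + 1)) + d n * (Ln (1 / s) ^ k n / s powr of_real (\<beta> n + 1))))" for s
  have mt: "main_term M L" unfolding M_def[abs_def] L_def[abs_def]
    by (intro main_term_add main_term_sum main_term_cmult main_term_linear main_term_exp main_term_power_log)
       (use beta_range in auto)
  have "((\<lambda>x. \<tau> x - M x) \<longlongrightarrow> 0) at_top"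
  proof (rule tauberian_main_term[OF loc_int slow vanish lap mt])
    show "(?F s) = laplace \<tau> s - L s" for s
      by (simp add: L_def add_divide_distrib)
    show "local_pseudofunction_bb ?F (- {})" using bb by simp
  qed auto
  then show "((\<lambda>x. \<tau> x - (a * of_real x + (\<Sum>n=1..N. b n * exp (\<i> * of_real (t n * x)))
            + (\<Sum>n=1..m. of_real (x powr \<beta> n) *
                 (c n / of_real (Gamma (\<beta> n + 1))
                  + d n * (\<Sum>j=0..k n. of_nat (k n choose j) * of_real (Dj j (\<beta> n + 1))
                                      * of_real ((ln x) ^ (k n - j)))))))
          \<longlongrightarrow> 0) at_top"
  proof (rule Lim_transform_eventually)
    show "\<forall>\<^sub>F x in at_top. \<tau> x - M x = \<tau> x - (a * of_real x + (\<Sum>n=1..N. b n * exp (\<i> * of_real (t n * x)))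
            + (\<Sum>n=1..m. of_real (x powr \<beta> n) *
                 (c n / of_real (Gamma (\<beta> n + 1))
                  + d n * (\<Sum>j=0..k n. of_nat (k n choose j) * of_real (Dj j (\<beta> n + 1))
                                      * of_real ((ln x) ^ (k n - j))))))"
      using eventually_gt_at_top[of 0]
    proof eventually_elim
      case (elim x)
      have "(\<Sum>n=1..m. c n * power_log 0 (\<beta> n) x + d n * power_log (k n) (\<beta> n) x) = 
         (\<Sum>n=1..m. of_real (x powr \<beta> n) *
                 (c n / of_real (Gamma (\<beta> n + 1))
                  + d n * (\<Sum>j=0..k n. of_nat (k n choose j) * of_real (Dj j (\<beta> n + 1))
                                      * of_real ((ln x) ^ (k n - j)))))"
        unfolding power_log_0 distrib_left
        by (intro sum.cong refl arg_cong2[where f = "(+)"]) (simp only: power_log_def mult_ac)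
      then show ?case using elim by (simp only: M_def if_True)
    qed
  qed
next
  fix E :: "real set" and N :: nat and b :: "nat \<Rightarrow> complex" and t :: "nat \<Rightarrow> real"
  assume hyp: "closed E \<and> E \<in> null_sets lborel
        \<and> local_pseudofunction_bb
            (\<lambda>s. laplace \<tau> s - (\<Sum>n=1..N. b n / (s - \<i> * of_real (t n)))) (- E)
        \<and> (\<forall>u\<in>E. \<exists>M>0. \<forall>x>0.
              norm (integral {0..x} (\<lambda>y. \<tau> y * exp (- \<i> * of_real (u * y)))) < M)
        \<and> E \<inter> t ` {1..N} = {}"
  let ?m = "\<lambda>x. \<Sum>n=1..N. b n * (if 0 < x then exp (\<i> * of_real (t n * x)) else 0)"
  have mt: "main_term ?m (\<lambda>s. \<Sum>n=1..N. b n * (1 / (s - \<i> * of_real (t n))))"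
    by (intro main_term_sum main_term_cmult main_term_exp)
  have mB: "norm (?m x) \<le> (\<Sum>n=1..N. norm (b n))" for x
    by (intro sum_norm_le) (simp add: norm_mult norm_exp_imaginary del: of_real_mult)
  have "((\<lambda>x. \<tau> x - ?m x) \<longlongrightarrow> 0) at_top"
  proof (rule tauberian_main_term[OF loc_int slow vanish lap mt])
    show "local_pseudofunction_bb (\<lambda>s. laplace \<tau> s - (\<Sum>n=1..N. b n / (s - \<i> * of_real (t n)))) (- E)" 
      "closed E" "E \<in> null_sets lborel" using hyp by auto
    show "laplace \<tau> s - (\<Sum>n=1..N. b n / (s - \<i> * of_real (t n))) = laplace \<tau> s - (\<Sum>n=1..N. b n * (1 / (s - \<i> * of_real (t n))))" for s
      by simp
    fix u assume u: "u \<in> E"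
    then obtain K where K: "\<forall>x>0. norm (integral {0..x} (\<lambda>y. \<tau> y * exp (- \<i> * of_real (u * y)))) < K" using hyp by blast
    \<comment> \<open>Condition (III): at a frequency in E every subtracted exponential has bounded
      partial transforms, so bound (II) passes to the difference.\<close>
    have "t n \<noteq> u" if "n \<in> {1..N}" for n using hyp u that by blast
    then obtain K' where K': "\<forall>x>0. norm (partial_transform ?m u x) \<le> K'"
      using partial_transform_exp_sum_bounded[of "{1..N}" t u b] by auto
    have "?m \<in> borel_measurable borel" using mt by (simp add: main_term_def)
    from partial_transform_diff_bounded[OF loc_int K this mB K']
    show "\<exists>M. \<forall>x>0. norm (partial_transform (\<lambda>x. \<tau> x - ?m x) u x) \<le> M" by blast
  qed
  then show "((\<lambda>x. \<tau> x - (\<Sum>n=1..N. b n * exp (\<i> * of_real (t n * x)))) \<longlongrightarrow> 0) at_top"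
  proof (rule Lim_transform_eventually)
    show "\<forall>\<^sub>F x in at_top. \<tau> x - ?m x = \<tau> x - (\<Sum>n=1..N. b n * exp (\<i> * of_real (t n * x)))"
      using eventually_gt_at_top[of 0] by eventually_elim simp
  qed
qed

end
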